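(* For every $r\ge 4$ and $\ell\ge 2$ there exist $K,c>0$ such that the following holds for all sufficiently large $n$ and all $t\ge K$. Given an $r$-graph $H$ with $n$ vertices and $tn^{r-1}$ edges, there exists a collection $\mathcal{S}$ of copies of $C^r_{2\ell}$ in $H$ such that for all $1\le j\le 2\ell$, $$\Delta_j(\mathcal{S})\le\frac{c|\mathcal{S}|(\log n)^{r-2}}{tn^{r-1}}\left(\left(\frac{t}{(\log n)^{r-2}}\right)^{-1}n^{-r+2+\frac{1}{2\ell-1}}\right)^{j-1}.$$
   Context: An $r$-graph is an $r$-uniform hypergraph. The linear cycle $C^r_k$ ($k\ge3$) has vertices $v_1,\dots,v_{k(r-1)}$ and edges $e_i=\{v_{(i-1)(r-1)},\dots,v_{i(r-1)}\}$, $1\le i\le k$, with $v_0=v_{k(r-1)}$. For a collection $\mathcal{S}$ of copies of $C^r_{2\ell}$ in $H$, $\Delta_j(\mathcal{S})$ is the maximum, over all sets $J$ of $j$ edges of $H$, of the number of members of $\mathcal{S}$ containing all edges of $J$. *)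

theory Defs
  imports Complex_Main
begin

definition r_graph :: "nat \<Rightarrow> 'a set \<Rightarrow> 'a set set \<Rightarrow> bool" where
  "r_graph r V E \<longleftrightarrow> finite V \<and> (\<forall>e\<in>E. e \<subseteq> V \<and> card e = r)"

text \<open>The vertex \<open>v\<^sub>m\<close> of the linear cycle is represented by the number \<open>m\<close>, for
  \<open>1 \<le> m \<le> k (r - 1)\<close>; the index \<open>0\<close> is identified with \<open>k (r - 1)\<close>.\<close>

definition lc_vertex :: "nat \<Rightarrow> nat \<Rightarrow> nat \<Rightarrow> nat" where
  "lc_vertex r k m = (if m = 0 then k * (r - 1) else m)"

definition lc_vertices :: "nat \<Rightarrow> nat \<Rightarrow> nat set" where
  "lc_vertices r k = {1..k * (r - 1)}"

definition lc_edge :: "nat \<Rightarrow> nat \<Rightarrow> nat \<Rightarrow> nat set" where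
  "lc_edge r k i = lc_vertex r k ` {(i - 1) * (r - 1)..i * (r - 1)}"

definition lc_edges :: "nat \<Rightarrow> nat \<Rightarrow> nat set set" where
  "lc_edges r k = lc_edge r k ` {1..k}"

text \<open>Copies are unlabelled subgraphs. Since a linear cycle has no isolated vertices, a copy
  is determined by, and represented by, its set of edges.\<close>

definition lc_copies :: "nat \<Rightarrow> nat \<Rightarrow> 'a set \<Rightarrow> 'a set set \<Rightarrow> 'a set set set" where
  "lc_copies r k V E =
     {C. C \<subseteq> E \<and> (\<exists>\<phi>. inj_on \<phi> (lc_vertices r k) \<and> \<phi> ` lc_vertices r k \<subseteq> V \<and>
                       C = (\<lambda>e. \<phi> ` e) ` lc_edges r k)}"

text \<open>For finite \<open>E\<close> the maximum is over a nonempty set exactly when \<open>j \<le> card E\<close>.\<close>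

definition max_codegree :: "'a set set \<Rightarrow> nat \<Rightarrow> 'a set set set \<Rightarrow> nat" where
  "max_codegree E j S = Max ((\<lambda>J. card {C \<in> S. J \<subseteq> C}) ` {J. J \<subseteq> E \<and> card J = j})"

end

theory Submission
  imports Defs "HOL-Library.FuncSet" "HOL-Analysis.Convex"
begin

text \<open>
  A balanced collection is built greedily, so it suffices to find a linear cycle of length \<open>2 l\<close>
  that avoids given families \<open>F j\<close> of forbidden \<open>j\<close>-sets of edges, \<open>j \<le> 2 l\<close>, which are not too
  large. First delete the edges lying in too many forbidden sets and pass to a subgraph in which
  every \<open>(r - 1)\<close>-subset of an edge has codegree of order \<open>t\<close>. Because \<open>r \<ge> 4\<close>, most edges then
  contain a pair of vertices whose codegree is at most \<open>O(n powr (-2/3))\<close> times the degree of either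
  vertex. The random walk that moves along such light pairs, weighted by codegree, is reversible.

  A closed walk of length \<open>2 l\<close>, weighted by its transition probabilities and with a hyperedge chosen
  through each of its steps, gives a linear cycle unless it repeats a vertex or two of its
  hyperedges clash; light pairs make the former rare and large codegrees the latter. Walks through
  a forbidden set are rare as well. If the remaining part of the closed walk consists of at least
  two gaps, this follows from the bound on one step. If it is a single gap from \<open>x\<close> to \<open>y\<close>, the
  transition density is bounded by the Cauchy--Schwarz inequality in terms of return densities at
  \<open>x\<close> and \<open>y\<close>, which are log-convex in the number of steps. No logarithm is lost.
\<close>

section \<open>Weighted sums over walks\<close>

text \<open>The power 2/3 is where \<open>r \<ge> 4\<close> enters. Call a pair light if its
  codegree is at most about a share 1/s of the degree of either vertex. Edges without a light pair
  number at most n s^(r-1), which has to stay below n^(r-1); so s may be at most n^((r-2)/(r-1)). On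
  the other side a light step has probability O(1/s) and density O(n/s), so a repeated vertex costs
  O(n/s^2), and s has to grow faster than the square root of n. For r = 3 these demands conflict; s
  = n^(2/3) meets both for all r from 4 on. The scale of the statement is that of a random
  hypergraph: with T = t n^(r-1) and q = t n^(r-2-1/(2l-1)), the product T q^(2l-1) equals t^(2l)
  n^(2l(r-2)), the expected order of the number of cycles. A prescribed set of j edges may then cost
  a density of order n^((j-1)/(2l-1)) in the rest of the walk. This is tight for j = 2l. Return
  densities may be large at single vertices. They are harmless because degree times return density,
  summed over the vertices, is again the total weight of closed walks, so that bad walks are
  compared with this total whatever its size.\<close>

fun walk_sum :: "'a set \<Rightarrow> (nat \<Rightarrow> 'a \<Rightarrow> 'a \<Rightarrow> real) \<Rightarrow> nat \<Rightarrow> 'a \<Rightarrow> 'a \<Rightarrow> real" where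
  "walk_sum U k 0 x y = (if x = y then 1 else 0)"
| "walk_sum U k (Suc n) x y = (\<Sum>z\<in>U. walk_sum U k n x z * k n z y)"

text \<open>\<open>walk_sum U k n\<close> is the product of the matrices
  \<open>k 0, ..., k (n - 1)\<close> over \<open>U\<close>. The kernel may change from step to step
  because single positions will carry a prescribed hyperedge or vertex; hence the second factor
  shifts the index by \<open>a\<close>.\<close>

lemma walk_sum_add:
  assumes "finite U" "y \<in> U"
  shows "walk_sum U k (a + b) x y =
    (\<Sum>z\<in>U. walk_sum U k a x z * walk_sum U (\<lambda>i. k (a + i)) b z y)"
  using assms(2)
proof (induction b arbitrary: y)
  case 0
  then show ?case using assms(1) by (simp add: sum.delta' if_distrib cong: if_cong)
next
  case (Suc b)
  have "walk_sum U k (a + Suc b) x y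
      = (\<Sum>v\<in>U. \<Sum>z\<in>U. walk_sum U k a x z * walk_sum U (\<lambda>i. k (a + i)) b z v * k (a + b) v y)"
    using Suc.IH by (simp add: sum_distrib_right)
  also have "\<dots> = (\<Sum>z\<in>U. \<Sum>v\<in>U. walk_sum U k a x z * walk_sum U (\<lambda>i. k (a + i)) b z v * k (a + b) v y)"
    by (rule sum.swap)
  also have "\<dots> = (\<Sum>z\<in>U. walk_sum U k a x z * walk_sum U (\<lambda>i. k (a + i)) (Suc b) z y)"
    by (simp add: sum_distrib_left mult.assoc)
  finally show ?case .
qed

lemma walk_sum_1:
  assumes "finite U" "x \<in> U"
  shows "walk_sum U k (Suc 0) x y = k 0 x y"
proof -
  have "walk_sum U k (Suc 0) x y = (\<Sum>z\<in>U. if x = z then k 0 z y else 0)"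
    unfolding walk_sum.simps by (intro sum.cong) auto
  then show ?thesis using assms by (simp add: sum.delta)
qed

lemma walk_sum_Suc_left:
  assumes "finite U" "x \<in> U" "y \<in> U"
  shows "walk_sum U k (Suc n) x y = (\<Sum>z\<in>U. k 0 x z * walk_sum U (\<lambda>i. k (Suc i)) n z y)"
proof -
  have "walk_sum U k (Suc 0 + n) x y = (\<Sum>z\<in>U. k 0 x z * walk_sum U (\<lambda>i. k (Suc i)) n z y)"
    unfolding walk_sum_add[OF assms(1,3)] walk_sum_1[OF assms(1,2)] by simp
  then show ?thesis by simp
qed

lemma walk_sum_cong:
  assumes "\<And>i x y. i < n \<Longrightarrow> k i x y = k' i x y"
  shows "walk_sum U k n x y = walk_sum U k' n x y"
  using assms
proof (induction n arbitrary: y)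
  case (Suc n)
  have "walk_sum U k n x z = walk_sum U k' n x z" for z
    by (rule Suc.IH) (use Suc.prems in auto)
  then show ?case using Suc.prems by simp
qed simp

lemma walk_sum_nonneg:
  assumes "\<And>i x y. 0 \<le> k i x y"
  shows "0 \<le> walk_sum U k n x y"
  by (induction n arbitrary: y) (auto intro!: sum_nonneg mult_nonneg_nonneg assms)

lemma walk_sum_mono:
  assumes "\<And>i x y. 0 \<le> k i x y" "\<And>i x y. k i x y \<le> k' i x y"
  shows "walk_sum U k n x y \<le> walk_sum U k' n x y"
proof (induction n arbitrary: y)
  case (Suc n)
  have "0 \<le> k' i x y" for i x y using assms order_trans by blast
  then show ?case
    using Suc by (auto intro!: sum_mono mult_mono walk_sum_nonneg assms)
qed simp

lemma walk_sum_row_le: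
  assumes "finite U" "x \<in> U" "\<And>i x y. 0 \<le> k i x y"
    and row: "\<And>i x. i < n \<Longrightarrow> x \<in> U \<Longrightarrow> (\<Sum>y\<in>U. k i x y) \<le> c i"
    and c: "\<And>i. 0 \<le> c i"
  shows "(\<Sum>y\<in>U. walk_sum U k n x y) \<le> (\<Prod>i<n. c i)"
  using row
proof (induction n)
  case 0
  then show ?case using assms(1,2) by simp
next
  case (Suc n)
  have "(\<Sum>y\<in>U. walk_sum U k (Suc n) x y) = (\<Sum>z\<in>U. walk_sum U k n x z * (\<Sum>y\<in>U. k n z y))"
    unfolding walk_sum.simps sum_distrib_left by (rule sum.swap)
  also have "\<dots> \<le> (\<Sum>z\<in>U. walk_sum U k n x z * c n)"
    by (intro sum_mono mult_left_mono Suc.prems walk_sum_nonneg assms) auto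
  also have "\<dots> = (\<Sum>z\<in>U. walk_sum U k n x z) * c n"
    by (simp add: sum_distrib_right)
  also have "\<dots> \<le> (\<Prod>i<n. c i) * c n"
    by (intro mult_right_mono Suc.IH Suc.prems c) auto
  finally show ?case by simp
qed

lemma walk_sum_row_add_le:
  assumes "finite U" "x \<in> U" "\<And>i x y. 0 \<le> k i x y"
    and "(\<Sum>z\<in>U. walk_sum U k a x z) \<le> A"
    and "\<And>z. z \<in> U \<Longrightarrow> (\<Sum>y\<in>U. walk_sum U (\<lambda>i. k (a + i)) b z y) \<le> B" and "0 \<le> B"
  shows "(\<Sum>y\<in>U. walk_sum U k (a + b) x y) \<le> A * B"
proof -
  have "(\<Sum>y\<in>U. walk_sum U k (a + b) x y)
     = (\<Sum>y\<in>U. \<Sum>z\<in>U. walk_sum U k a x z * walk_sum U (\<lambda>i. k (a + i)) b z y)"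
    using walk_sum_add[OF assms(1)] by (intro sum.cong) auto
  also have "\<dots> = (\<Sum>z\<in>U. walk_sum U k a x z * (\<Sum>y\<in>U. walk_sum U (\<lambda>i. k (a + i)) b z y))"
    by (subst sum.swap) (simp add: sum_distrib_left)
  also have "\<dots> \<le> (\<Sum>z\<in>U. walk_sum U k a x z * B)"
    by (intro sum_mono mult_left_mono assms walk_sum_nonneg)
  also have "\<dots> \<le> A * B"
    using assms(4,6) by (simp add: sum_distrib_right[symmetric] mult_right_mono)
  finally show ?thesis .
qed

section \<open>Walk sums as sums over explicit walks\<close>

lemma sum_PiE_lessThan_Suc:
  fixes F :: "(nat \<Rightarrow> 'a) \<Rightarrow> real"
  shows "(\<Sum>f\<in>PiE {..<Suc n} (\<lambda>_. U). F f) = (\<Sum>y\<in>U. \<Sum>f\<in>PiE {..<n} (\<lambda>_. U). F (f(n := y)))"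
proof -
  have inj: "inj_on (\<lambda>(y, g). g(n := y)) (U \<times> PiE {..<n} (\<lambda>_. U))"
    using inj_combinator[of n "{..<n}" "\<lambda>_. U"] by simp
  have "PiE {..<Suc n} (\<lambda>_. U) = (\<lambda>(y, g). g(n := y)) ` (U \<times> PiE {..<n} (\<lambda>_. U))"
    by (simp add: lessThan_Suc PiE_insert_eq)
  then have "(\<Sum>f\<in>PiE {..<Suc n} (\<lambda>_. U). F f)
      = (\<Sum>p\<in>U \<times> PiE {..<n} (\<lambda>_. U). F (case p of (y, g) \<Rightarrow> g(n := y)))"
    using sum.reindex[OF inj, of F] by (simp add: o_def)
  then show ?thesis
    by (simp add: sum.cartesian_product case_prod_unfold)
qed

lemma sum_open_walks:
  assumes "finite U" "x \<in> U" "y \<in> U"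
  shows "(\<Sum>f | f \<in> PiE {..<Suc n} (\<lambda>_. U) \<and> f 0 = x \<and> f n = y. \<Prod>i<n. k i (f i) (f (Suc i)))
    = walk_sum U k n x y"
  using assms(3)
proof (induction n arbitrary: y)
  case 0
  have "{f. f \<in> PiE {..<Suc 0} (\<lambda>_. U) \<and> f 0 = x \<and> f 0 = y}
      = (if x = y then {(\<lambda>i. undefined)(0 := x)} else {})"
    using assms(2) by (auto simp: lessThan_Suc PiE_def extensional_def fun_eq_iff)
  then show ?case by simp
next
  case (Suc n)
  let ?P = "\<lambda>n. PiE {..<Suc n} (\<lambda>_. U)"
  have fin: "finite (?P n)" for n using assms(1) by (intro finite_PiE) auto
  have "(\<Sum>f | f \<in> ?P (Suc n) \<and> f 0 = x \<and> f (Suc n) = y. \<Prod>i<Suc n. k i (f i) (f (Suc i)))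
      = (\<Sum>f\<in>?P (Suc n). if f 0 = x \<and> f (Suc n) = y then \<Prod>i<Suc n. k i (f i) (f (Suc i)) else 0)"
    by (rule sum.inter_filter[OF fin])
  also have "\<dots> = (\<Sum>v\<in>U. \<Sum>f\<in>?P n. if f 0 = x \<and> v = y
        then (\<Prod>i<n. k i (f i) (f (Suc i))) * k n (f n) y else 0)"
    unfolding sum_PiE_lessThan_Suc
    by (intro sum.cong refl if_cong) (auto intro!: prod.cong)
  also have "\<dots> = (\<Sum>f\<in>?P n. \<Sum>v\<in>U. if f 0 = x \<and> v = y
        then (\<Prod>i<n. k i (f i) (f (Suc i))) * k n (f n) y else 0)"
    by (rule sum.swap)
  also have "\<dots> = (\<Sum>f\<in>?P n. if f 0 = x then (\<Prod>i<n. k i (f i) (f (Suc i))) * k n (f n) y else 0)"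
    using Suc.prems assms(1) by (intro sum.cong refl) (auto simp: sum.delta')
  also have "\<dots> = (\<Sum>f\<in>?P n. \<Sum>z\<in>U. if f 0 = x \<and> f n = z
       then (\<Prod>i<n. k i (f i) (f (Suc i))) * k n z y else 0)"
  proof (intro sum.cong refl)
    fix f assume "f \<in> ?P n"
    then have "f n \<in> U" by (auto simp: PiE_def Pi_def)
    then show "(if f 0 = x then (\<Prod>i<n. k i (f i) (f (Suc i))) * k n (f n) y else 0)
      = (\<Sum>z\<in>U. if f 0 = x \<and> f n = z then (\<Prod>i<n. k i (f i) (f (Suc i))) * k n z y else 0)"
      using assms(1) by (cases "f 0 = x") (simp_all add: sum.delta)
  qed
  also have "\<dots> = (\<Sum>z\<in>U. \<Sum>f\<in>?P n. if f 0 = x \<and> f n = z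
       then (\<Prod>i<n. k i (f i) (f (Suc i))) * k n z y else 0)"
    by (rule sum.swap)
  also have "\<dots> = (\<Sum>z\<in>U. walk_sum U k n x z * k n z y)"
  proof (intro sum.cong refl)
    fix z assume "z \<in> U"
    show "(\<Sum>f\<in>?P n. if f 0 = x \<and> f n = z then (\<Prod>i<n. k i (f i) (f (Suc i))) * k n z y else 0)
      = walk_sum U k n x z * k n z y"
      unfolding Suc.IH[OF \<open>z \<in> U\<close>, symmetric] sum.inter_filter[OF fin] sum_distrib_right
      by (intro sum.cong) auto
  qed
  finally show ?case by simp
qed

text \<open>The trace of a matrix product expands into closed walks, with \<open>Suc i mod n\<close>
  closing the walk. Cycles are read off from the explicit walks, while the estimates are made on the
  trace.\<close>

lemma sum_closed_walks:
  assumes "finite U" "0 < n"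
  shows "(\<Sum>f\<in>PiE {..<n} (\<lambda>_. U). \<Prod>i<n. k i (f i) (f (Suc i mod n)))
    = (\<Sum>x\<in>U. walk_sum U k n x x)"
proof -
  obtain m where n: "n = Suc m" using assms(2) gr0_implies_Suc by blast
  let ?P = "PiE {..<Suc m} (\<lambda>_. U)"
  have fin: "finite ?P" using assms(1) by (intro finite_PiE) auto
  let ?w = "\<lambda>f x y. (\<Prod>i<m. k i (f i) (f (Suc i))) * k m y x"
  have "(\<Sum>f\<in>?P. \<Prod>i<Suc m. k i (f i) (f (Suc i mod Suc m)))
     = (\<Sum>f\<in>?P. ?w f (f 0) (f m))"
    by (intro sum.cong refl) simp
  also have "\<dots> = (\<Sum>f\<in>?P. \<Sum>x\<in>U. \<Sum>y\<in>U. if f 0 = x \<and> f m = y then ?w f x y else 0)"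
  proof (intro sum.cong refl)
    fix f assume "f \<in> ?P"
    then have *: "f 0 \<in> U" "f m \<in> U" by (auto simp: PiE_def Pi_def)
    have "(\<Sum>x\<in>U. \<Sum>y\<in>U. if f 0 = x \<and> f m = y then ?w f x y else 0)
      = (\<Sum>x\<in>U. if f 0 = x then \<Sum>y\<in>U. if f m = y then ?w f x y else 0 else 0)"
      by (intro sum.cong refl) auto
    also have "\<dots> = ?w f (f 0) (f m)"
      using * assms(1) by (simp add: sum.delta)
    finally show "?w f (f 0) (f m) = (\<Sum>x\<in>U. \<Sum>y\<in>U. if f 0 = x \<and> f m = y then ?w f x y else 0)"
      by simp
  qed
  also have "\<dots> = (\<Sum>x\<in>U. \<Sum>y\<in>U. \<Sum>f\<in>?P. if f 0 = x \<and> f m = y then ?w f x y else 0)"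
    by (subst sum.swap, rule sum.cong[OF refl], rule sum.swap)
  also have "\<dots> = (\<Sum>x\<in>U. \<Sum>y\<in>U. walk_sum U k m x y * k m y x)"
  proof (intro sum.cong refl)
    fix x y assume xy: "x \<in> U" "y \<in> U"
    show "(\<Sum>f\<in>?P. if f 0 = x \<and> f m = y then ?w f x y else 0) = walk_sum U k m x y * k m y x"
      unfolding sum_open_walks[OF assms(1) xy, symmetric] sum.inter_filter[OF fin] sum_distrib_right
      by (intro sum.cong) auto
  qed
  finally show ?thesis by (simp add: n)
qed

text \<open>Cyclic invariance of the trace: a prescribed position, or the position of a repeated
  vertex, can be moved to 0.\<close>

lemma walk_sum_rotate:
  assumes "finite U" "s < n"
  shows "(\<Sum>x\<in>U. walk_sum U k n x x) = (\<Sum>x\<in>U. walk_sum U (\<lambda>i. k ((s + i) mod n)) n x x)"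
proof -
  let ?k = "\<lambda>i. k ((s + i) mod n)"
  have n: "n = s + (n - s)" "n = (n - s) + s" using assms(2) by auto
  have "(\<Sum>x\<in>U. walk_sum U k n x x)
    = (\<Sum>x\<in>U. \<Sum>z\<in>U. walk_sum U k s x z * walk_sum U (\<lambda>i. k (s + i)) (n - s) z x)"
    using walk_sum_add[OF assms(1), of _ k s "n - s"] n(1) by (intro sum.cong) auto
  also have "\<dots> = (\<Sum>z\<in>U. \<Sum>x\<in>U. walk_sum U k s x z * walk_sum U (\<lambda>i. k (s + i)) (n - s) z x)"
    by (rule sum.swap)
  also have "\<dots> = (\<Sum>z\<in>U. \<Sum>x\<in>U. walk_sum U ?k (n - s) z x * walk_sum U (\<lambda>i. ?k (n - s + i)) s x z)"
  proof (intro sum.cong refl)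
    fix z x
    have "walk_sum U (\<lambda>i. k (s + i)) (n - s) z x = walk_sum U ?k (n - s) z x"
      by (rule walk_sum_cong) auto
    moreover have "walk_sum U k s x z = walk_sum U (\<lambda>i. ?k (n - s + i)) s x z"
      using assms(2) by (intro walk_sum_cong) (simp add: add.commute add.left_commute)
    ultimately show "walk_sum U k s x z * walk_sum U (\<lambda>i. k (s + i)) (n - s) z x
      = walk_sum U ?k (n - s) z x * walk_sum U (\<lambda>i. ?k (n - s + i)) s x z" by simp
  qed
  also have "\<dots> = (\<Sum>z\<in>U. walk_sum U ?k n z z)"
    using walk_sum_add[OF assms(1), of _ ?k "n - s" s] n(2) by (intro sum.cong) auto
  finally show ?thesis .
qed

section \<open>Reversible random walks\<close>

text \<open>By log-convexity the ratios \<open>v a / v (Suc a)\<close> do not increase with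
  \<open>a\<close>. With \<open>g\<close> the ratio at \<open>a\<close> this gives
  \<open>v 1 \<ge> g ^ (a - 1) * v a\<close> and \<open>v a \<le> g ^ (l - a) * v l\<close>, and
  \<open>g\<close> cancels when the two are combined. Taking powers with exponent
  \<open>l - 1\<close> avoids roots.\<close>

lemma log_convex_interpolation:
  fixes v :: "nat \<Rightarrow> real"
  assumes pos: "\<And>a. 0 < v a"
    and lc: "\<And>a. 1 \<le> a \<Longrightarrow> v (Suc a) ^ 2 \<le> v a * v (Suc (Suc a))"
    and a: "1 \<le> a" "a \<le> l"
  shows "v a ^ (l - 1) \<le> v 1 ^ (l - a) * v l ^ (a - 1)"
proof -
  have ratio: "v a / v (Suc a) \<le> v b / v (Suc b)" if "1 \<le> b" "b \<le> a" for a b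
    using that(2)
  proof (induction a rule: dec_induct)
    case (step a)
    have "v (Suc a) / v (Suc (Suc a)) \<le> v a / v (Suc a)"
      using lc[of a] step pos[of "Suc a"] pos[of "Suc (Suc a)"] that(1)
      by (simp add: field_simps power2_eq_square)
    then show ?case using step by linarith
  qed simp
  define g where "g = v a / v (Suc a)"
  have g: "0 < g" using pos by (simp add: g_def)
  have "v 1 \<ge> g ^ (a - 1) * v a"
  proof -
    have "v b \<ge> g ^ (a - b) * v a" if "1 \<le> b" "b \<le> a" for b
      using that(2,1)
    proof (induction b rule: inc_induct)
      case (step b)
      have "g ^ (a - b) * v a = g * (g ^ (a - Suc b) * v a)"
        using step by (simp add: Suc_diff_Suc flip: power_Suc mult.assoc)
      also have "\<dots> \<le> g * v (Suc b)"
        using step g by (intro mult_left_mono) auto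
      also have "\<dots> \<le> v b / v (Suc b) * v (Suc b)"
        unfolding g_def using step pos[of "Suc b"] by (intro mult_right_mono ratio) auto
      also have "\<dots> = v b" using pos[of "Suc b"] by simp
      finally show ?case .
    qed simp
    then show ?thesis using a by simp
  qed
  then have 1: "v a \<le> v 1 / g ^ (a - 1)" using g by (simp add: field_simps)
  have "v a \<le> g ^ (c - a) * v c" if "a \<le> c" for c
    using that
  proof (induction c rule: dec_induct)
    case (step c)
    have "v a \<le> g ^ (c - a) * v c" by (rule step)
    also have "v c = v c / v (Suc c) * v (Suc c)" using pos[of "Suc c"] by simp
    also have "g ^ (c - a) * \<dots> \<le> g ^ (c - a) * (g * v (Suc c))"
      unfolding g_def using step a pos g unfolding g_def
      by (intro mult_left_mono mult_right_mono ratio) (auto intro: less_imp_le)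
    also have "\<dots> = g ^ (Suc c - a) * v (Suc c)"
      using step by (simp add: Suc_diff_le)
    finally show ?case .
  qed simp
  then have 2: "v a \<le> g ^ (l - a) * v l" using a by simp
  have "v a ^ (l - 1) = v a ^ (l - a) * v a ^ (a - 1)"
    using a by (simp flip: power_add)
  also have "\<dots> \<le> (v 1 / g ^ (a - 1)) ^ (l - a) * (g ^ (l - a) * v l) ^ (a - 1)"
    using 1 2 pos[of a] g pos[of 1] by (intro mult_mono power_mono) (auto intro: less_imp_le)
  also have "\<dots> = v 1 ^ (l - a) * v l ^ (a - 1)"
    using g by (simp add: power_divide power_mult_distrib mult.commute flip: power_mult)
  finally show ?thesis .
qed

locale weighted_graph =
  fixes U :: "'a set" and w :: "'a \<Rightarrow> 'a \<Rightarrow> real"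
  assumes fin: "finite U"
    and sym: "w x y = w y x"
    and nonneg: "0 \<le> w x y"
    and deg_pos: "x \<in> U \<Longrightarrow> 0 < (\<Sum>y\<in>U. w x y)"
begin

definition deg :: "'a \<Rightarrow> real" where "deg x = (\<Sum>y\<in>U. w x y)"

definition vol :: real where "vol = (\<Sum>x\<in>U. deg x)"

definition step :: "'a \<Rightarrow> 'a \<Rightarrow> real" where "step x y = w x y / deg x"

definition prob :: "nat \<Rightarrow> 'a \<Rightarrow> 'a \<Rightarrow> real" where "prob = walk_sum U (\<lambda>_. step)"

text \<open>The density of the \<open>n\<close>-step transition with respect to the stationary
  distribution \<open>deg y / vol\<close>. In this normalization reversibility is plain symmetry,
  and composition is an inner product in the L2 space of that distribution.\<close>

definition dens :: "nat \<Rightarrow> 'a \<Rightarrow> 'a \<Rightarrow> real" where "dens n x y = vol * prob n x y / deg y"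

lemma deg_gt_0: "x \<in> U \<Longrightarrow> 0 < deg x"
  using deg_pos by (simp add: deg_def)

lemma deg_nonneg: "0 \<le> deg x"
  unfolding deg_def by (intro sum_nonneg nonneg)

lemma vol_nonneg: "0 \<le> vol"
  unfolding vol_def by (intro sum_nonneg deg_nonneg)

lemma vol_gt_0: "x \<in> U \<Longrightarrow> 0 < vol"
  unfolding vol_def using fin deg_gt_0 by (auto intro!: sum_pos)

lemma step_nonneg: "0 \<le> step x y"
  unfolding step_def by (intro divide_nonneg_nonneg nonneg deg_nonneg)

lemma sum_step: "x \<in> U \<Longrightarrow> (\<Sum>y\<in>U. step x y) = 1"
  using deg_gt_0[of x] by (simp add: step_def deg_def flip: sum_divide_distrib)

lemma prob_nonneg: "0 \<le> prob n x y"
  unfolding prob_def by (intro walk_sum_nonneg step_nonneg)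

lemma dens_nonneg: "0 \<le> dens n x y"
  unfolding dens_def by (intro divide_nonneg_nonneg mult_nonneg_nonneg vol_nonneg prob_nonneg deg_nonneg)

lemma sum_prob: "x \<in> U \<Longrightarrow> (\<Sum>y\<in>U. prob n x y) = 1"
proof (induction n)
  case 0
  then show ?case using fin by (simp add: prob_def)
next
  case (Suc n)
  have "(\<Sum>y\<in>U. prob (Suc n) x y) = (\<Sum>z\<in>U. prob n x z * (\<Sum>y\<in>U. step z y))"
    unfolding prob_def walk_sum.simps sum_distrib_left by (rule sum.swap)
  also have "\<dots> = (\<Sum>z\<in>U. prob n x z)" by (intro sum.cong) (auto simp: sum_step)
  finally show ?case using Suc by simp
qed

lemma prob_add: "y \<in> U \<Longrightarrow> prob (a + b) x y = (\<Sum>z\<in>U. prob a x z * prob b z y)"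
  using walk_sum_add[OF fin, of y "\<lambda>_. step" a b x] by (simp add: prob_def)

lemma prob_1: "x \<in> U \<Longrightarrow> prob (Suc 0) x y = step x y"
  unfolding prob_def by (rule walk_sum_1[OF fin])

lemma prob_Suc: "prob (Suc n) x y = (\<Sum>z\<in>U. prob n x z * step z y)"
  by (simp add: prob_def)

lemma deg_step: "x \<in> U \<Longrightarrow> deg x * step x y = w x y"
  using deg_gt_0[of x] by (simp add: step_def)

lemma prob_reversible:
  assumes "x \<in> U" "y \<in> U"
  shows "deg x * prob n x y = deg y * prob n y x"
  using assms
proof (induction n arbitrary: x y)
  case 0
  then show ?case by (simp add: prob_def)
next
  case (Suc n)
  have "deg x * prob (Suc n) x y = (\<Sum>z\<in>U. (deg x * prob n x z) * step z y)"
    by (simp add: prob_Suc sum_distrib_left mult.assoc)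
  also have "\<dots> = (\<Sum>z\<in>U. deg z * prob n z x * step z y)"
    using Suc by (intro sum.cong) auto
  also have "\<dots> = (\<Sum>z\<in>U. deg y * (step y z * prob n z x))"
  proof (intro sum.cong refl)
    fix z assume "z \<in> U"
    then have "deg z * step z y = deg y * step y z"
      using Suc.prems by (simp add: deg_step sym)
    then show "deg z * prob n z x * step z y = deg y * (step y z * prob n z x)"
      by (simp add: algebra_simps)
  qed
  also have "\<dots> = deg y * prob (1 + n) y x"
    using Suc.prems by (subst prob_add) (auto simp: prob_1 sum_distrib_left)
  finally show ?case by simp
qed

lemma dens_sym: "x \<in> U \<Longrightarrow> y \<in> U \<Longrightarrow> dens n x y = dens n y x"
  using prob_reversible[of x y n] deg_gt_0[of x] deg_gt_0[of y]
  by (simp add: dens_def field_simps)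

lemma dens_add:
  assumes "x \<in> U" "y \<in> U"
  shows "dens (a + b) x y = (\<Sum>z\<in>U. dens a x z * dens b z y * (deg z / vol))"
proof -
  have "dens (a + b) x y = (\<Sum>z\<in>U. vol * (prob a x z * prob b z y) / deg y)"
    unfolding dens_def prob_add[OF assms(2)] by (simp add: sum_distrib_left sum_divide_distrib)
  also have "\<dots> = (\<Sum>z\<in>U. dens a x z * dens b z y * (deg z / vol))"
  proof (intro sum.cong refl)
    fix z assume z: "z \<in> U"
    show "vol * (prob a x z * prob b z y) / deg y = dens a x z * dens b z y * (deg z / vol)"
      using deg_gt_0[OF z] vol_gt_0[OF z] by (simp add: dens_def field_simps)
  qed
  finally show ?thesis .
qed

lemma sqrt_weight: "(sqrt (deg z / vol))\<^sup>2 = deg z / vol"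
  using deg_nonneg vol_nonneg by simp

lemma dens_diag: "x \<in> U \<Longrightarrow> dens (a + a) x x = (\<Sum>z\<in>U. (dens a x z * sqrt (deg z / vol))\<^sup>2)"
proof -
  assume x: "x \<in> U"
  have "dens a x z * dens a z x * (deg z / vol) = (dens a x z * sqrt (deg z / vol))\<^sup>2" if "z \<in> U" for z
    unfolding power_mult_distrib sqrt_weight dens_sym[OF that x, of a]
    by (simp add: power2_eq_square)
  then show ?thesis
    unfolding dens_add[OF x x] by (intro sum.cong) auto
qed

text \<open>Cut the walk after \<open>a\<close> steps and reverse the second part: the density is
  the inner product of \<open>dens a x\<close> and \<open>dens b y\<close>, whose squared norms are
  the diagonal densities. The factors \<open>sqrt (deg z / vol)\<close> turn the weighted inner
  product into a plain sum.\<close>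

lemma dens_Cauchy_Schwarz:
  assumes "x \<in> U" "y \<in> U"
  shows "(dens (a + b) x y)\<^sup>2 \<le> dens (a + a) x x * dens (b + b) y y"
proof -
  let ?s = "\<lambda>z. sqrt (deg z / vol)"
  have "dens (a + b) x y = (\<Sum>z\<in>U. (dens a x z * ?s z) * (dens b y z * ?s z))"
    unfolding dens_add[OF assms]
  proof (intro sum.cong refl)
    fix z assume "z \<in> U"
    then have "dens b z y = dens b y z" using dens_sym assms by blast
    moreover have "(dens a x z * ?s z) * (dens b y z * ?s z) = dens a x z * dens b y z * (?s z)\<^sup>2"
      unfolding power2_eq_square by (simp only: mult_ac)
    ultimately show "dens a x z * dens b z y * (deg z / vol) = (dens a x z * ?s z) * (dens b y z * ?s z)"
      by (simp only: sqrt_weight)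
  qed
  then show ?thesis
    using Cauchy_Schwarz_ineq_sum[of "\<lambda>z. dens a x z * ?s z" "\<lambda>z. dens b y z * ?s z" U]
    by (simp only: dens_diag[OF assms(1)] dens_diag[OF assms(2)])
qed

text \<open>\<open>dens a x\<close> has integral 1 for the stationary distribution, a probability
  measure, so its L2 norm is at least 1. This permits inserting a return density as a factor into
  any upper bound.\<close>

lemma one_le_dens_diag:
  assumes "x \<in> U"
  shows "1 \<le> dens (a + a) x x"
proof -
  let ?s = "\<lambda>z. sqrt (deg z / vol)"
  have "(\<Sum>z\<in>U. (dens a x z * ?s z) * ?s z) = (\<Sum>z\<in>U. prob a x z)"
  proof (intro sum.cong refl)
    fix z assume z: "z \<in> U"
    have "(dens a x z * ?s z) * ?s z = dens a x z * (?s z)\<^sup>2"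
      unfolding power2_eq_square by (simp only: mult_ac)
    then have "(dens a x z * ?s z) * ?s z = dens a x z * (deg z / vol)"
      by (simp only: sqrt_weight)
    then show "(dens a x z * ?s z) * ?s z = prob a x z"
      using deg_gt_0[OF z] vol_gt_0[OF z] by (simp add: dens_def)
  qed
  then have 1: "(\<Sum>z\<in>U. (dens a x z * ?s z) * ?s z) = 1" using sum_prob[OF assms] by simp
  have 2: "(\<Sum>z\<in>U. (?s z)\<^sup>2) = 1"
    unfolding sqrt_weight using vol_gt_0[OF assms]
    by (simp add: vol_def flip: sum_divide_distrib)
  show ?thesis
    using Cauchy_Schwarz_ineq_sum[of "\<lambda>z. dens a x z * ?s z" ?s U]
    unfolding 1 2 dens_diag[OF assms] by simp
qed

lemma prob_le:
  assumes "\<And>x y. x \<in> U \<Longrightarrow> y \<in> U \<Longrightarrow> step x y \<le> \<rho>" "x \<in> U" "y \<in> U" "1 \<le> n"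
  shows "prob n x y \<le> \<rho>"
proof -
  obtain m where n: "n = Suc m" using assms(4) by (cases n) auto
  have "prob n x y \<le> (\<Sum>z\<in>U. prob m x z * \<rho>)"
    unfolding n prob_Suc by (intro sum_mono mult_left_mono assms prob_nonneg)
  also have "\<dots> = \<rho>" by (simp add: sum_prob[OF assms(2)] flip: sum_distrib_right)
  finally show ?thesis .
qed

lemma dens_le:
  assumes "\<And>x y. x \<in> U \<Longrightarrow> y \<in> U \<Longrightarrow> vol * step x y / deg y \<le> X" "x \<in> U" "y \<in> U" "1 \<le> n"
  shows "dens n x y \<le> X"
proof -
  obtain m where n: "n = Suc m" using assms(4) by (cases n) auto
  have "dens n x y = (\<Sum>z\<in>U. prob m x z * (vol * step z y / deg y))"
    unfolding n dens_def prob_Suc by (simp add: sum_distrib_left sum_divide_distrib algebra_simps)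
  also have "\<dots> \<le> (\<Sum>z\<in>U. prob m x z * X)"
    by (intro sum_mono mult_left_mono assms prob_nonneg)
  also have "\<dots> = X" by (simp add: sum_prob[OF assms(2)] flip: sum_distrib_right)
  finally show ?thesis .
qed

text \<open>Cauchy-Schwarz with parts of \<open>a\<close> and \<open>a + 2\<close> steps makes the
  even return densities log-convex in \<open>a\<close>. The interpolation starts at two steps, a
  length to which the one-step density bound applies.\<close>

lemma dens_diag_interpolation:
  assumes "x \<in> U" "1 \<le> a" "a \<le> l"
  shows "dens (a + a) x x ^ (l - 1) \<le> dens 2 x x ^ (l - a) * dens (l + l) x x ^ (a - 1)"
proof -
  have "dens (Suc a + Suc a) x x ^ 2 \<le> dens (a + a) x x * dens (Suc (Suc a) + Suc (Suc a)) x x" for a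
  proof -
    have "Suc a + Suc a = a + Suc (Suc a)" by simp
    then show ?thesis using dens_Cauchy_Schwarz[OF assms(1) assms(1), of a "Suc (Suc a)"] by metis
  qed
  moreover have "0 < dens (a + a) x x" for a
    using one_le_dens_diag[OF assms(1), of a] by linarith
  ultimately have "dens (a + a) x x ^ (l - 1) \<le> dens (1 + 1) x x ^ (l - a) * dens (l + l) x x ^ (a - 1)"
    using log_convex_interpolation[of "\<lambda>a. dens (a + a) x x" a l] assms(2,3) by blast
  then show ?thesis by (simp add: numeral_2_eq_2)
qed

text \<open>The Cauchy--Schwarz inequality moves the density to the diagonal, where it is log-convex in the
  number of steps and at least \<open>1\<close>.\<close>

lemma dens_gap_le:
  assumes X: "\<And>x y. x \<in> U \<Longrightarrow> y \<in> U \<Longrightarrow> vol * step x y / deg y \<le> X" "1 \<le> X"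
    and xy: "x \<in> U" "y \<in> U" and k: "2 \<le> k" "k \<le> 2 * l" and l: "2 \<le> l"
  shows "dens k x y \<le> X powr (real (l - k div 2) / real (l - 1)) * (dens (l + l) x x + dens (l + l) y y)"
proof -
  let ?u = "\<lambda>z. dens (l + l) z z" and ?p = "\<lambda>a. X powr (real (l - a) / real (l - 1))"
  define u where "u = max (?u x) (?u y)"
  \<comment> \<open>The gap is cut into parts of \<open>a\<close> and \<open>k - a\<close> steps,
    which differ by at most one and lie between \<open>a\<close> and \<open>l\<close>. As
    \<open>X \<ge> 1\<close>, the exponent of the shorter part serves for both.\<close>
  define a where "a = k div 2"
  have u: "1 \<le> ?u x" "1 \<le> ?u y" using one_le_dens_diag xy by auto
  have diag: "dens (b + b) z z \<le> ?p a * u" if z: "z \<in> {x, y}" and b: "a \<le> b" "b \<le> l" for z b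
  proof -
    have zU: "z \<in> U" and zu: "?u z \<le> u" and zu1: "1 \<le> ?u z" using z xy u by (auto simp: u_def)
    have a1: "1 \<le> a" using k by (auto simp: a_def)
    have "dens (b + b) z z ^ (l - 1) \<le> dens 2 z z ^ (l - b) * ?u z ^ (b - 1)"
      by (rule dens_diag_interpolation) (use zU a1 b in auto)
    also have "\<dots> \<le> X ^ (l - b) * ?u z ^ (l - 1)"
      using dens_le[OF X(1) zU zU, of 2] zu1 b X(2) dens_nonneg
      by (intro mult_mono power_mono power_increasing) auto
    also have "\<dots> \<le> X ^ (l - a) * u ^ (l - 1)"
      using zu zu1 b X(2) by (intro mult_mono power_mono power_increasing) auto
    also have "\<dots> = (?p a * u) ^ (l - 1)"
    proof -
      have "?p a ^ (l - 1) = X ^ (l - a)"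
        using X(2) l by (simp add: powr_powr flip: powr_realpow)
      then show ?thesis by (simp add: power_mult_distrib)
    qed
    finally show ?thesis
      using l X(2) u by (subst (asm) power_mono_iff) (auto simp: dens_nonneg u_def)
  qed
  have ka: "k = a + (k - a)" "a \<le> k - a" "k - a \<le> l" "a \<le> l" using k by (auto simp: a_def)
  have "(dens k x y)\<^sup>2 \<le> dens (a + a) x x * dens (k - a + (k - a)) y y"
    using dens_Cauchy_Schwarz[OF xy, of a "k - a"] ka(1) by simp
  also have "\<dots> \<le> (?p a * u) * (?p a * u)"
    using ka u by (intro mult_mono diag dens_nonneg) (auto simp: u_def)
  also have "\<dots> = (?p a * u)\<^sup>2" by (simp only: power2_eq_square)
  finally have "dens k x y \<le> ?p a * u"
    by (rule power2_le_imp_le) (use u in \<open>simp add: u_def\<close>)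
  also have "\<dots> \<le> ?p a * (?u x + ?u y)"
    using u by (intro mult_left_mono) (auto simp: u_def)
  finally show ?thesis by (simp add: a_def)
qed

end

section \<open>Codegrees and light pairs\<close>

definition codeg :: "'a set set \<Rightarrow> 'a set \<Rightarrow> nat" where
  "codeg E Q = card {e \<in> E. Q \<subseteq> e}"

lemma finite_maximizer:
  fixes f :: "'b \<Rightarrow> real"
  assumes "finite A" "A \<noteq> {}"
  obtains x where "x \<in> A" "\<And>y. y \<in> A \<Longrightarrow> f y \<le> f x"
proof -
  have "Max (f ` A) \<in> f ` A" using assms by (intro Max_in) auto
  then obtain x where "x \<in> A" "f x = Max (f ` A)" by auto
  then show ?thesis using assms by (intro that[of x]) auto
qed

lemma card_subsets_le_power:
  assumes "finite A"
  shows "card {f. f \<subseteq> A \<and> card f = k} \<le> card A ^ k"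
  using assms by (cases "k \<le> card A") (auto simp: n_subsets binomial_le_pow binomial_eq_0)

text \<open>Instead of deleting edges repeatedly, take a subgraph that maximizes the number of edges
  minus \<open>\<theta>\<close> times the size of the shadow \<open>sh\<close>. A shadow set of
  codegree below \<open>\<theta>\<close> contradicts maximality: removing its edges loses fewer than
  \<open>\<theta>\<close> edges and at least one shadow set. The loss is bounded because the shadow
  has at most \<open>card V ^ (r - 1)\<close> members.\<close>

lemma exists_large_codegree_subgraph:
  fixes E1 :: "'a set set"
  assumes V: "finite V" and E1: "\<And>e. e \<in> E1 \<Longrightarrow> e \<subseteq> V \<and> card e = r" and \<theta>: "0 \<le> \<theta>"
  obtains E0 where "E0 \<subseteq> E1" "real (card E1) - \<theta> * real (card V) ^ (r - 1) \<le> real (card E0)"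
    "\<And>e v. e \<in> E0 \<Longrightarrow> v \<in> e \<Longrightarrow> \<theta> \<le> real (codeg E0 (e - {v}))"
proof -
  define sh where "sh E = (\<Union>e\<in>E. (\<lambda>v. e - {v}) ` e)" for E :: "'a set set"
  define \<Phi> where "\<Phi> E = real (card E) - \<theta> * real (card (sh E))" for E
  have finE1: "finite E1" using E1 V by (intro finite_subset[of E1 "Pow V"]) auto
  have finsh: "finite (sh E)" if "E \<subseteq> E1" for E
    using that E1 V by (intro finite_subset[of "sh E" "Pow V"]) (auto simp: sh_def)
  obtain E0 where E0: "E0 \<in> Pow E1" and max: "\<And>E. E \<in> Pow E1 \<Longrightarrow> \<Phi> E \<le> \<Phi> E0"
    using finE1 by (rule_tac finite_maximizer[of "Pow E1" \<Phi>]) auto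
  have finE0: "finite E0" using E0 finE1 finite_subset by auto
  have "sh E1 \<subseteq> {f. f \<subseteq> V \<and> card f = r - 1}"
    unfolding sh_def using E1 V by (auto dest: finite_subset)
  then have "card (sh E1) \<le> card {f. f \<subseteq> V \<and> card f = r - 1}"
    using V by (intro card_mono) auto
  also have "\<dots> \<le> card V ^ (r - 1)" by (rule card_subsets_le_power[OF V])
  finally have "real (card (sh E1)) \<le> real (card V) ^ (r - 1)"
    by (metis of_nat_le_iff of_nat_power)
  then have "\<theta> * real (card (sh E1)) \<le> \<theta> * real (card V) ^ (r - 1)"
    using \<theta> by (rule mult_left_mono)
  moreover have "\<Phi> E1 \<le> \<Phi> E0" by (rule max) auto
  moreover have "\<Phi> E0 \<le> real (card E0)" using \<theta> by (simp add: \<Phi>_def)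
  ultimately have large: "real (card E1) - \<theta> * real (card V) ^ (r - 1) \<le> real (card E0)"
    by (simp add: \<Phi>_def)
  have "\<theta> \<le> real (codeg E0 (e - {v}))" if "e \<in> E0" "v \<in> e" for e v
  proof -
    let ?f = "e - {v}"
    define E' where "E' = {e' \<in> E0. \<not> ?f \<subseteq> e'}"
    have "sh E' \<subset> sh E0"
    proof
      show "sh E' \<subseteq> sh E0" by (auto simp: sh_def E'_def)
      have "?f \<in> sh E0" using that by (auto simp: sh_def)
      moreover have "?f \<notin> sh E'" by (auto simp: sh_def E'_def)
      ultimately show "sh E' \<noteq> sh E0" by metis
    qed
    then have "card (sh E') < card (sh E0)"
      using finsh[of E0] E0 by (intro psubset_card_mono) auto
    then have "\<theta> * (real (card (sh E')) + 1) \<le> \<theta> * real (card (sh E0))"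
      using \<theta> by (intro mult_left_mono) auto
    moreover have "card E0 = card E' + codeg E0 ?f"
    proof -
      have "E0 = E' \<union> {e' \<in> E0. ?f \<subseteq> e'}" by (auto simp: E'_def)
      then have "card E0 = card (E' \<union> {e' \<in> E0. ?f \<subseteq> e'})" by simp
      also have "\<dots> = card E' + codeg E0 ?f"
        unfolding codeg_def using finE0 by (intro card_Un_disjoint) (auto simp: E'_def)
      finally show ?thesis .
    qed
    moreover have "\<Phi> E' \<le> \<Phi> E0" using E0 by (intro max) (auto simp: E'_def)
    ultimately show ?thesis by (simp add: \<Phi>_def algebra_simps)
  qed
  then show ?thesis using that E0 large by blast
qed

text \<open>Double count the pairs of edges with \<open>insert v Q \<subseteq> e\<close>,
  \<open>Q \<subseteq> e'\<close> and \<open>e - {v} \<subseteq> e'\<close>. Each \<open>e\<close>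
  has at least \<open>\<theta>\<close> partners, since \<open>e - {v}\<close> still contains
  \<open>Q\<close>; each \<open>e'\<close> has at most \<open>r\<close>, since it has only
  \<open>r\<close> subsets of size \<open>r - 1\<close>. So one more vertex costs a factor
  \<open>r / \<theta>\<close>, which will make clashes of hyperedges rare.\<close>

lemma codeg_insert_le:
  assumes fin: "finite E" and E: "\<And>e. e \<in> E \<Longrightarrow> card e = r" and r: "1 \<le> r"
    and \<theta>: "\<And>e v. e \<in> E \<Longrightarrow> v \<in> e \<Longrightarrow> \<theta> \<le> real (codeg E (e - {v}))" and v: "v \<notin> Q"
  shows "\<theta> * real (codeg E (insert v Q)) \<le> real r * real (codeg E Q)"
proof -
  let ?A = "{e \<in> E. insert v Q \<subseteq> e}" and ?B = "{e \<in> E. Q \<subseteq> e}"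
  have finAB: "finite ?A" "finite ?B" using fin by auto
  have fine: "finite e" if "e \<in> E" for e using E[OF that] r card.infinite by fastforce
  have "\<theta> * real (codeg E (insert v Q)) = (\<Sum>e\<in>?A. \<theta>)" by (simp add: codeg_def)
  also have "\<dots> \<le> (\<Sum>e\<in>?A. real (codeg E (e - {v})))" by (intro sum_mono \<theta>) auto
  also have "\<dots> \<le> (\<Sum>e\<in>?A. \<Sum>e'\<in>{e' \<in> ?B. e - {v} \<subseteq> e'}. 1)"
  proof (intro sum_mono)
    fix e assume "e \<in> ?A"
    then have "{e' \<in> E. e - {v} \<subseteq> e'} \<subseteq> {e' \<in> ?B. e - {v} \<subseteq> e'}" using v by auto
    then have "codeg E (e - {v}) \<le> card {e' \<in> ?B. e - {v} \<subseteq> e'}"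
      unfolding codeg_def using fin by (intro card_mono) auto
    then show "real (codeg E (e - {v})) \<le> (\<Sum>e'\<in>{e' \<in> ?B. e - {v} \<subseteq> e'}. 1)" by simp
  qed
  also have "\<dots> = (\<Sum>e'\<in>?B. \<Sum>e\<in>{e \<in> ?A. e - {v} \<subseteq> e'}. 1)"
    by (rule sum.swap_restrict[OF finAB])
  also have "\<dots> \<le> (\<Sum>e'\<in>?B. real r)"
  proof (intro sum_mono)
    fix e' assume e': "e' \<in> ?B"
    have inj: "inj_on (\<lambda>e. e - {v}) {e \<in> ?A. e - {v} \<subseteq> e'}"
      by (intro inj_onI) (auto 0 3)
    have "(\<lambda>e. e - {v}) ` {e \<in> ?A. e - {v} \<subseteq> e'} \<subseteq> {f. f \<subseteq> e' \<and> card f = r - 1}"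
      using E by auto
    then have "card {e \<in> ?A. e - {v} \<subseteq> e'} \<le> card {f. f \<subseteq> e' \<and> card f = r - 1}"
      using fine e' by (intro card_inj_on_le[OF inj]) auto
    also have "\<dots> = r choose (r - 1)" using n_subsets[OF fine] e' E by auto
    also have "\<dots> = r" using r by (cases r) simp_all
    finally show "(\<Sum>e\<in>{e \<in> ?A. e - {v} \<subseteq> e'}. 1) \<le> real r" by simp
  qed
  also have "\<dots> = real r * real (codeg E Q)" by (simp add: codeg_def)
  finally show ?thesis .
qed

lemma sum_codeg_pairs:
  assumes V: "finite V" and fin: "finite E" and E: "\<And>e. e \<in> E \<Longrightarrow> e \<subseteq> V \<and> card e = r"
  shows "(\<Sum>y\<in>V - {x}. codeg E {x, y}) = (r - 1) * codeg E {x}"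
proof -
  have "(\<Sum>y\<in>V - {x}. codeg E {x, y}) = (\<Sum>y\<in>V - {x}. \<Sum>e\<in>{e \<in> {e \<in> E. x \<in> e}. y \<in> e}. 1)"
    by (intro sum.cong refl) (auto simp: codeg_def intro!: arg_cong[where f=card])
  also have "\<dots> = (\<Sum>e\<in>{e \<in> E. x \<in> e}. \<Sum>y\<in>{y \<in> V - {x}. y \<in> e}. 1)"
    using V fin by (intro sum.swap_restrict) auto
  also have "\<dots> = (\<Sum>e\<in>{e \<in> E. x \<in> e}. r - 1)"
  proof (intro sum.cong refl)
    fix e assume e: "e \<in> {e \<in> E. x \<in> e}"
    then have "{y \<in> V - {x}. y \<in> e} = e - {x}" using E by auto
    then show "(\<Sum>y\<in>{y \<in> V - {x}. y \<in> e}. 1) = r - 1" using e E by auto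
  qed
  finally show ?thesis by (simp add: codeg_def)
qed

lemma sum_codeg_ordered_pairs:
  assumes V: "finite V" and fin: "finite E" and E: "\<And>e. e \<in> E \<Longrightarrow> e \<subseteq> V \<and> card e = r"
  shows "(\<Sum>x\<in>V. \<Sum>y\<in>V. codeg E {x, y}) = r * r * card E"
    and "(\<Sum>x\<in>V. codeg E {x}) = r * card E"
proof -
  have r: "card {y \<in> V. y \<in> e} = r" if "e \<in> E" for e
    using E[OF that] by (metis Int_absorb1 Int_def)
  have "(\<Sum>x\<in>V. \<Sum>y\<in>V. codeg E {x, y}) = (\<Sum>p\<in>V \<times> V. \<Sum>e\<in>{e \<in> E. fst p \<in> e \<and> snd p \<in> e}. 1)"
    by (simp add: sum.cartesian_product codeg_def case_prod_unfold)
  also have "\<dots> = (\<Sum>e\<in>E. \<Sum>p\<in>{p \<in> V \<times> V. fst p \<in> e \<and> snd p \<in> e}. 1)"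
    using V fin by (intro sum.swap_restrict) auto
  also have "\<dots> = (\<Sum>e\<in>E. r * r)"
  proof (intro sum.cong refl)
    fix e assume e: "e \<in> E"
    have "{p \<in> V \<times> V. fst p \<in> e \<and> snd p \<in> e} = {y \<in> V. y \<in> e} \<times> {y \<in> V. y \<in> e}" by auto
    then show "(\<Sum>p\<in>{p \<in> V \<times> V. fst p \<in> e \<and> snd p \<in> e}. 1) = r * r"
      using r[OF e] by (simp add: card_cartesian_product)
  qed
  finally show "(\<Sum>x\<in>V. \<Sum>y\<in>V. codeg E {x, y}) = r * r * card E" by simp
  have "(\<Sum>x\<in>V. codeg E {x}) = (\<Sum>x\<in>V. \<Sum>e\<in>{e \<in> E. x \<in> e}. 1)" by (simp add: codeg_def)
  also have "\<dots> = (\<Sum>e\<in>E. \<Sum>x\<in>{x \<in> V. x \<in> e}. 1)"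
    using V fin by (intro sum.swap_restrict) auto
  also have "\<dots> = (\<Sum>e\<in>E. r)" using r by simp
  finally show "(\<Sum>x\<in>V. codeg E {x}) = r * card E" by simp
qed

text \<open>The codegrees at \<open>x\<close> sum to \<open>r - 1\<close> times its degree, which
  explains the factor: at most \<open>s\<close> partners of \<open>x\<close> exceed the share
  \<open>1 / s\<close> of that sum. Asking for the bound at both ends keeps the relation symmetric,
  so that the walk along light pairs is reversible.\<close>

definition light :: "'a set set \<Rightarrow> nat \<Rightarrow> real \<Rightarrow> 'a \<Rightarrow> 'a \<Rightarrow> bool" where
  "light E r s x y \<longleftrightarrow> x \<noteq> y \<and> real (codeg E {x, y}) * s \<le> real (r - 1) * real (codeg E {x})
     \<and> real (codeg E {x, y}) * s \<le> real (r - 1) * real (codeg E {y})"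

lemma light_sym: "light E r s x y \<longleftrightarrow> light E r s y x"
  by (auto simp: light_def insert_commute)

text \<open>In an edge without a light pair all other vertices are heavy for the vertex of smallest
  degree, and a vertex has at most \<open>s\<close> heavy partners.\<close>

lemma card_edges_without_light_pair:
  fixes E :: "'a set set"
  assumes V: "finite V" and fin: "finite E" and E: "\<And>e. e \<in> E \<Longrightarrow> e \<subseteq> V \<and> card e = r"
    and r: "2 \<le> r" and s: "0 < s"
  shows "real (card {e \<in> E. \<forall>x\<in>e. \<forall>y\<in>e. \<not> light E r s x y}) \<le> real (card V) * s ^ (r - 1)"
proof -
  define H where "H x = {y \<in> V - {x}. real (r - 1) * real (codeg E {x}) < real (codeg E {x, y}) * s}" for x
  have finH: "finite (H x)" for x using V by (auto simp: H_def)
  have cH: "real (card (H x)) \<le> s" for x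
  proof (cases "codeg E {x} = 0")
    case True
    then have "{e \<in> E. x \<in> e} = {}" using fin by (simp add: codeg_def)
    then have "{e \<in> E. {x, y} \<subseteq> e} = {}" for y by auto
    then have "codeg E {x, y} = 0" for y by (simp only: codeg_def card.empty)
    then have "H x = {}" by (auto simp: H_def True)
    then show ?thesis using s by simp
  next
    case False
    have "real (card (H x)) * (real (r - 1) * real (codeg E {x})) \<le> (\<Sum>y\<in>H x. real (codeg E {x, y}) * s)"
      using sum_bounded_below[of "H x" "real (r - 1) * real (codeg E {x})" "\<lambda>y. real (codeg E {x, y}) * s"]
      by (auto simp: H_def)
    also have "\<dots> \<le> (\<Sum>y\<in>V - {x}. real (codeg E {x, y}) * s)"
      using V s by (intro sum_mono2) (auto simp: H_def)
    also have "\<dots> = real (\<Sum>y\<in>V - {x}. codeg E {x, y}) * s" by (simp add: sum_distrib_right)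
    also have "\<dots> = s * (real (r - 1) * real (codeg E {x}))"
      by (subst sum_codeg_pairs[OF V fin E]) auto
    finally show ?thesis
      using False r by (auto dest!: mult_right_le_imp_le)
  qed
  let ?S = "\<lambda>x. {f. f \<subseteq> H x \<and> card f = r - 1}"
  have "{e \<in> E. \<forall>x\<in>e. \<forall>y\<in>e. \<not> light E r s x y} \<subseteq> (\<Union>x\<in>V. insert x ` ?S x)"
  proof
    fix e assume e: "e \<in> {e \<in> E. \<forall>x\<in>e. \<forall>y\<in>e. \<not> light E r s x y}"
    then have eE: "e \<in> E" by simp
    have fe: "finite e" "e \<noteq> {}" "e \<subseteq> V" "card e = r" using E[OF eE] V r by (auto dest: finite_subset)
    obtain x where x: "x \<in> e" and min: "\<And>y. y \<in> e \<Longrightarrow> - real (codeg E {y}) \<le> - real (codeg E {x})"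
      using finite_maximizer[OF fe(1,2), of "\<lambda>y. - real (codeg E {y})"] by metis
    have "e - {x} \<subseteq> H x"
    proof
      fix y assume y: "y \<in> e - {x}"
      then have "\<not> light E r s x y" using e x by auto
      moreover have "real (r - 1) * real (codeg E {x}) \<le> real (r - 1) * real (codeg E {y})"
        using min[of y] y by (intro mult_left_mono) auto
      ultimately have "real (r - 1) * real (codeg E {x}) < real (codeg E {x, y}) * s"
        using y by (auto simp: light_def)
      then show "y \<in> H x" using y fe by (auto simp: H_def)
    qed
    moreover have "card (e - {x}) = r - 1" using fe x by simp
    ultimately have "e - {x} \<in> ?S x" by simp
    moreover have "e = insert x (e - {x})" using x by auto
    ultimately show "e \<in> (\<Union>x\<in>V. insert x ` ?S x)" using x fe by blast
  qed
  then have "card {e \<in> E. \<forall>x\<in>e. \<forall>y\<in>e. \<not> light E r s x y} \<le> card (\<Union>x\<in>V. insert x ` ?S x)"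
    using V finH by (intro card_mono) auto
  also have "\<dots> \<le> (\<Sum>x\<in>V. card (insert x ` ?S x))" by (rule card_UN_le[OF V])
  also have "\<dots> \<le> (\<Sum>x\<in>V. card (H x) ^ (r - 1))"
  proof (rule sum_mono)
    fix x
    have "card (insert x ` ?S x) \<le> card (?S x)" using finH by (intro card_image_le) auto
    then show "card (insert x ` ?S x) \<le> card (H x) ^ (r - 1)"
      using card_subsets_le_power[OF finH, of x "r - 1"] by linarith
  qed
  finally have "real (card {e \<in> E. \<forall>x\<in>e. \<forall>y\<in>e. \<not> light E r s x y}) \<le> real (\<Sum>x\<in>V. card (H x) ^ (r - 1))"
    by (rule of_nat_mono)
  also have "\<dots> = (\<Sum>x\<in>V. real (card (H x)) ^ (r - 1))" by simp
  also have "\<dots> \<le> (\<Sum>x\<in>V. s ^ (r - 1))"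
    using cH by (intro sum_mono power_mono) auto
  finally show ?thesis by simp
qed

text \<open>Maximize the weight inside \<open>U\<close>, over ordered pairs, minus the sum of
  \<open>2 * b\<close>. Removing a vertex lowers the first term by twice its weighted degree, as
  \<open>w\<close> is symmetric with zero diagonal, so by maximality this degree is at least
  \<open>b\<close>. Positivity of the maximum excludes the empty set.\<close>

lemma exists_min_degree_subset:
  fixes w :: "'a \<Rightarrow> 'a \<Rightarrow> real"
  assumes V: "finite V" and sym: "\<And>x y. w x y = w y x" and irr: "\<And>x. w x x = 0"
    and large: "(\<Sum>x\<in>V. 2 * b x) < (\<Sum>x\<in>V. \<Sum>y\<in>V. w x y)"
  obtains U where "U \<subseteq> V" "U \<noteq> {}" "\<And>x. x \<in> U \<Longrightarrow> b x \<le> (\<Sum>y\<in>U. w x y)"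
proof -
  define \<Phi> where "\<Phi> U = (\<Sum>x\<in>U. \<Sum>y\<in>U. w x y) - (\<Sum>x\<in>U. 2 * b x)" for U
  obtain U where U: "U \<in> Pow V" and max: "\<And>U'. U' \<in> Pow V \<Longrightarrow> \<Phi> U' \<le> \<Phi> U"
    using V by (rule_tac finite_maximizer[of "Pow V" \<Phi>]) auto
  have finU: "finite U" using U V finite_subset by auto
  have "0 < \<Phi> V" using large by (simp add: \<Phi>_def)
  then have "0 < \<Phi> U" using max[of V] by simp
  then have "U \<noteq> {}" by (auto simp: \<Phi>_def)
  moreover have "b x \<le> (\<Sum>y\<in>U. w x y)" if x: "x \<in> U" for x
  proof -
    let ?U = "U - {x}"
    have row: "(\<Sum>y\<in>U. w z y) = w z x + (\<Sum>y\<in>?U. w z y)" for z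
      by (rule sum.remove[OF finU x])
    have "(\<Sum>z\<in>U. \<Sum>y\<in>U. w z y) = (\<Sum>y\<in>U. w x y) + (\<Sum>z\<in>?U. w z x + (\<Sum>y\<in>?U. w z y))"
      using sum.remove[OF finU x, of "\<lambda>z. \<Sum>y\<in>U. w z y"] row by simp
    also have "\<dots> = (\<Sum>y\<in>U. w x y) + (\<Sum>z\<in>?U. w x z) + (\<Sum>z\<in>?U. \<Sum>y\<in>?U. w z y)"
      using sym by (simp add: sum.distrib)
    also have "(\<Sum>z\<in>?U. w x z) = (\<Sum>y\<in>U. w x y)" using row[of x] irr by simp
    finally have "\<Phi> U = \<Phi> ?U + 2 * (\<Sum>y\<in>U. w x y) - 2 * b x"
      using sum.remove[OF finU x, of "\<lambda>x. 2 * b x"] by (simp add: \<Phi>_def)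
    moreover have "\<Phi> ?U \<le> \<Phi> U" using U by (intro max) auto
    ultimately show ?thesis by simp
  qed
  ultimately show ?thesis using that U by blast
qed

lemma card_edges_with_light_pair_le:
  assumes V: "finite V" and fin: "finite E" and E: "\<And>e. e \<in> E \<Longrightarrow> e \<subseteq> V \<and> card e = r"
  shows "real (card {e \<in> E. \<exists>x\<in>e. \<exists>y\<in>e. L x y})
    \<le> (\<Sum>x\<in>V. \<Sum>y\<in>V. if L x y then real (codeg E {x, y}) else 0)"
proof -
  let ?A = "{e \<in> E. \<exists>x\<in>e. \<exists>y\<in>e. L x y}" and ?P = "{p \<in> V \<times> V. L (fst p) (snd p)}"
  have "real (card ?A) = (\<Sum>e\<in>?A. 1)" by simp
  also have "\<dots> \<le> (\<Sum>e\<in>?A. \<Sum>p\<in>{p \<in> ?P. fst p \<in> e \<and> snd p \<in> e}. 1)"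
  proof (intro sum_mono)
    fix e assume "e \<in> ?A"
    then obtain x y where "e \<in> E" "x \<in> e" "y \<in> e" "L x y" by auto
    then have "(x, y) \<in> {p \<in> ?P. fst p \<in> e \<and> snd p \<in> e}" using E by auto
    then have "card {p \<in> ?P. fst p \<in> e \<and> snd p \<in> e} \<noteq> 0" using V by (auto simp: card_eq_0_iff)
    then show "1 \<le> (\<Sum>p\<in>{p \<in> ?P. fst p \<in> e \<and> snd p \<in> e}. 1 :: real)" by simp
  qed
  also have "\<dots> \<le> (\<Sum>e\<in>E. \<Sum>p\<in>{p \<in> ?P. fst p \<in> e \<and> snd p \<in> e}. 1)"
    using fin by (intro sum_mono2) (auto intro!: sum_nonneg)
  also have "\<dots> = (\<Sum>p\<in>?P. \<Sum>e\<in>{e \<in> E. fst p \<in> e \<and> snd p \<in> e}. 1)"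
    using V fin by (intro sum.swap_restrict) auto
  also have "\<dots> = (\<Sum>p\<in>V \<times> V. if L (fst p) (snd p) then real (codeg E {fst p, snd p}) else 0)"
    using V by (simp add: sum.inter_filter codeg_def cong: if_cong)
  also have "\<dots> = (\<Sum>x\<in>V. \<Sum>y\<in>V. if L x y then real (codeg E {x, y}) else 0)"
    by (simp add: sum.cartesian_product case_prod_unfold)
  finally show ?thesis .
qed

text \<open>The two terms of the degree bound have separate uses: the multiple of
  \<open>codeg E {x}\<close> bounds transition probabilities along light pairs, and the multiple of
  \<open>t * real (card V) ^ (r - 2)\<close> bounds degrees from below absolutely, and with that the
  densities. The codegree conclusion controls clashes.\<close>

lemma exists_clean_core:
  fixes V :: "'a set" and E1 :: "'a set set" and t :: real
  defines "s \<equiv> real (card V) powr (2 / 3)"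
  assumes V: "finite V" "1 \<le> card V" and E1: "\<And>e. e \<in> E1 \<Longrightarrow> e \<subseteq> V \<and> card e = r"
    and r: "4 \<le> r" and t: "4 \<le> t"
    and large: "3 / 4 * (t * real (card V) ^ (r - 1)) \<le> real (card E1)"
  obtains E U where "E \<subseteq> E1" "U \<subseteq> V" "U \<noteq> {}"
    "\<And>x. x \<in> U \<Longrightarrow> (real (codeg E {x}) + t * real (card V) ^ (r - 2)) / (8 * real r)
        \<le> (\<Sum>y\<in>U. if light E r s x y then real (codeg E {x, y}) else 0)"
    "\<And>Q v. v \<notin> Q \<Longrightarrow> t / 4 * real (codeg E (insert v Q)) \<le> real r * real (codeg E Q)"
proof -
  define n where "n = real (card V)"
  have n: "1 \<le> n" using V by (simp add: n_def)
  have t4: "0 \<le> t / 4" using t by simp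
  obtain E where E: "E \<subseteq> E1" and cE: "real (card E1) - t / 4 * n ^ (r - 1) \<le> real (card E)"
    and cod: "\<And>e v. e \<in> E \<Longrightarrow> v \<in> e \<Longrightarrow> t / 4 \<le> real (codeg E (e - {v}))"
    by (rule exists_large_codegree_subgraph[of V E1 r "t / 4", folded n_def])
      (use V(1) E1 t4 that in blast)+
  have E': "e \<subseteq> V \<and> card e = r" if "e \<in> E" for e using E E1 that by auto
  have fin: "finite E" using E' V by (intro finite_subset[of E "Pow V"]) auto
  have T: "t * n ^ (r - 1) \<le> 2 * real (card E)" using large cE by (simp add: n_def)
  have npos: "0 < n ^ (r - 1)" using n by simp
  have tn: "4 * n ^ (r - 1) \<le> t * n ^ (r - 1)" using t n by (intro mult_right_mono) auto
  have Epos: "0 < real (card E)" using T tn npos by linarith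
  have s: "0 < s" using n by (simp add: s_def n_def)
  let ?L = "light E r s" and ?w = "\<lambda>x y. if light E r s x y then real (codeg E {x, y}) else 0"
  \<comment> \<open>This needs \<open>2 / 3 * (r - 1) \<le> r - 2\<close>, which is equivalent to
    \<open>r \<ge> 4\<close>.\<close>
  have s_pow: "s ^ (r - 1) \<le> n ^ (r - 2)"
  proof -
    have "s ^ (r - 1) = n powr (2 / 3 * real (r - 1))"
      using n by (simp add: s_def n_def powr_powr flip: powr_realpow)
    also have "\<dots> \<le> n powr real (r - 2)"
      using n r by (intro powr_mono) (auto simp: of_nat_diff)
    also have "\<dots> = n ^ (r - 2)" using n by (simp add: powr_realpow)
    finally show ?thesis .
  qed
  have n_split: "n * n ^ (r - 2) = n ^ (r - 1)"
    using r by (cases r) (auto simp: Suc_diff_Suc numeral_eq_Suc simp flip: power_Suc)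
  have "real (card {e \<in> E. \<forall>x\<in>e. \<forall>y\<in>e. \<not> ?L x y}) \<le> n * s ^ (r - 1)"
    unfolding n_def using r s by (intro card_edges_without_light_pair[OF V(1) fin E']) auto
  also have "\<dots> \<le> n ^ (r - 1)"
    using s_pow n n_split mult_left_mono[OF s_pow, of n] by simp
  finally have no: "real (card {e \<in> E. \<forall>x\<in>e. \<forall>y\<in>e. \<not> ?L x y}) \<le> n ^ (r - 1)" .
  have "card E = card {e \<in> E. \<forall>x\<in>e. \<forall>y\<in>e. \<not> ?L x y} + card {e \<in> E. \<exists>x\<in>e. \<exists>y\<in>e. ?L x y}"
  proof -
    have "E = {e \<in> E. \<forall>x\<in>e. \<forall>y\<in>e. \<not> ?L x y} \<union> {e \<in> E. \<exists>x\<in>e. \<exists>y\<in>e. ?L x y}" by auto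
    then have "card E = card ({e \<in> E. \<forall>x\<in>e. \<forall>y\<in>e. \<not> ?L x y} \<union> {e \<in> E. \<exists>x\<in>e. \<exists>y\<in>e. ?L x y})"
      by simp
    also have "\<dots> = card {e \<in> E. \<forall>x\<in>e. \<forall>y\<in>e. \<not> ?L x y} + card {e \<in> E. \<exists>x\<in>e. \<exists>y\<in>e. ?L x y}"
      using fin by (intro card_Un_disjoint) auto
    finally show ?thesis .
  qed
  \<comment> \<open>The edges without a light pair number at most \<open>n ^ (r - 1)\<close>, a
    quarter of \<open>t * n ^ (r - 1)\<close> at most, and hence at most half of
    \<open>card E\<close>.\<close>
  then have half: "real (card E) / 2 \<le> (\<Sum>x\<in>V. \<Sum>y\<in>V. ?w x y)"
    using card_edges_with_light_pair_le[OF V(1) fin E', of ?L] no T tn by linarith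
  let ?b = "\<lambda>x. (real (codeg E {x}) + t * n ^ (r - 2)) / (8 * real r)"
  have "(\<Sum>x\<in>V. 2 * ?b x) = (real (\<Sum>x\<in>V. codeg E {x}) + n * (t * n ^ (r - 2))) / (4 * real r)"
    using r by (simp add: sum.distrib n_def field_simps flip: sum_divide_distrib sum_distrib_left)
  also have "\<dots> = (real r * real (card E) + t * n ^ (r - 1)) / (4 * real r)"
    using n_split sum_codeg_ordered_pairs(2)[OF V(1) fin E']
    by (simp add: mult.left_commute[of n t])
  also have "\<dots> < real (card E) / 2"
  proof -
    have "t * n ^ (r - 1) < real r * real (card E)"
      using T r Epos mult_right_mono[of 4 "real r" "real (card E)"] by linarith
    then show ?thesis using r by (simp add: field_simps)
  qed
  finally have "(\<Sum>x\<in>V. 2 * ?b x) < (\<Sum>x\<in>V. \<Sum>y\<in>V. ?w x y)" using half by linarith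
  moreover have "?w x y = ?w y x" for x y by (simp add: light_sym[of E r s x y] insert_commute)
  moreover have "?w x x = 0" for x by (simp add: light_def)
  ultimately obtain U where "U \<subseteq> V" "U \<noteq> {}" "\<And>x. x \<in> U \<Longrightarrow> ?b x \<le> (\<Sum>y\<in>U. ?w x y)"
    using exists_min_degree_subset[OF V(1), of ?w ?b] by blast
  moreover have "t / 4 * real (codeg E (insert v Q)) \<le> real r * real (codeg E Q)" if "v \<notin> Q" for v Q
    by (rule codeg_insert_le[OF fin _ _ cod that]) (use E' r in auto)
  ultimately show ?thesis using that[of E U] E unfolding n_def by blast
qed

section \<open>Closed walks with prescribed edges\<close>

text \<open>\<open>G\<close> will be the relation of light pairs. Only its consequences are
  recorded: degrees are at least \<open>\<delta>\<close>, of order t n^(r-2), and transition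
  probabilities at most \<open>\<rho>\<close>, of order n^(-2/3).\<close>

locale clean_hypergraph = weighted_graph U w for U :: "'a set" and w +
  fixes E :: "'a set set" and G :: "'a \<Rightarrow> 'a \<Rightarrow> bool" and r l :: nat and \<delta> \<rho> :: real
  assumes finE: "finite E"
    and cardE: "e \<in> E \<Longrightarrow> card e = r"
    and r_ge: "4 \<le> r" and l_ge: "2 \<le> l"
    and w_eq: "w x y = (if G x y then real (codeg E {x, y}) else 0)"
    and G_irrefl: "\<not> G x x"
    and \<delta>_pos: "0 < \<delta>"
    and \<delta>_le: "x \<in> U \<Longrightarrow> \<delta> \<le> deg x"
    and step_le: "x \<in> U \<Longrightarrow> y \<in> U \<Longrightarrow> step x y \<le> \<rho>"
begin

abbreviation (input) m :: nat where "m \<equiv> l + l"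

definition return :: "'a \<Rightarrow> real" where "return x = dens (l + l) x x"

text \<open>As \<open>w\<close> counts hyperedges through a pair, a step of the walk is a choice of
  a hyperedge together with a \<open>G\<close>-partner in it, each choice having mass
  \<open>1 / deg x\<close>. Summed over hyperedges this is \<open>step\<close>.\<close>

definition wt :: "'a \<Rightarrow> 'a set \<Rightarrow> 'a \<Rightarrow> real" where
  "wt x e y = (if G x y \<and> x \<in> e \<and> y \<in> e then 1 / deg x else 0)"

lemma finite_edge: "e \<in> E \<Longrightarrow> finite e"
  using cardE r_ge card.infinite by fastforce

lemma wt_nonneg: "0 \<le> wt x e y"
  by (simp add: wt_def deg_nonneg)

lemma step_eq_sum_wt: "step x y = (\<Sum>e\<in>E. wt x e y)"
proof -
  have "(\<Sum>e\<in>E. wt x e y) = (\<Sum>e\<in>E. if {x, y} \<subseteq> e then (if G x y then 1 / deg x else 0) else 0)"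
    by (intro sum.cong) (auto simp: wt_def)
  also have "\<dots> = real (codeg E {x, y}) * (if G x y then 1 / deg x else 0)"
    using finE by (simp add: codeg_def flip: sum.inter_filter)
  finally show ?thesis by (simp add: step_def w_eq)
qed

lemma wt_le: "x \<in> U \<Longrightarrow> wt x e y \<le> (if x \<in> e \<and> y \<in> e then 1 / \<delta> else 0)"
  using \<delta>_le[of x] \<delta>_pos by (auto simp: wt_def intro!: divide_left_mono mult_pos_pos)

lemma card_edge_le: "e \<in> E \<Longrightarrow> real (card (e \<inter> U)) \<le> real r"
  using card_mono[OF finite_edge[of e], of "e \<inter> U"] cardE by auto

lemma \<rho>_nonneg: "x \<in> U \<Longrightarrow> 0 \<le> \<rho>"
  using step_le[of x x] step_nonneg[of x x] by linarith

lemma one_le_return: "x \<in> U \<Longrightarrow> 1 \<le> return x"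
  unfolding return_def by (rule one_le_dens_diag)

lemma return_nonneg: "0 \<le> return x"
  unfolding return_def by (rule dens_nonneg)

lemma sum_wt_le: "x \<in> U \<Longrightarrow> e \<in> E \<Longrightarrow> (\<Sum>y\<in>U. wt x e y) \<le> real r / \<delta>"
proof -
  assume x: "x \<in> U" and e: "e \<in> E"
  have "(\<Sum>y\<in>U. wt x e y) \<le> (\<Sum>y\<in>U. if y \<in> e then 1 / \<delta> else 0)"
    using wt_le[OF x, of e] \<delta>_pos by (intro sum_mono order_trans[OF wt_le[OF x]]) auto
  also have "\<dots> = real (card (e \<inter> U)) * (1 / \<delta>)"
    using fin by (simp add: Int_def conj_commute flip: sum.inter_filter)
  also have "\<dots> \<le> real r * (1 / \<delta>)"
    using card_edge_le[OF e] \<delta>_pos by (intro mult_right_mono) auto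
  finally show ?thesis by simp
qed

text \<open>The trace of the product of these kernels is the total weight of the closed walks whose
  hyperedges at the positions in \<open>I\<close> are prescribed by \<open>\<sigma>\<close>.\<close>

definition kern :: "nat set \<Rightarrow> (nat \<Rightarrow> 'a set) \<Rightarrow> nat \<Rightarrow> 'a \<Rightarrow> 'a \<Rightarrow> real" where
  "kern I \<sigma> i x y = (if i \<in> I then wt x (\<sigma> i) y else step x y)"

lemma kern_nonneg: "0 \<le> kern I \<sigma> i x y"
  by (simp add: kern_def wt_nonneg step_nonneg)

definition rowb :: "nat set \<Rightarrow> nat \<Rightarrow> real" where
  "rowb I i = (if i \<in> I then real r / \<delta> else 1)"

lemma rowb_nonneg: "0 \<le> rowb I i"
  using \<delta>_pos by (simp add: rowb_def)

lemma sum_kern_le: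
  assumes "\<And>i. i \<in> I \<Longrightarrow> \<sigma> i \<in> E" "x \<in> U"
  shows "(\<Sum>y\<in>U. kern I \<sigma> i x y) \<le> rowb I i"
  using assms sum_wt_le sum_step by (simp add: kern_def rowb_def)

lemma prod_rowb:
  assumes "finite A"
  shows "(\<Prod>i\<in>A. rowb I i) = (real r / \<delta>) ^ card (A \<inter> I)"
  unfolding rowb_def using assms by (subst prod.If_cases) (auto simp: Int_def)

lemma walk_sum_start:
  assumes "0 \<in> I" "x \<in> U" "x \<notin> \<sigma> 0" "y \<in> U"
  shows "walk_sum U (kern I \<sigma>) (Suc n) x y = 0"
  unfolding walk_sum_Suc_left[OF fin assms(2,4)]
  using assms by (intro sum.neutral) (simp add: kern_def wt_def)

text \<open>The walk has to start in the prescribed hyperedge \<open>\<sigma> 0\<close>. The factor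
  \<open>return x \<ge> 1\<close> is inserted on purpose: it brings the bound into the form of the
  one for a single gap, so that both can be summed over hyperedges in the same way.\<close>

lemma closed_le_of_start:
  assumes I: "0 \<in> I" and \<sigma>: "\<And>i. i \<in> I \<Longrightarrow> \<sigma> i \<in> E"
    and b: "\<And>x. x \<in> U \<Longrightarrow> walk_sum U (kern I \<sigma>) m x x \<le> B" and B: "0 \<le> B"
  shows "(\<Sum>x\<in>U. walk_sum U (kern I \<sigma>) m x x) \<le> B * (\<Sum>x\<in>\<sigma> 0 \<inter> U. return x)"
proof -
  obtain n where n: "m = Suc n" using l_ge by (cases m) auto
  have "(\<Sum>x\<in>U. walk_sum U (kern I \<sigma>) m x x) = (\<Sum>x\<in>\<sigma> 0 \<inter> U. walk_sum U (kern I \<sigma>) m x x)"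
    unfolding n using fin walk_sum_start[OF I, of _ \<sigma> _ n]
    by (intro sum.mono_neutral_right) (auto simp del: walk_sum.simps)
  also have "\<dots> \<le> (\<Sum>x\<in>\<sigma> 0 \<inter> U. B * return x)"
  proof (intro sum_mono)
    fix x assume "x \<in> \<sigma> 0 \<inter> U"
    then have "walk_sum U (kern I \<sigma>) m x x \<le> B * 1" "1 \<le> return x"
      using b one_le_return by auto
    then show "walk_sum U (kern I \<sigma>) m x x \<le> B * return x"
      using B mult_left_mono order_trans by blast
  qed
  finally show ?thesis by (simp add: sum_distrib_left)
qed

lemma closed_full_le:
  assumes \<sigma>: "\<And>i. i < m \<Longrightarrow> \<sigma> i \<in> E"
  shows "(\<Sum>x\<in>U. walk_sum U (kern {..<m} \<sigma>) m x x) \<le> (real r / \<delta>) ^ m * (\<Sum>x\<in>\<sigma> 0 \<inter> U. return x)"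
proof (rule closed_le_of_start)
  fix x assume x: "x \<in> U"
  have "walk_sum U (kern {..<m} \<sigma>) m x x \<le> (\<Sum>y\<in>U. walk_sum U (kern {..<m} \<sigma>) m x y)"
    using x fin by (intro member_le_sum) (auto intro: walk_sum_nonneg kern_nonneg)
  also have "\<dots> \<le> (\<Prod>i<m. rowb {..<m} i)"
    using \<sigma> x by (intro walk_sum_row_le fin kern_nonneg rowb_nonneg sum_kern_le) auto
  finally show "walk_sum U (kern {..<m} \<sigma>) m x x \<le> (real r / \<delta>) ^ m"
    by (simp add: prod_rowb)
qed (use \<sigma> l_ge \<delta>_pos in auto)

text \<open>A prescribed hyperedge leaves at most \<open>r\<close> next vertices, each of mass at
  most \<open>1 / \<delta>\<close>. Two free steps give a factor \<open>\<rho>\<close> each: the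
  last one has to return to the start, and the one at position \<open>b\<close> has to hit one of
  the at most \<open>r\<close> vertices of the hyperedge prescribed at \<open>Suc b\<close>.\<close>

lemma closed_two_gaps_le:
  assumes I: "I \<subseteq> {..<m}" "0 \<in> I" "m - 1 \<notin> I" and b: "b \<notin> I" "Suc b \<in> I"
    and \<sigma>: "\<And>i. i \<in> I \<Longrightarrow> \<sigma> i \<in> E"
  shows "(\<Sum>x\<in>U. walk_sum U (kern I \<sigma>) m x x)
    \<le> (real r / \<delta>) ^ card I * real r * \<rho>\<^sup>2 * (\<Sum>x\<in>\<sigma> 0 \<inter> U. return x)"
proof (cases "U = {}")
  case False
  then have \<rho>: "0 \<le> \<rho>" using \<rho>_nonneg by blast
  let ?k = "kern I \<sigma>" and ?R = "real r / \<delta>"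
  have R: "0 \<le> ?R" using \<delta>_pos by simp
  have below: "i < m - 1" if "i \<in> I" for i
  proof -
    have "i < m" "i \<noteq> m - 1" using that I by auto
    then show ?thesis by simp
  qed
  have b2: "Suc b < m - 1" by (rule below[OF b(2)])
  define c where "c = m - 1 - (b + 2)"
  have m1: "m - 1 = (b + 2) + c" using b2 by (simp add: c_def)
  have row1: "(\<Sum>y\<in>U. walk_sum U ?k b x y) \<le> (\<Prod>i<b. rowb I i)" if "x \<in> U" for x
    using that by (intro walk_sum_row_le fin kern_nonneg rowb_nonneg sum_kern_le \<sigma>)
  have row2: "(\<Sum>y\<in>U. walk_sum U (\<lambda>i. ?k (b + i)) 2 x y) \<le> real r * \<rho> * ?R" if x: "x \<in> U" for x
  proof -
    have e: "\<sigma> (Suc b) \<in> E" using \<sigma> b by auto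
    have "(\<Sum>y\<in>U. walk_sum U (\<lambda>i. ?k (b + i)) 2 x y)
      = (\<Sum>y\<in>U. \<Sum>z\<in>U. step x z * wt z (\<sigma> (Suc b)) y)"
      using walk_sum_1[OF fin x, of "\<lambda>i. ?k (b + i)"] b
      by (simp add: numeral_2_eq_2 kern_def del: walk_sum.simps(2) add: walk_sum.simps(2)[of _ _ "Suc 0"])
    also have "\<dots> = (\<Sum>z\<in>U. step x z * (\<Sum>y\<in>U. wt z (\<sigma> (Suc b)) y))"
      by (subst sum.swap) (simp add: sum_distrib_left)
    also have "\<dots> \<le> (\<Sum>z\<in>U. if z \<in> \<sigma> (Suc b) then \<rho> * ?R else 0)"
    proof (intro sum_mono)
      fix z assume z: "z \<in> U"
      show "step x z * (\<Sum>y\<in>U. wt z (\<sigma> (Suc b)) y) \<le> (if z \<in> \<sigma> (Suc b) then \<rho> * ?R else 0)"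
      proof (cases "z \<in> \<sigma> (Suc b)")
        case True
        have "step x z * (\<Sum>y\<in>U. wt z (\<sigma> (Suc b)) y) \<le> \<rho> * ?R"
          using step_le[OF x z] sum_wt_le[OF z e] \<rho> by (intro mult_mono sum_nonneg wt_nonneg)
        then show ?thesis using True by simp
      qed (simp add: wt_def)
    qed
    also have "\<dots> = real (card (\<sigma> (Suc b) \<inter> U)) * (\<rho> * ?R)"
      using fin by (simp add: Int_def conj_commute flip: sum.inter_filter)
    also have "\<dots> \<le> real r * (\<rho> * ?R)"
      by (intro mult_right_mono mult_nonneg_nonneg card_edge_le e \<rho> R)
    finally show ?thesis by (simp add: mult.assoc)
  qed
  have row3: "(\<Sum>y\<in>U. walk_sum U (\<lambda>i. ?k (b + 2 + i)) c x y) \<le> (\<Prod>i<c. rowb I (b + 2 + i))"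
    if "x \<in> U" for x
    using that by (intro walk_sum_row_le fin kern_nonneg rowb_nonneg sum_kern_le \<sigma>)
  have cardI: "card I = card ({..<b} \<inter> I) + 1 + card ({b + 2..<m - 1} \<inter> I)"
  proof -
    have "I = ({..<b} \<inter> I) \<union> ({Suc b} \<union> ({b + 2..<m - 1} \<inter> I))" (is "_ = ?A \<union> (?B \<union> ?C)")
    proof (intro equalityI subsetI)
      fix i assume i: "i \<in> I"
      then have "i < m - 1" by (rule below)
      moreover have "i \<noteq> b" using i b by auto
      ultimately show "i \<in> ?A \<union> (?B \<union> ?C)" using i by auto
    qed (use b in auto)
    moreover have "card (?A \<union> (?B \<union> ?C)) = card ?A + card (?B \<union> ?C)"
      by (intro card_Un_disjoint) auto
    moreover have "card (?B \<union> ?C) = card ?B + card ?C" by (intro card_Un_disjoint) auto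
    ultimately show ?thesis by simp
  qed
  have rows: "(\<Sum>y\<in>U. walk_sum U ?k (m - 1) x y) \<le> ?R ^ card I * real r * \<rho>" if x: "x \<in> U" for x
  proof -
    have 12: "(\<Sum>y\<in>U. walk_sum U ?k (b + 2) x y) \<le> (\<Prod>i<b. rowb I i) * (real r * \<rho> * ?R)"
      using row1 row2 \<rho> R x by (intro walk_sum_row_add_le fin kern_nonneg mult_nonneg_nonneg) auto
    have "(\<Sum>y\<in>U. walk_sum U ?k (b + 2 + c) x y)
      \<le> (\<Prod>i<b. rowb I i) * (real r * \<rho> * ?R) * (\<Prod>i<c. rowb I (b + 2 + i))"
      by (rule walk_sum_row_add_le[OF fin x kern_nonneg 12 row3]) (auto intro!: prod_nonneg rowb_nonneg)
    also have "(\<Prod>i<c. rowb I (b + 2 + i)) = (\<Prod>i\<in>{b + 2..<m - 1}. rowb I i)"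
      by (rule prod.reindex_bij_witness[of _ "\<lambda>i. i - (b + 2)" "\<lambda>i. b + 2 + i"])
        (use b2 in \<open>auto simp: c_def\<close>)
    also have "(\<Prod>i<b. rowb I i) * (real r * \<rho> * ?R) * \<dots> = ?R ^ card I * real r * \<rho>"
      unfolding cardI by (simp add: prod_rowb power_add)
    finally show ?thesis by (simp only: m1)
  qed
  have "(\<Sum>x\<in>U. walk_sum U ?k m x x) \<le> (?R ^ card I * real r * \<rho> * \<rho>) * (\<Sum>x\<in>\<sigma> 0 \<inter> U. return x)"
  proof (rule closed_le_of_start[OF I(2) \<sigma>])
    fix x assume x: "x \<in> U"
    have "walk_sum U ?k m x x = walk_sum U ?k (Suc (m - 1)) x x" using l_ge by simp
    also have "\<dots> = (\<Sum>z\<in>U. walk_sum U ?k (m - 1) x z * step z x)"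
      using I(3) by (simp add: kern_def)
    also have "\<dots> \<le> (\<Sum>z\<in>U. walk_sum U ?k (m - 1) x z * \<rho>)"
      using x by (intro sum_mono mult_left_mono step_le walk_sum_nonneg kern_nonneg)
    also have "\<dots> \<le> ?R ^ card I * real r * \<rho> * \<rho>"
      using rows[OF x] \<rho> by (simp add: sum_distrib_right[symmetric] mult_right_mono)
    finally show "walk_sum U ?k m x x \<le> ?R ^ card I * real r * \<rho> * \<rho>" .
  qed (use \<rho> R in auto)
  then show ?thesis by (simp add: power2_eq_square mult.assoc)
qed simp

text \<open>Each intermediate vertex has at most \<open>r\<close> choices, and every step but the
  first has mass at most \<open>1 / \<delta>\<close>. The factor \<open>1 / deg x\<close> of the
  first step is kept exact, because it later turns a transition probability back to \<open>x\<close>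
  into a density.\<close>

lemma walk_sum_prescribed_le:
  assumes \<sigma>: "\<And>i. i < Suc j \<Longrightarrow> \<sigma> i \<in> E" and x: "x \<in> U" "z \<in> U"
  shows "walk_sum U (\<lambda>i x y. wt x (\<sigma> i) y) (Suc j) x z
    \<le> (if x \<in> \<sigma> 0 \<and> z \<in> \<sigma> j then (real r / \<delta>) ^ j / deg x else 0)"
  using \<sigma> x(2)
proof (induction j arbitrary: z)
  case 0
  then show ?case using x(1) unfolding walk_sum_1[OF fin x(1)] by (simp add: wt_def deg_nonneg)
next
  case (Suc j)
  let ?W = "walk_sum U (\<lambda>i x y. wt x (\<sigma> i) y)" and ?R = "real r / \<delta>"
  let ?c = "if x \<in> \<sigma> 0 then ?R ^ j / deg x else 0" and ?d = "if z \<in> \<sigma> (Suc j) then 1 / \<delta> else 0"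
  have c: "0 \<le> ?c" "0 \<le> ?d" using \<delta>_pos deg_nonneg by auto
  have e: "\<sigma> j \<in> E" using Suc.prems by auto
  have "?W (Suc (Suc j)) x z = (\<Sum>y\<in>U. ?W (Suc j) x y * wt y (\<sigma> (Suc j)) z)"
    by (rule walk_sum.simps(2))
  also have "\<dots> \<le> (\<Sum>y\<in>U. if y \<in> \<sigma> j then ?c * ?d else 0)"
  proof (intro sum_mono)
    fix y assume y: "y \<in> U"
    have 1: "?W (Suc j) x y \<le> (if x \<in> \<sigma> 0 \<and> y \<in> \<sigma> j then ?R ^ j / deg x else 0)"
      using Suc.IH[of y] Suc.prems y by auto
    have 2: "wt y (\<sigma> (Suc j)) z \<le> ?d"
      using wt_le[OF y, of "\<sigma> (Suc j)" z] \<delta>_pos order_trans[of _ 0 "1 / \<delta>"]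
      by (simp split: if_splits)
    have "?W (Suc j) x y * wt y (\<sigma> (Suc j)) z
       \<le> (if x \<in> \<sigma> 0 \<and> y \<in> \<sigma> j then ?R ^ j / deg x else 0) * ?d"
      using 1 2 c \<delta>_pos deg_nonneg by (intro mult_mono wt_nonneg) auto
    then show "?W (Suc j) x y * wt y (\<sigma> (Suc j)) z \<le> (if y \<in> \<sigma> j then ?c * ?d else 0)"
      by (auto split: if_splits)
  qed
  also have "\<dots> = real (card (\<sigma> j \<inter> U)) * (?c * ?d)"
    using fin by (simp add: Int_def conj_commute flip: sum.inter_filter)
  also have "\<dots> \<le> real r * (?c * ?d)"
    using card_edge_le[OF e] c by (intro mult_right_mono) auto
  also have "\<dots> = (if x \<in> \<sigma> 0 \<and> z \<in> \<sigma> (Suc j) then ?R ^ Suc j / deg x else 0)"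
    by simp
  finally show ?case .
qed

text \<open>The closed walk is a prescribed path from \<open>x\<close> to \<open>z\<close> followed
  by a free walk of \<open>m - j\<close> steps from \<open>z\<close> to \<open>x\<close>, whose
  probability divided by \<open>deg x\<close> is its density divided by \<open>vol\<close>. Each
  term of \<open>return x + return z\<close> involves one end only, and the other end has at most
  \<open>r\<close> positions.\<close>

lemma closed_one_gap_le:
  assumes j: "1 \<le> j" "j < m" and \<sigma>: "\<And>i. i < j \<Longrightarrow> \<sigma> i \<in> E"
    and gap: "\<And>x y. x \<in> U \<Longrightarrow> y \<in> U \<Longrightarrow> dens (m - j) x y \<le> N * (return x + return y)"
    and N: "0 \<le> N"
  shows "(\<Sum>x\<in>U. walk_sum U (kern {..<j} \<sigma>) m x x)
    \<le> (real r / \<delta>) ^ (j - 1) * (real r * N / vol)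
        * ((\<Sum>x\<in>\<sigma> 0 \<inter> U. return x) + (\<Sum>x\<in>\<sigma> (j - 1) \<inter> U. return x))"
proof -
  let ?k = "kern {..<j} \<sigma>" and ?R = "real r / \<delta>"
  let ?A = "\<sigma> 0 \<inter> U" and ?B = "\<sigma> (j - 1) \<inter> U"
  have R: "0 \<le> ?R" using \<delta>_pos by simp
  have m: "m = j + (m - j)" "j = Suc (j - 1)" using j by auto
  have finAB: "finite ?A" "finite ?B" using fin by auto
  have "(\<Sum>x\<in>U. walk_sum U ?k m x x) = (\<Sum>x\<in>U. \<Sum>z\<in>U. walk_sum U (\<lambda>i x y. wt x (\<sigma> i) y) j x z * prob (m - j) z x)"
  proof (intro sum.cong refl)
    fix x assume x: "x \<in> U"
    have "walk_sum U ?k m x x = (\<Sum>z\<in>U. walk_sum U ?k j x z * walk_sum U (\<lambda>i. ?k (j + i)) (m - j) z x)"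
      using walk_sum_add[OF fin x, of ?k j "m - j" x] m(1) by simp
    also have "\<dots> = (\<Sum>z\<in>U. walk_sum U (\<lambda>i x y. wt x (\<sigma> i) y) j x z * prob (m - j) z x)"
      unfolding prob_def
      by (intro sum.cong refl arg_cong2[where f="(*)"] walk_sum_cong) (auto simp: kern_def)
    finally show "walk_sum U ?k m x x = \<dots>" .
  qed
  also have "\<dots> \<le> (\<Sum>x\<in>U. \<Sum>z\<in>U. if x \<in> \<sigma> 0 \<and> z \<in> \<sigma> (j - 1) then ?R ^ (j - 1) * (N * (return x + return z)) / vol else 0)"
  proof (intro sum_mono)
    fix x z assume x: "x \<in> U" and z: "z \<in> U"
    have W: "walk_sum U (\<lambda>i x y. wt x (\<sigma> i) y) j x z
      \<le> (if x \<in> \<sigma> 0 \<and> z \<in> \<sigma> (j - 1) then ?R ^ (j - 1) / deg x else 0)"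
      using walk_sum_prescribed_le[of "j - 1" \<sigma> x z] x z \<sigma> m(2) by auto
    have "prob (m - j) z x / deg x = dens (m - j) z x / vol"
      using vol_gt_0[OF x] by (simp add: dens_def)
    also have "\<dots> \<le> N * (return x + return z) / vol"
      using gap[OF z x] vol_gt_0[OF x] by (simp add: divide_right_mono add.commute)
    finally have p: "?R ^ (j - 1) * (prob (m - j) z x / deg x) \<le> ?R ^ (j - 1) * (N * (return x + return z) / vol)"
      using R by (intro mult_left_mono) auto
    have "walk_sum U (\<lambda>i x y. wt x (\<sigma> i) y) j x z * prob (m - j) z x
      \<le> (if x \<in> \<sigma> 0 \<and> z \<in> \<sigma> (j - 1) then ?R ^ (j - 1) / deg x else 0) * prob (m - j) z x"
      using W by (intro mult_right_mono prob_nonneg)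
    also have "\<dots> \<le> (if x \<in> \<sigma> 0 \<and> z \<in> \<sigma> (j - 1) then ?R ^ (j - 1) * (N * (return x + return z)) / vol else 0)"
      using p by simp
    finally show "walk_sum U (\<lambda>i x y. wt x (\<sigma> i) y) j x z * prob (m - j) z x \<le> \<dots>" .
  qed
  also have "\<dots> = (\<Sum>x\<in>U. if x \<in> \<sigma> 0 then \<Sum>z\<in>?B. ?R ^ (j - 1) * (N * (return x + return z)) / vol else 0)"
    using fin by (intro sum.cong refl) (auto simp: Int_def conj_commute sum.inter_filter simp del: One_nat_def)
  also have "\<dots> = (\<Sum>x\<in>?A. \<Sum>z\<in>?B. ?R ^ (j - 1) * (N * (return x + return z)) / vol)"
    using fin by (simp add: Int_def conj_commute flip: sum.inter_filter)
  also have "\<dots> = ?R ^ (j - 1) * (N / vol) * (\<Sum>x\<in>?A. \<Sum>z\<in>?B. return x + return z)"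
    by (simp add: sum_distrib_left sum_divide_distrib algebra_simps)
  also have "\<dots> \<le> ?R ^ (j - 1) * (N / vol) * (real r * ((\<Sum>x\<in>?A. return x) + (\<Sum>x\<in>?B. return x)))"
  proof (intro mult_left_mono)
    have "(\<Sum>x\<in>?A. \<Sum>z\<in>?B. return x + return z)
      = real (card ?B) * (\<Sum>x\<in>?A. return x) + real (card ?A) * (\<Sum>x\<in>?B. return x)"
      by (simp add: sum.distrib sum_distrib_left)
    also have "\<dots> \<le> real r * (\<Sum>x\<in>?A. return x) + real r * (\<Sum>x\<in>?B. return x)"
      using j \<sigma> by (intro add_mono mult_right_mono card_edge_le sum_nonneg return_nonneg) auto
    finally show "(\<Sum>x\<in>?A. \<Sum>z\<in>?B. return x + return z) \<le> real r * ((\<Sum>x\<in>?A. return x) + (\<Sum>x\<in>?B. return x))"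
      by (simp add: distrib_left)
  qed (use R N vol_nonneg in auto)
  finally show ?thesis by (simp add: mult_ac)
qed

end

section \<open>Cyclic index sets and products of finite sets\<close>

lemma down_closed_eq_lessThan:
  fixes A :: "nat set"
  assumes "finite A" "\<And>b. Suc b \<in> A \<Longrightarrow> b \<in> A"
  shows "A = {..<card A}"
proof -
  define k where "k = (LEAST i. i \<notin> A)"
  have "\<exists>i. i \<notin> A" using assms(1) by (metis UNIV_eq_I infinite_UNIV_nat)
  then have k: "k \<notin> A" unfolding k_def by (rule LeastI_ex)
  have "i \<in> A" if "i < k" for i using not_less_Least that unfolding k_def by blast
  moreover have "i \<notin> A" if "k \<le> i" for i
    using that k by (induction i rule: dec_induct) (auto dest: assms(2))
  ultimately have "A = {..<k}" by (auto simp: not_less[symmetric])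
  then show ?thesis by simp
qed

lemma bij_betw_rotate:
  assumes "s < (m::nat)"
  shows "bij_betw (\<lambda>i. (s + i) mod m) {..<m} {..<m}"
proof (rule bij_betw_byWitness[where f'="\<lambda>i. (i + (m - s)) mod m"])
  have s: "s + i + (m - s) = i + m" "s + (i + (m - s)) = i + m" for i using assms by auto
  show "\<forall>i\<in>{..<m}. ((s + i) mod m + (m - s)) mod m = i"
    unfolding mod_add_left_eq s by simp
  show "\<forall>i\<in>{..<m}. (s + (i + (m - s)) mod m) mod m = i"
    unfolding mod_add_right_eq s by simp
qed (use assms in auto)

lemma card_PiE_related_le:
  fixes B :: "'i \<Rightarrow> 'b set"
  assumes I: "finite I" "i \<in> I" "k \<in> I" "i \<noteq> k" and B: "\<And>i. i \<in> I \<Longrightarrow> finite (B i)"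
    and R: "\<And>e. e \<in> B i \<Longrightarrow> real (card {e' \<in> B k. R e e'}) \<le> \<eta> * real (card (B k))"
  shows "real (card {f \<in> PiE I B. R (f i) (f k)}) \<le> \<eta> * (\<Prod>i\<in>I. real (card (B i)))"
proof -
  let ?J = "I - {k}"
  have IJ: "I = insert k ?J" using I by auto
  have finJ: "finite (PiE ?J B)" using I B by (intro finite_PiE) auto
  have "{f \<in> PiE I B. R (f i) (f k)} = (\<lambda>(g, y). g(k := y)) ` (SIGMA g:PiE ?J B. {y \<in> B k. R (g i) y})"
  proof (intro equalityI subsetI)
    fix f assume f: "f \<in> {f \<in> PiE I B. R (f i) (f k)}"
    then have "f(k := undefined) \<in> PiE ?J B" using IJ fun_upd_in_PiE[of k ?J f B] by auto
    moreover have "f k \<in> {y \<in> B k. R ((f(k := undefined)) i) y}" using f I by auto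
    ultimately show "f \<in> (\<lambda>(g, y). g(k := y)) ` (SIGMA g:PiE ?J B. {y \<in> B k. R (g i) y})"
      by (intro image_eqI[of _ _ "(f(k := undefined), f k)"]) auto
  next
    fix f assume "f \<in> (\<lambda>(g, y). g(k := y)) ` (SIGMA g:PiE ?J B. {y \<in> B k. R (g i) y})"
    then obtain g y where g: "g \<in> PiE ?J B" "y \<in> B k" "R (g i) y" "f = g(k := y)" by auto
    have "f \<in> PiE I B" using PiE_fun_upd[OF g(2,1)] by (simp only: g(4) IJ[symmetric])
    then show "f \<in> {f \<in> PiE I B. R (f i) (f k)}" using g(3,4) I(4) by simp
  qed
  then have "card {f \<in> PiE I B. R (f i) (f k)} \<le> card (SIGMA g:PiE ?J B. {y \<in> B k. R (g i) y})"
    using finJ B[OF I(3)] by (simp only:) (intro card_image_le finite_SigmaI, auto)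
  also have "\<dots> = (\<Sum>g\<in>PiE ?J B. card {y \<in> B k. R (g i) y})"
    using finJ B[OF I(3)] by (intro card_SigmaI) auto
  finally have "real (card {f \<in> PiE I B. R (f i) (f k)}) \<le> real (\<Sum>g\<in>PiE ?J B. card {y \<in> B k. R (g i) y})"
    by (rule of_nat_mono)
  also have "\<dots> = (\<Sum>g\<in>PiE ?J B. real (card {y \<in> B k. R (g i) y}))" by simp
  also have "\<dots> \<le> (\<Sum>g\<in>PiE ?J B. \<eta> * real (card (B k)))"
    using I by (intro sum_mono R) auto
  also have "\<dots> = \<eta> * (real (card (B k)) * (\<Prod>i\<in>?J. real (card (B i))))"
    using I by (simp add: card_PiE)
  also have "real (card (B k)) * (\<Prod>i\<in>?J. real (card (B i))) = (\<Prod>i\<in>I. real (card (B i)))"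
    by (rule prod.remove[OF I(1,3), symmetric])
  finally show ?thesis .
qed

context clean_hypergraph
begin

text \<open>After a rotation position 0 is prescribed and the position before it is free. Then
  either there is a second gap, or the prescribed positions form an initial segment.
  \<open>N\<close> is one bound for the cost of all shapes, and the factor 2 covers the two ends of
  a single gap.\<close>

lemma closed_prescribed_le:
  assumes I: "I \<subseteq> {..<m}" "1 \<le> card I" and \<sigma>: "\<And>i. i \<in> I \<Longrightarrow> \<sigma> i \<in> E" and N: "0 \<le> N"
    and gap: "\<And>x y. card I < m \<Longrightarrow> x \<in> U \<Longrightarrow> y \<in> U \<Longrightarrow> dens (m - card I) x y \<le> N * (return x + return y)"
    and two: "card I < m \<Longrightarrow> real r * \<rho>\<^sup>2 * (vol / \<delta>) \<le> N"
    and full: "card I = m \<Longrightarrow> vol / \<delta> \<le> N"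
  shows "(\<Sum>x\<in>U. walk_sum U (kern I \<sigma>) m x x)
    \<le> (real r / \<delta>) ^ (card I - 1) * (real r * N / vol) * (2 * (\<Sum>i\<in>I. \<Sum>x\<in>\<sigma> i \<inter> U. return x))"
proof (cases "U = {}")
  case False
  then have vol: "0 < vol" using vol_gt_0 by blast
  let ?R = "real r / \<delta>" and ?j = "card I"
  let ?B = "?R ^ (?j - 1) * (real r * N / vol)" and ?S = "\<lambda>e. \<Sum>x\<in>e \<inter> U. return x"
  have finI: "finite I" using I finite_subset by blast
  have R: "0 \<le> ?R" using \<delta>_pos by simp
  have B: "0 \<le> ?B" using R N vol by simp
  have S: "0 \<le> ?S e" for e by (intro sum_nonneg return_nonneg)
  have mem: "?S (\<sigma> i) \<le> (\<Sum>i\<in>I. ?S (\<sigma> i))" if "i \<in> I" for i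
    using that finI S by (intro member_le_sum) auto
  have j: "?R ^ ?j = ?R ^ (?j - 1) * ?R" using I(2) by (cases ?j) auto
  show ?thesis
  proof (cases "?j = m")
    case True
    then have Im: "I = {..<m}" using card_subset_eq[of "{..<m}" I] I by auto
    have 0: "0 \<in> I" using l_ge by (simp add: Im)
    have "(\<Sum>x\<in>U. walk_sum U (kern I \<sigma>) m x x) \<le> ?R ^ ?j * ?S (\<sigma> 0)"
      using closed_full_le[of \<sigma>] \<sigma> Im by simp
    also have "?R ^ ?j \<le> ?B"
    proof -
      have "?R \<le> real r * N / vol"
        using full[OF True] vol \<delta>_pos mult_left_mono[of vol "N * \<delta>" "real r"] by (simp add: field_simps)
      then show ?thesis unfolding j using R by (intro mult_left_mono) auto
    qed
    finally have "(\<Sum>x\<in>U. walk_sum U (kern I \<sigma>) m x x) \<le> ?B * ?S (\<sigma> 0)"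
      using S by (simp add: mult_right_mono)
    also have "\<dots> \<le> ?B * (2 * (\<Sum>i\<in>I. ?S (\<sigma> i)))"
      using mem[OF 0] S[of "\<sigma> 0"] B by (intro mult_left_mono) auto
    finally show ?thesis .
  next
    case False
    have jm: "?j < m" using card_mono[OF _ I(1)] False by simp
    \<comment> \<open>\<open>(s + (m - 1)) mod m\<close> is the cyclic predecessor of
      \<open>s\<close>. If no free position precedes a prescribed one in the linear order,
      \<open>I\<close> is an initial segment, and 0 has the free predecessor \<open>m - 1\<close>
      because \<open>card I < m\<close>.\<close>
    have "\<exists>s<m. s \<in> I \<and> (s + (m - 1)) mod m \<notin> I"
    proof (cases "\<exists>i. i \<notin> I \<and> Suc i \<in> I")
      case True
      then obtain i where i: "i \<notin> I" "Suc i \<in> I" by auto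
      then have im: "Suc i < m" using I by auto
      then have "(Suc i + (m - 1)) mod m = i" by simp
      then show ?thesis using i im by metis
    next
      case False
      then have Ij: "I = {..<?j}" using down_closed_eq_lessThan[OF finI] by blast
      have "0 \<in> I" "m - 1 \<notin> I" using I(2) jm by (subst Ij, simp)+
      then show ?thesis using l_ge by (intro exI[of _ 0]) auto
    qed
    then obtain s where s: "s < m" "s \<in> I" "(s + (m - 1)) mod m \<notin> I" by auto
    let ?rot = "\<lambda>i. (s + i) mod m"
    define I' where "I' = {i. i < m \<and> ?rot i \<in> I}"
    define \<sigma>' where "\<sigma>' i = \<sigma> (?rot i)" for i
    have finI': "finite I'" by (simp add: I'_def)
    have "?rot ` I' = I"
    proof
      show "?rot ` I' \<subseteq> I" by (auto simp: I'_def)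
      show "I \<subseteq> ?rot ` I'"
      proof
        fix i assume i: "i \<in> I"
        then have "i \<in> ?rot ` {..<m}" using bij_betw_rotate[OF s(1)] I by (auto simp: bij_betw_def)
        then show "i \<in> ?rot ` I'" using i by (auto simp: I'_def)
      qed
    qed
    moreover have "inj_on ?rot I'"
      using bij_betw_rotate[OF s(1)] by (auto simp: bij_betw_def I'_def intro: inj_on_subset)
    ultimately have cI': "card I' = ?j" using card_image by metis
    have I'm: "I' \<subseteq> {..<m}" by (auto simp: I'_def)
    have 0: "0 \<in> I'" using s by (simp add: I'_def)
    have last: "m - 1 \<notin> I'" using s by (simp add: I'_def)
    have \<sigma>': "\<sigma>' i \<in> E" if "i \<in> I'" for i using that \<sigma> by (auto simp: I'_def \<sigma>'_def)
    have mem': "?S (\<sigma>' i) \<le> (\<Sum>i\<in>I. ?S (\<sigma> i))" if "i \<in> I'" for i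
      using that mem by (auto simp: I'_def \<sigma>'_def)
    have "(\<Sum>x\<in>U. walk_sum U (kern I \<sigma>) m x x) = (\<Sum>x\<in>U. walk_sum U (\<lambda>i. kern I \<sigma> (?rot i)) m x x)"
      by (rule walk_sum_rotate[OF fin s(1)])
    also have "\<dots> = (\<Sum>x\<in>U. walk_sum U (kern I' \<sigma>') m x x)"
      by (intro sum.cong refl walk_sum_cong) (auto simp: kern_def I'_def \<sigma>'_def)
    finally have rot: "(\<Sum>x\<in>U. walk_sum U (kern I \<sigma>) m x x) = (\<Sum>x\<in>U. walk_sum U (kern I' \<sigma>') m x x)" .
    show ?thesis
    proof (cases "\<exists>b. b \<notin> I' \<and> Suc b \<in> I'")
      case True
      then obtain b where b: "b \<notin> I'" "Suc b \<in> I'" by auto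
      have "(\<Sum>x\<in>U. walk_sum U (kern I' \<sigma>') m x x) \<le> ?R ^ ?j * real r * \<rho>\<^sup>2 * ?S (\<sigma>' 0)"
        using closed_two_gaps_le[OF I'm 0 last b \<sigma>'] cI' by simp
      also have "?R ^ ?j * real r * \<rho>\<^sup>2 \<le> ?B"
      proof -
        have "?R * real r * \<rho>\<^sup>2 \<le> real r * N / vol"
          using two[OF jm] vol \<delta>_pos mult_left_mono[of "real r * \<rho>\<^sup>2 * vol" "N * \<delta>" "real r"]
          by (simp add: field_simps)
        then have "?R ^ (?j - 1) * (?R * real r * \<rho>\<^sup>2) \<le> ?B" using R by (intro mult_left_mono) auto
        then show ?thesis unfolding j by (simp only: mult.assoc)
      qed
      finally have "(\<Sum>x\<in>U. walk_sum U (kern I' \<sigma>') m x x) \<le> ?B * ?S (\<sigma>' 0)"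
        using S by (simp add: mult_right_mono)
      also have "\<dots> \<le> ?B * (2 * (\<Sum>i\<in>I. ?S (\<sigma> i)))"
        using mem'[OF 0] S[of "\<sigma>' 0"] B by (intro mult_left_mono) auto
      finally show ?thesis unfolding rot .
    next
      case False
      then have I'j: "I' = {..<?j}" using down_closed_eq_lessThan[OF finI'] cI' by metis
      have lst: "?j - 1 \<in> I'" using I(2) by (subst I'j) auto
      have "(\<Sum>x\<in>U. walk_sum U (kern {..<?j} \<sigma>') m x x) \<le> ?B * (?S (\<sigma>' 0) + ?S (\<sigma>' (?j - 1)))"
        using gap[OF jm] \<sigma>' I'j I(2) jm N by (intro closed_one_gap_le) auto
      also have "\<dots> \<le> ?B * (2 * (\<Sum>i\<in>I. ?S (\<sigma> i)))"
        using mem'[OF 0] mem'[OF lst] B by (intro mult_left_mono) auto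
      finally show ?thesis unfolding rot using I'j by simp
    qed
  qed
qed simp

section \<open>Weights of closed walks with a hyperedge chosen at every step\<close>

definition conf :: "(nat \<Rightarrow> 'a) \<Rightarrow> (nat \<Rightarrow> 'a set) \<Rightarrow> real" where
  "conf xs es = (\<Prod>i<m. wt (xs i) (es i) (xs (Suc i mod m)))"

text \<open>The trace of the \<open>m\<close>-step transition matrix, which is the total weight of
  all configurations. Bad configurations are bounded by fractions of \<open>Z\<close>, so that its
  positivity suffices in the end.\<close>

definition Z :: real where "Z = (\<Sum>x\<in>U. prob m x x)"

lemma conf_nonneg: "0 \<le> conf xs es"
  unfolding conf_def by (intro prod_nonneg) (simp add: wt_nonneg)

lemma m_pos: "0 < m" using l_ge by simp

lemma sum_conf_edges:
  assumes "\<And>i. i < m \<Longrightarrow> finite (A i)"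
  shows "(\<Sum>es\<in>PiE {..<m} A. conf xs es) = (\<Prod>i<m. \<Sum>e\<in>A i. wt (xs i) e (xs (Suc i mod m)))"
  unfolding conf_def using assms by (subst prod_sum_PiE) auto

lemma sum_conf:
  assumes "\<And>i. i < m \<Longrightarrow> finite (A i)"
  shows "(\<Sum>xs\<in>PiE {..<m} (\<lambda>_. U). \<Sum>es\<in>PiE {..<m} A. conf xs es)
    = (\<Sum>x\<in>U. walk_sum U (\<lambda>i x y. \<Sum>e\<in>A i. wt x e y) m x x)"
  using sum_closed_walks[OF fin m_pos, of "\<lambda>i x y. \<Sum>e\<in>A i. wt x e y"]
  by (simp only: sum_conf_edges[OF assms])

lemma sum_conf_all:
  "(\<Sum>xs\<in>PiE {..<m} (\<lambda>_. U). \<Sum>es\<in>PiE {..<m} (\<lambda>_. E). conf xs es) = Z"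
  using sum_conf[of "\<lambda>_. E"] finE by (simp add: Z_def prob_def step_eq_sum_wt[abs_def])

lemma Z_ge: "U \<noteq> {} \<Longrightarrow> 0 < Z"
proof -
  assume "U \<noteq> {}"
  have "0 < prob m x x" if "x \<in> U" for x
    using one_le_return[OF that] deg_gt_0[OF that] vol_gt_0[OF that] prob_nonneg[of m x x]
    by (cases "prob m x x = 0") (auto simp: return_def dens_def)
  then show ?thesis using fin \<open>U \<noteq> {}\<close> unfolding Z_def by (intro sum_pos) auto
qed

end

section \<open>Walks that give linear cycles\<close>

context clean_hypergraph
begin

abbreviation (input) "XS \<equiv> PiE {..<m} (\<lambda>_. U)"
abbreviation (input) "ES \<equiv> PiE {..<m} (\<lambda>_. E)"

lemma finite_XS: "finite XS" using fin by (intro finite_PiE) auto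
lemma finite_ES: "finite ES" using finE by (intro finite_PiE) auto

text \<open>Such a walk consists of two closed walks at the repeated vertex, of
  \<open>c = b - a\<close> and \<open>m - c\<close> steps. The first has probability at most
  \<open>\<rho>\<close>. For the second, \<open>dens (m - c) v v \<le> X \<le> X * return v\<close>
  compares its probability with that of a return after \<open>m\<close> steps, which sums to
  \<open>Z\<close> over \<open>v\<close>.\<close>

lemma sum_conf_repeated_vertex_le:
  assumes ab: "a < b" "b < m"
    and X: "\<And>x y. x \<in> U \<Longrightarrow> y \<in> U \<Longrightarrow> vol * step x y / deg y \<le> X" and U: "U \<noteq> {}"
  shows "(\<Sum>xs | xs \<in> XS \<and> xs a = xs b. \<Sum>es\<in>ES. conf xs es) \<le> \<rho> * X * Z"
proof -
  \<comment> \<open>This kernel keeps exactly the walks that are at \<open>v\<close> at both times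
    \<open>a\<close> and \<open>b\<close>; a sum over \<open>v\<close> then expresses
    \<open>xs a = xs b\<close>.\<close>
  define k where "k v i x y = (if (i = a \<or> i = b) \<and> x \<noteq> v then 0 else step x y)" for v i x y
  have knn: "0 \<le> k v i x y" for v i x y by (simp add: k_def step_nonneg)
  have kle: "k v i x y \<le> step x y" for v i x y by (simp add: k_def step_nonneg)
  obtain u where u: "u \<in> U" using U by auto
  have \<rho>: "0 \<le> \<rho>" by (rule \<rho>_nonneg[OF u])
  have X0: "0 \<le> X"
  proof -
    have "0 \<le> vol * step u u / deg u" by (intro divide_nonneg_nonneg mult_nonneg_nonneg vol_nonneg step_nonneg deg_nonneg)
    then show ?thesis using X[OF u u] by linarith
  qed
  have es: "(\<Sum>es\<in>ES. conf xs es) = (\<Prod>i<m. step (xs i) (xs (Suc i mod m)))" for xs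
    by (subst sum_conf_edges) (auto simp: finE step_eq_sum_wt)
  have "(\<Sum>xs | xs \<in> XS \<and> xs a = xs b. \<Sum>es\<in>ES. conf xs es)
    = (\<Sum>xs\<in>XS. if xs a = xs b then \<Prod>i<m. step (xs i) (xs (Suc i mod m)) else 0)"
    unfolding es by (rule sum.inter_filter[OF finite_XS])
  also have "\<dots> = (\<Sum>xs\<in>XS. \<Sum>v\<in>U. \<Prod>i<m. k v i (xs i) (xs (Suc i mod m)))"
  proof (intro sum.cong refl)
    fix xs assume xs: "xs \<in> XS"
    have "(\<Prod>i<m. k v i (xs i) (xs (Suc i mod m)))
        = (if xs a = v \<and> xs b = v then \<Prod>i<m. step (xs i) (xs (Suc i mod m)) else 0)" for v
    proof (cases "xs a = v \<and> xs b = v")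
      case True
      then show ?thesis by (auto simp: k_def intro!: prod.cong)
    next
      case False
      then have "\<exists>i\<in>{..<m}. k v i (xs i) (xs (Suc i mod m)) = 0"
        using ab by (auto simp: k_def intro: bexI[of _ a] bexI[of _ b])
      then show ?thesis using False by (auto intro: prod_zero)
    qed
    then have "(\<Sum>v\<in>U. \<Prod>i<m. k v i (xs i) (xs (Suc i mod m)))
      = (\<Sum>v\<in>U. if v = xs a then if xs a = xs b then \<Prod>i<m. step (xs i) (xs (Suc i mod m)) else 0 else 0)"
      by (intro sum.cong) auto
    also have "\<dots> = (if xs a = xs b then \<Prod>i<m. step (xs i) (xs (Suc i mod m)) else 0)"
      using xs ab fin by (auto simp: sum.delta)
    finally show "(if xs a = xs b then \<Prod>i<m. step (xs i) (xs (Suc i mod m)) else 0)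
      = (\<Sum>v\<in>U. \<Prod>i<m. k v i (xs i) (xs (Suc i mod m)))" by simp
  qed
  also have "\<dots> = (\<Sum>v\<in>U. \<Sum>xs\<in>XS. \<Prod>i<m. k v i (xs i) (xs (Suc i mod m)))" by (rule sum.swap)
  also have "\<dots> = (\<Sum>v\<in>U. \<Sum>x\<in>U. walk_sum U (k v) m x x)"
    using sum_closed_walks[OF fin m_pos] by (intro sum.cong refl)
  also have "\<dots> \<le> (\<Sum>v\<in>U. \<rho> * X * prob m v v)"
  proof (intro sum_mono)
    fix v assume v: "v \<in> U"
    define k' where "k' i = k v ((a + i) mod m)" for i
    have k'nn: "0 \<le> k' i x y" for i x y by (simp add: k'_def knn)
    define c where "c = b - a"
    have c: "1 \<le> c" "c < m" "a + c = b" using ab by (auto simp: c_def)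
    have start0: "walk_sum U k' (Suc n) x y = 0" if "x \<in> U" "x \<noteq> v" "y \<in> U" for n x y
      unfolding walk_sum_Suc_left[OF fin that(1,3)] using that ab
      by (intro sum.neutral) (simp add: k'_def k_def)
    have startc: "walk_sum U (\<lambda>i. k' (c + i)) (Suc n) x y = 0" if "x \<in> U" "x \<noteq> v" "y \<in> U" for n x y
      unfolding walk_sum_Suc_left[OF fin that(1,3)] using that ab c
      by (intro sum.neutral) (simp add: k'_def k_def)
    obtain p where p: "m = Suc p" using m_pos gr0_implies_Suc by blast
    obtain q where q: "m - c = Suc q" using c by (metis zero_less_diff gr0_implies_Suc)
    have "(\<Sum>x\<in>U. walk_sum U (k v) m x x) = (\<Sum>x\<in>U. walk_sum U k' m x x)"
      unfolding k'_def using ab by (intro walk_sum_rotate fin) auto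
    also have "\<dots> = (\<Sum>x\<in>{v}. walk_sum U k' m x x)"
      using v fin start0[where n=p] unfolding p by (intro sum.mono_neutral_right) (auto simp del: walk_sum.simps)
    also have "\<dots> = walk_sum U k' (c + (m - c)) v v" using c by simp
    also have "\<dots> = (\<Sum>z\<in>U. walk_sum U k' c v z * walk_sum U (\<lambda>i. k' (c + i)) (m - c) z v)"
      by (rule walk_sum_add[OF fin v])
    also have "\<dots> = (\<Sum>z\<in>{v}. walk_sum U k' c v z * walk_sum U (\<lambda>i. k' (c + i)) (m - c) z v)"
      using v fin startc[where n=q] unfolding q by (intro sum.mono_neutral_right) (auto simp del: walk_sum.simps)
    also have "\<dots> \<le> prob c v v * prob (m - c) v v"
      unfolding prob_def
      by (simp, intro mult_mono walk_sum_mono walk_sum_nonneg k'nn step_nonneg) (auto simp: k'_def kle)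
    also have "\<dots> \<le> \<rho> * (X * prob m v v)"
    proof (intro mult_mono prob_nonneg \<rho>)
      show "prob c v v \<le> \<rho>" using step_le v c by (intro prob_le) auto
      have "dens (m - c) v v \<le> X * 1" using dens_le[OF X v v, of "m - c"] c by simp
      also have "\<dots> \<le> X * return v" using X0 one_le_return[OF v] by (intro mult_left_mono) auto
      finally have "vol * prob (m - c) v v \<le> X * (vol * prob m v v)"
        using deg_gt_0[OF v] by (simp add: return_def dens_def field_simps)
      then have "vol * prob (m - c) v v \<le> vol * (X * prob m v v)" by (simp only: mult.left_commute)
      then show "prob (m - c) v v \<le> X * prob m v v"
        using vol_gt_0[OF v] by (rule mult_left_le_imp_le)
    qed
    finally show "(\<Sum>x\<in>U. walk_sum U (k v) m x x) \<le> \<rho> * X * prob m v v" by (simp add: mult.assoc)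
  qed
  also have "\<dots> = \<rho> * X * Z" by (simp add: Z_def sum_distrib_left)
  finally show ?thesis .
qed

text \<open>\<open>e'\<close> is the hyperedge of step \<open>k\<close>, and the removed pair
  consists of the two walk vertices it is meant to contain. Its other vertices should avoid
  \<open>e\<close> and all of the walk. The relation is not symmetric in the two hyperedges, so it
  has to be excluded for all ordered pairs of positions.\<close>

definition clash :: "(nat \<Rightarrow> 'a) \<Rightarrow> nat \<Rightarrow> 'a set \<Rightarrow> 'a set \<Rightarrow> bool" where
  "clash xs k e e' \<longleftrightarrow> (e' - {xs k, xs (Suc k mod m)}) \<inter> (e \<union> xs ` {..<m}) \<noteq> {}"

text \<open>For a fixed walk along \<open>G\<close> all admissible choices of hyperedges have the
  same weight \<open>c\<close>, so the hyperedges are independent and uniform on the sets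
  \<open>B i\<close>. A clash forces the one at \<open>k\<close> through a further vertex, among at
  most \<open>r + m\<close> vertices, and each of these costs a factor
  \<open>\<eta>\<close>.\<close>

lemma sum_conf_clash_le:
  assumes xs: "xs \<in> XS" and ik: "i < m" "k < m" "i \<noteq> k"
    and \<eta>: "0 \<le> \<eta>" "\<And>Q v. v \<notin> Q \<Longrightarrow> real (codeg E (insert v Q)) \<le> \<eta> * real (codeg E Q)"
  shows "(\<Sum>es | es \<in> ES \<and> clash xs k (es i) (es k). conf xs es)
    \<le> real (r + m) * \<eta> * (\<Sum>es\<in>ES. conf xs es)"
proof (cases "\<forall>i<m. G (xs i) (xs (Suc i mod m))")
  case False
  then obtain i0 where i0: "i0 < m" "\<not> G (xs i0) (xs (Suc i0 mod m))" by auto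
  then have "conf xs es = 0" for es
    unfolding conf_def by (intro prod_zero) (auto simp: wt_def intro!: bexI[of _ i0])
  then show ?thesis by simp
next
  case True
  define B where "B i = {e \<in> E. {xs i, xs (Suc i mod m)} \<subseteq> e}" for i
  define c where "c = (\<Prod>i<m. 1 / deg (xs i))"
  have c: "0 \<le> c" unfolding c_def by (intro prod_nonneg) (simp add: deg_nonneg)
  have conf: "conf xs es = (if es \<in> PiE {..<m} B then c else 0)" if es: "es \<in> ES" for es
  proof (cases "es \<in> PiE {..<m} B")
    case inB: True
    then have "conf xs es = c"
      unfolding conf_def c_def using True by (intro prod.cong) (auto simp: wt_def B_def PiE_def Pi_def)
    then show ?thesis using inB by simp
  next
    case False
    then obtain i0 where "i0 < m" "es i0 \<notin> B i0" using es by (auto simp: PiE_def Pi_def)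
    moreover have "es i0 \<in> E" using es \<open>i0 < m\<close> by auto
    ultimately have "\<exists>i\<in>{..<m}. wt (xs i) (es i) (xs (Suc i mod m)) = 0"
      by (intro bexI[of _ i0]) (auto simp: wt_def B_def)
    then show ?thesis using False unfolding conf_def by (simp add: prod_zero)
  qed
  have BE: "PiE {..<m} B \<subseteq> ES" by (intro PiE_mono) (auto simp: B_def)
  have conf1: "conf xs es = c" if "es \<in> PiE {..<m} B" for es
    using conf[of es] that subsetD[OF BE that] by simp
  have all: "(\<Sum>es\<in>ES. conf xs es) = c * (\<Prod>i<m. real (card (B i)))"
  proof -
    have "(\<Sum>es\<in>ES. conf xs es) = (\<Sum>es\<in>PiE {..<m} B. c)"
      by (intro sum.mono_neutral_cong_right finite_ES BE) (simp_all add: conf conf1)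
    also have "\<dots> = c * (\<Prod>i<m. real (card (B i)))" by (simp add: card_PiE)
    finally show ?thesis .
  qed
  have "real (card {es \<in> PiE {..<m} B. clash xs k (es i) (es k)})
    \<le> real (r + m) * \<eta> * (\<Prod>i<m. real (card (B i)))"
  proof (rule card_PiE_related_le)
    fix e assume e: "e \<in> B i"
    let ?Q = "{xs k, xs (Suc k mod m)}" and ?A = "e \<union> xs ` {..<m}"
    have e': "finite e" "card e = r" using e finite_edge cardE by (auto simp: B_def)
    have cA: "card ?A \<le> r + m"
      using card_Un_le[of e "xs ` {..<m}"] card_image_le[of "{..<m}" xs] e' by simp
    have "{e' \<in> B k. clash xs k e e'} \<subseteq> (\<Union>v\<in>?A - ?Q. {e' \<in> E. insert v ?Q \<subseteq> e'})"
      by (auto simp: clash_def B_def)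
    then have "card {e' \<in> B k. clash xs k e e'} \<le> card (\<Union>v\<in>?A - ?Q. {e' \<in> E. insert v ?Q \<subseteq> e'})"
      using e' finE by (intro card_mono) auto
    also have "\<dots> \<le> (\<Sum>v\<in>?A - ?Q. codeg E (insert v ?Q))"
      unfolding codeg_def using e' by (intro card_UN_le) auto
    finally have "real (card {e' \<in> B k. clash xs k e e'}) \<le> real (\<Sum>v\<in>?A - ?Q. codeg E (insert v ?Q))"
      by (rule of_nat_mono)
    also have "\<dots> = (\<Sum>v\<in>?A - ?Q. real (codeg E (insert v ?Q)))" by simp
    also have "\<dots> \<le> (\<Sum>v\<in>?A - ?Q. \<eta> * real (codeg E ?Q))"
      by (intro sum_mono \<eta>(2)) auto
    also have "\<dots> = real (card (?A - ?Q)) * (\<eta> * real (codeg E ?Q))" by simp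
    also have "\<dots> \<le> real (r + m) * (\<eta> * real (codeg E ?Q))"
    proof (intro mult_right_mono)
      have "card (?A - ?Q) \<le> card ?A" using e' by (intro card_mono) auto
      then show "real (card (?A - ?Q)) \<le> real (r + m)" using cA by linarith
    qed (use \<eta> in auto)
    finally show "real (card {e' \<in> B k. clash xs k e e'}) \<le> real (r + m) * \<eta> * real (card (B k))"
      by (simp add: codeg_def B_def mult.assoc)
  qed (use ik finE in \<open>auto simp: B_def\<close>)
  then have "c * real (card {es \<in> PiE {..<m} B. clash xs k (es i) (es k)})
     \<le> c * (real (r + m) * \<eta> * (\<Prod>i<m. real (card (B i))))"
    using c by (rule mult_left_mono)
  moreover have "(\<Sum>es | es \<in> ES \<and> clash xs k (es i) (es k). conf xs es)
    = (\<Sum>es | es \<in> PiE {..<m} B \<and> clash xs k (es i) (es k). c)"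
    using BE finite_ES by (intro sum.mono_neutral_cong_right) (auto simp: conf conf1)
  ultimately show ?thesis unfolding all by (simp add: mult_ac)
qed

text \<open>Because \<open>deg x * return x = vol * prob m x x\<close>, summing return densities
  over all incidences of vertices and hyperedges recovers the trace.\<close>

lemma sum_return_edges:
  assumes "\<And>x. x \<in> U \<Longrightarrow> real (codeg E {x}) \<le> C * deg x"
  shows "(\<Sum>e\<in>E. \<Sum>x\<in>e \<inter> U. return x) \<le> C * vol * Z"
proof -
  have "(\<Sum>e\<in>E. \<Sum>x\<in>e \<inter> U. return x) = (\<Sum>e\<in>E. \<Sum>x\<in>{x \<in> U. x \<in> e}. return x)"
    by (simp add: Int_def conj_commute)
  also have "\<dots> = (\<Sum>x\<in>U. \<Sum>e\<in>{e \<in> E. x \<in> e}. return x)"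
    using fin finE by (intro sum.swap_restrict)
  also have "\<dots> = (\<Sum>x\<in>U. real (codeg E {x}) * return x)" by (simp add: codeg_def)
  also have "\<dots> \<le> (\<Sum>x\<in>U. C * deg x * return x)"
    using assms by (intro sum_mono mult_right_mono return_nonneg) auto
  also have "\<dots> = (\<Sum>x\<in>U. C * vol * prob m x x)"
    using deg_gt_0 by (intro sum.cong refl) (force simp: return_def dens_def)
  finally show ?thesis by (simp add: Z_def sum_distrib_left)
qed

text \<open>The walks are grouped by their hyperedges \<open>\<sigma>\<close> at the positions in
  \<open>I\<close>. A hyperedge lies in at most \<open>L\<close> members of \<open>F\<close>, each
  the image of at most \<open>card I ^ card I\<close> maps \<open>\<sigma>\<close>; the choice of
  the position that carries the hyperedge gives one more factor \<open>card I\<close>. The volume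
  cancels by \<open>sum_return_edges\<close>.\<close>

lemma sum_conf_forbidden_le:
  assumes I: "I \<subseteq> {..<m}" "1 \<le> card I" and N: "0 \<le> N"
    and gap: "\<And>x y. card I < m \<Longrightarrow> x \<in> U \<Longrightarrow> y \<in> U \<Longrightarrow> dens (m - card I) x y \<le> N * (return x + return y)"
    and two: "card I < m \<Longrightarrow> real r * \<rho>\<^sup>2 * (vol / \<delta>) \<le> N"
    and full: "card I = m \<Longrightarrow> vol / \<delta> \<le> N"
    and F: "finite F" "\<And>J. J \<in> F \<Longrightarrow> card J = card I" "\<And>e. e \<in> E \<Longrightarrow> real (card {J \<in> F. e \<in> J}) \<le> L"
    and L: "0 \<le> L" and C: "0 \<le> C" "\<And>x. x \<in> U \<Longrightarrow> real (codeg E {x}) \<le> C * deg x"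
  shows "(\<Sum>xs\<in>XS. \<Sum>es | es \<in> ES \<and> es ` I \<in> F. conf xs es)
    \<le> 2 * real r * C * (real r / \<delta>) ^ (card I - 1) * N * real (card I) ^ Suc (card I) * L * Z"
proof (cases "U = {}")
  case True
  then have "XS = {}" using m_pos by (auto simp: PiE_eq_empty_iff)
  moreover have "Z = 0" unfolding Z_def using True by (intro sum.neutral) blast
  ultimately show ?thesis by (simp only: sum.empty mult_zero_right order_refl)
next
  case False
  then have vol: "0 < vol" using vol_gt_0 by blast
  let ?j = "card I" and ?R = "real r / \<delta>"
  let ?B = "?R ^ (?j - 1) * (real r * N / vol)" and ?S = "\<lambda>e. \<Sum>x\<in>e \<inter> U. return x"
  let ?\<Sigma> = "{\<sigma> \<in> PiE I (\<lambda>_. E). \<sigma> ` I \<in> F}"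
  have finI: "finite I" using I finite_subset by blast
  have fin\<Sigma>: "finite ?\<Sigma>"
    using finI finE finite_PiE[of I "\<lambda>_. E"] by (intro finite_subset[of ?\<Sigma> "PiE I (\<lambda>_. E)"]) auto
  have B: "0 \<le> ?B" using \<delta>_pos N vol by simp
  have S: "0 \<le> ?S e" for e by (intro sum_nonneg return_nonneg)
  have fiber: "{es \<in> {es \<in> ES. es ` I \<in> F}. restrict es I = \<sigma>}
     = PiE {..<m} (\<lambda>i. if i \<in> I then {\<sigma> i} else E)" if "\<sigma> \<in> ?\<Sigma>" for \<sigma>
  proof (intro equalityI subsetI)
    fix es assume es: "es \<in> {es \<in> {es \<in> ES. es ` I \<in> F}. restrict es I = \<sigma>}"
    then have "es i = \<sigma> i" if "i \<in> I" for i using that by auto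
    then show "es \<in> PiE {..<m} (\<lambda>i. if i \<in> I then {\<sigma> i} else E)"
      using es by (auto simp: PiE_def Pi_def)
  next
    fix es assume es: "es \<in> PiE {..<m} (\<lambda>i. if i \<in> I then {\<sigma> i} else E)"
    have eq: "es i = \<sigma> i" if "i \<in> I" for i
      using es that I(1) PiE_mem[OF es, of i] by auto
    then have "es ` I = \<sigma> ` I" by (intro image_cong) auto
    moreover have "es \<in> ES"
    proof (rule PiE_I)
      fix i assume i: "i \<in> {..<m}"
      show "es i \<in> E" using PiE_mem[OF es i] that by (cases "i \<in> I") (auto simp: PiE_def Pi_def)
    next
      fix i assume "i \<notin> {..<m}"
      then show "es i = undefined" using PiE_arb[OF es] by blast
    qed
    moreover have "restrict es I = \<sigma>"
      using that eq by (auto simp: fun_eq_iff restrict_def PiE_def extensional_def)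
    ultimately show "es \<in> {es \<in> {es \<in> ES. es ` I \<in> F}. restrict es I = \<sigma>}" using that by simp
  qed
  have "(\<Sum>xs\<in>XS. \<Sum>es | es \<in> ES \<and> es ` I \<in> F. conf xs es)
    = (\<Sum>xs\<in>XS. \<Sum>\<sigma>\<in>?\<Sigma>. \<Sum>es\<in>PiE {..<m} (\<lambda>i. if i \<in> I then {\<sigma> i} else E). conf xs es)"
  proof (rule sum.cong[OF refl])
    fix xs
    have "(\<lambda>es. restrict es I) ` {es \<in> ES. es ` I \<in> F} \<subseteq> ?\<Sigma>"
      using I(1) by (auto simp: PiE_def Pi_def)
    then have "(\<Sum>\<sigma>\<in>?\<Sigma>. \<Sum>es\<in>{es \<in> {es \<in> ES. es ` I \<in> F}. restrict es I = \<sigma>}. conf xs es)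
       = (\<Sum>es\<in>{es \<in> ES. es ` I \<in> F}. conf xs es)"
      using finite_ES fin\<Sigma> by (intro sum.group) auto
    then show "(\<Sum>es | es \<in> ES \<and> es ` I \<in> F. conf xs es)
      = (\<Sum>\<sigma>\<in>?\<Sigma>. \<Sum>es\<in>PiE {..<m} (\<lambda>i. if i \<in> I then {\<sigma> i} else E). conf xs es)"
      using fiber by (metis (no_types, lifting) sum.cong)
  qed
  also have "\<dots> = (\<Sum>\<sigma>\<in>?\<Sigma>. \<Sum>xs\<in>XS. \<Sum>es\<in>PiE {..<m} (\<lambda>i. if i \<in> I then {\<sigma> i} else E). conf xs es)"
    by (rule sum.swap)
  also have "\<dots> = (\<Sum>\<sigma>\<in>?\<Sigma>. \<Sum>x\<in>U. walk_sum U (kern I \<sigma>) m x x)"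
  proof (rule sum.cong[OF refl])
    fix \<sigma>
    have "(\<Sum>xs\<in>XS. \<Sum>es\<in>PiE {..<m} (\<lambda>i. if i \<in> I then {\<sigma> i} else E). conf xs es)
      = (\<Sum>x\<in>U. walk_sum U (\<lambda>i x y. \<Sum>e\<in>(if i \<in> I then {\<sigma> i} else E). wt x e y) m x x)"
      using finE by (intro sum_conf) auto
    also have "\<dots> = (\<Sum>x\<in>U. walk_sum U (kern I \<sigma>) m x x)"
      by (intro sum.cong refl walk_sum_cong) (simp add: kern_def step_eq_sum_wt)
    finally show "(\<Sum>xs\<in>XS. \<Sum>es\<in>PiE {..<m} (\<lambda>i. if i \<in> I then {\<sigma> i} else E). conf xs es) = \<dots>" .
  qed
  also have "\<dots> \<le> (\<Sum>\<sigma>\<in>?\<Sigma>. ?B * (2 * (\<Sum>i\<in>I. ?S (\<sigma> i))))"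
    using I N gap two full by (intro sum_mono closed_prescribed_le) auto
  also have "\<dots> = ?B * 2 * (\<Sum>\<sigma>\<in>?\<Sigma>. \<Sum>i\<in>I. ?S (\<sigma> i))"
    by (simp add: sum_distrib_left mult.assoc)
  also have "(\<Sum>\<sigma>\<in>?\<Sigma>. \<Sum>i\<in>I. ?S (\<sigma> i)) = (\<Sum>i\<in>I. \<Sum>\<sigma>\<in>?\<Sigma>. ?S (\<sigma> i))"
    by (rule sum.swap)
  also have "?B * 2 * (\<Sum>i\<in>I. \<Sum>\<sigma>\<in>?\<Sigma>. ?S (\<sigma> i)) \<le> ?B * 2 * (\<Sum>i\<in>I. real ?j ^ ?j * L * (C * vol * Z))"
  proof (intro mult_left_mono sum_mono)
    fix i assume i: "i \<in> I"
    have cnt: "real (card {\<sigma> \<in> ?\<Sigma>. \<sigma> i = e}) \<le> real ?j ^ ?j * L" if e: "e \<in> E" for e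
    proof -
      let ?Fe = "{J \<in> F. e \<in> J}"
      have "{\<sigma> \<in> ?\<Sigma>. \<sigma> i = e} \<subseteq> (\<Union>J\<in>?Fe. PiE I (\<lambda>_. J))"
      proof
        fix \<sigma> assume \<sigma>: "\<sigma> \<in> {\<sigma> \<in> ?\<Sigma>. \<sigma> i = e}"
        then have "\<sigma> \<in> PiE I (\<lambda>_. \<sigma> ` I)" "\<sigma> ` I \<in> ?Fe" using i by (auto simp: PiE_def Pi_def)
        then show "\<sigma> \<in> (\<Union>J\<in>?Fe. PiE I (\<lambda>_. J))" by blast
      qed
      moreover have finJ: "finite J" if "J \<in> F" for J
        using F(2)[OF that] I(2) card.infinite by fastforce
      ultimately have "card {\<sigma> \<in> ?\<Sigma>. \<sigma> i = e} \<le> card (\<Union>J\<in>?Fe. PiE I (\<lambda>_. J))"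
        using F(1) finI by (intro card_mono) (auto intro!: finite_PiE)
      also have "\<dots> \<le> (\<Sum>J\<in>?Fe. card (PiE I (\<lambda>_. J)))" using F(1) by (intro card_UN_le) auto
      also have "\<dots> = (\<Sum>J\<in>?Fe. ?j ^ ?j)"
        using F(2) finI by (intro sum.cong refl) (auto simp: card_PiE)
      also have "\<dots> = card ?Fe * ?j ^ ?j" by simp
      finally have "real (card {\<sigma> \<in> ?\<Sigma>. \<sigma> i = e}) \<le> real (card ?Fe * ?j ^ ?j)" by (rule of_nat_mono)
      also have "\<dots> \<le> L * real ?j ^ ?j" using F(3)[OF e] by (simp add: mult_right_mono)
      finally show ?thesis by (simp add: mult.commute)
    qed
    have "(\<Sum>\<sigma>\<in>?\<Sigma>. ?S (\<sigma> i)) = (\<Sum>e\<in>E. \<Sum>\<sigma>\<in>{\<sigma> \<in> ?\<Sigma>. \<sigma> i = e}. ?S (\<sigma> i))"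
      using fin\<Sigma> finE i by (intro sum.group[symmetric]) auto
    also have "\<dots> = (\<Sum>e\<in>E. real (card {\<sigma> \<in> ?\<Sigma>. \<sigma> i = e}) * ?S e)"
      by (intro sum.cong refl) simp
    also have "\<dots> \<le> (\<Sum>e\<in>E. real ?j ^ ?j * L * ?S e)"
      using cnt S by (intro sum_mono mult_right_mono) auto
    also have "\<dots> = real ?j ^ ?j * L * (\<Sum>e\<in>E. ?S e)" by (simp add: sum_distrib_left)
    also have "\<dots> \<le> real ?j ^ ?j * L * (C * vol * Z)"
      using sum_return_edges[OF C(2)] L by (intro mult_left_mono) auto
    finally show "(\<Sum>\<sigma>\<in>?\<Sigma>. ?S (\<sigma> i)) \<le> real ?j ^ ?j * L * (C * vol * Z)" .
  qed (rule mult_nonneg_nonneg[OF B zero_le_numeral])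
  also have "\<dots> = 2 * real r * C * ?R ^ (?j - 1) * N * real ?j ^ Suc ?j * L * Z"
    using vol by simp
  finally show ?thesis .
qed


text \<open>A union bound: repeated vertices, clashes and forbidden sets take at most a quarter of
  \<open>Z\<close> each, so a configuration of positive weight remains. Single positions are left
  out because forbidden single edges will have been deleted beforehand.\<close>

lemma exists_good_config:
  assumes U: "U \<noteq> {}"
    and X: "\<And>x y. x \<in> U \<Longrightarrow> y \<in> U \<Longrightarrow> vol * step x y / deg y \<le> X"
    and \<eta>: "0 \<le> \<eta>" "\<And>Q v. v \<notin> Q \<Longrightarrow> real (codeg E (insert v Q)) \<le> \<eta> * real (codeg E Q)"
    and C: "0 \<le> C" "\<And>x. x \<in> U \<Longrightarrow> real (codeg E {x}) \<le> C * deg x"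
    and N: "\<And>j. 0 \<le> N j"
    and gap: "\<And>j x y. 2 \<le> j \<Longrightarrow> j < m \<Longrightarrow> x \<in> U \<Longrightarrow> y \<in> U \<Longrightarrow> dens (m - j) x y \<le> N j * (return x + return y)"
    and two: "\<And>j. 2 \<le> j \<Longrightarrow> j < m \<Longrightarrow> real r * \<rho>\<^sup>2 * (vol / \<delta>) \<le> N j"
    and full: "vol / \<delta> \<le> N m"
    and F: "\<And>j. finite (F j)" "\<And>j J. J \<in> F j \<Longrightarrow> card J = j"
      "\<And>j e. 2 \<le> j \<Longrightarrow> j \<le> m \<Longrightarrow> e \<in> E \<Longrightarrow> real (card {J \<in> F j. e \<in> J}) \<le> L j" and L: "\<And>j. 0 \<le> L j"
    and small1: "real m ^ 2 * (\<rho> * X) \<le> 1 / 4"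
    and small2: "real m ^ 2 * (real (r + m) * \<eta>) \<le> 1 / 4"
    and small3: "\<And>j. 2 \<le> j \<Longrightarrow> j \<le> m \<Longrightarrow>
      2 ^ m * (2 * real r * C * (real r / \<delta>) ^ (j - 1) * N j * real j ^ Suc j * L j) \<le> 1 / 4"
  obtains xs es where "xs \<in> XS" "es \<in> ES" "0 < conf xs es" "inj_on xs {..<m}"
    "\<And>i k. i < m \<Longrightarrow> k < m \<Longrightarrow> i \<noteq> k \<Longrightarrow> \<not> clash xs k (es i) (es k)"
    "\<And>I. I \<subseteq> {..<m} \<Longrightarrow> 2 \<le> card I \<Longrightarrow> es ` I \<notin> F (card I)"
proof -
  \<comment> \<open>\<open>P\<close> lists each pair once, as the bound for repeated vertices is
    stated for \<open>a < b\<close>; \<open>Q\<close> lists ordered pairs because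
    \<open>clash\<close> is not symmetric.\<close>
  define P where "P = {p \<in> {..<m} \<times> {..<m}. fst p < snd p}"
  define Q where "Q = {p \<in> {..<m} \<times> {..<m}. fst p \<noteq> snd p}"
  define \<I> where "\<I> = {I \<in> Pow {..<m}. 2 \<le> card I}"
  have finPQ: "finite P" "finite Q" "finite \<I>" by (auto simp: P_def Q_def \<I>_def)
  have cP: "real (card P) \<le> real m ^ 2"
  proof -
    have "card P \<le> card ({..<m} \<times> {..<m})" unfolding P_def by (intro card_mono) auto
    then show ?thesis by (simp add: card_cartesian_product power2_eq_square flip: of_nat_mult of_nat_add)
  qed
  have cQ: "real (card Q) \<le> real m ^ 2"
  proof -
    have "card Q \<le> card ({..<m} \<times> {..<m})" unfolding Q_def by (intro card_mono) auto
    then show ?thesis by (simp add: card_cartesian_product power2_eq_square flip: of_nat_mult of_nat_add)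
  qed
  have cI: "real (card \<I>) \<le> 2 ^ m"
  proof -
    have "card \<I> \<le> card (Pow {..<m})" unfolding \<I>_def by (intro card_mono) auto
    then have "card \<I> \<le> 2 ^ m" by (simp add: card_Pow)
    then show ?thesis by (metis of_nat_le_iff of_nat_numeral of_nat_power)
  qed
  have Z: "0 < Z" by (rule Z_ge[OF U])
  have X0: "0 \<le> \<rho> * X"
  proof -
    obtain u where u: "u \<in> U" using U by auto
    have "0 \<le> vol * step u u / deg u" by (intro divide_nonneg_nonneg mult_nonneg_nonneg vol_nonneg step_nonneg deg_nonneg)
    then show ?thesis using X[OF u u] \<rho>_nonneg[OF u] by simp
  qed
  have bad1: "(\<Sum>xs\<in>XS. \<Sum>es\<in>ES. \<Sum>p\<in>P. if xs (fst p) = xs (snd p) then conf xs es else 0) \<le> Z / 4"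
  proof -
    have "(\<Sum>xs\<in>XS. \<Sum>es\<in>ES. \<Sum>p\<in>P. if xs (fst p) = xs (snd p) then conf xs es else 0)
      = (\<Sum>xs\<in>XS. \<Sum>p\<in>P. \<Sum>es\<in>ES. if xs (fst p) = xs (snd p) then conf xs es else 0)"
      by (rule sum.cong[OF refl], rule sum.swap)
    also have "\<dots> = (\<Sum>p\<in>P. \<Sum>xs\<in>XS. \<Sum>es\<in>ES. if xs (fst p) = xs (snd p) then conf xs es else 0)"
      by (rule sum.swap)
    also have "\<dots> \<le> (\<Sum>p\<in>P. \<rho> * X * Z)"
    proof (rule sum_mono)
      fix p assume p: "p \<in> P"
      have "(\<Sum>xs\<in>XS. \<Sum>es\<in>ES. if xs (fst p) = xs (snd p) then conf xs es else 0)
        = (\<Sum>xs\<in>XS. if xs (fst p) = xs (snd p) then \<Sum>es\<in>ES. conf xs es else 0)"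
        by (intro sum.cong refl) auto
      also have "\<dots> = (\<Sum>xs | xs \<in> XS \<and> xs (fst p) = xs (snd p). \<Sum>es\<in>ES. conf xs es)"
        by (rule sum.inter_filter[OF finite_XS, symmetric])
      also have "\<dots> \<le> \<rho> * X * Z"
        using p by (intro sum_conf_repeated_vertex_le X U) (auto simp: P_def)
      finally show "(\<Sum>xs\<in>XS. \<Sum>es\<in>ES. if xs (fst p) = xs (snd p) then conf xs es else 0) \<le> \<rho> * X * Z" .
    qed
    also have "\<dots> = real (card P) * (\<rho> * X) * Z" by simp
    also have "\<dots> \<le> real m ^ 2 * (\<rho> * X) * Z"
      using cP X0 Z by (intro mult_right_mono) auto
    also have "\<dots> \<le> 1 / 4 * Z" using small1 Z by (intro mult_right_mono) auto
    finally show ?thesis by simp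
  qed
  have bad2: "(\<Sum>xs\<in>XS. \<Sum>es\<in>ES. \<Sum>p\<in>Q. if clash xs (snd p) (es (fst p)) (es (snd p)) then conf xs es else 0) \<le> Z / 4"
  proof -
    have "(\<Sum>xs\<in>XS. \<Sum>es\<in>ES. \<Sum>p\<in>Q. if clash xs (snd p) (es (fst p)) (es (snd p)) then conf xs es else 0)
      = (\<Sum>xs\<in>XS. \<Sum>p\<in>Q. \<Sum>es\<in>ES. if clash xs (snd p) (es (fst p)) (es (snd p)) then conf xs es else 0)"
      by (rule sum.cong[OF refl], rule sum.swap)
    also have "\<dots> \<le> (\<Sum>xs\<in>XS. \<Sum>p\<in>Q. real (r + m) * \<eta> * (\<Sum>es\<in>ES. conf xs es))"
    proof (intro sum_mono)
      fix xs p assume xs: "xs \<in> XS" and p: "p \<in> Q"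
      have "(\<Sum>es\<in>ES. if clash xs (snd p) (es (fst p)) (es (snd p)) then conf xs es else 0)
        = (\<Sum>es | es \<in> ES \<and> clash xs (snd p) (es (fst p)) (es (snd p)). conf xs es)"
        by (rule sum.inter_filter[OF finite_ES, symmetric])
      also have "\<dots> \<le> real (r + m) * \<eta> * (\<Sum>es\<in>ES. conf xs es)"
        using p by (intro sum_conf_clash_le xs \<eta>) (auto simp: Q_def)
      finally show "(\<Sum>es\<in>ES. if clash xs (snd p) (es (fst p)) (es (snd p)) then conf xs es else 0)
        \<le> real (r + m) * \<eta> * (\<Sum>es\<in>ES. conf xs es)" .
    qed
    also have "\<dots> = real (card Q) * (real (r + m) * \<eta>) * Z"
      unfolding sum_conf_all[symmetric] by (simp add: sum_distrib_left mult.assoc)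
    also have "\<dots> \<le> real m ^ 2 * (real (r + m) * \<eta>) * Z"
      using cQ \<eta>(1) Z by (intro mult_right_mono) auto
    also have "\<dots> \<le> 1 / 4 * Z" using small2 Z by (intro mult_right_mono) auto
    finally show ?thesis by simp
  qed
  have bad3: "(\<Sum>xs\<in>XS. \<Sum>es\<in>ES. \<Sum>I\<in>\<I>. if es ` I \<in> F (card I) then conf xs es else 0) \<le> Z / 4"
  proof -
    have "(\<Sum>xs\<in>XS. \<Sum>es\<in>ES. \<Sum>I\<in>\<I>. if es ` I \<in> F (card I) then conf xs es else 0)
      = (\<Sum>xs\<in>XS. \<Sum>I\<in>\<I>. \<Sum>es\<in>ES. if es ` I \<in> F (card I) then conf xs es else 0)"
      by (rule sum.cong[OF refl], rule sum.swap)
    also have "\<dots> = (\<Sum>I\<in>\<I>. \<Sum>xs\<in>XS. \<Sum>es\<in>ES. if es ` I \<in> F (card I) then conf xs es else 0)"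
      by (rule sum.swap)
    \<comment> \<open>There are at most \<open>2 ^ m\<close> sets of positions, and
      \<open>small3\<close> reserves an equal share of \<open>Z / 4\<close> for each.\<close>
    also have "\<dots> \<le> (\<Sum>I\<in>\<I>. Z / (4 * 2 ^ m))"
    proof (rule sum_mono)
      fix I assume "I \<in> \<I>"
      then have I: "I \<subseteq> {..<m}" "2 \<le> card I" by (auto simp: \<I>_def)
      have Im: "card I \<le> m" using card_mono[OF _ I(1)] by simp
      let ?b = "2 * real r * C * (real r / \<delta>) ^ (card I - 1) * N (card I) * real (card I) ^ Suc (card I) * L (card I)"
      have "(\<Sum>xs\<in>XS. \<Sum>es\<in>ES. if es ` I \<in> F (card I) then conf xs es else 0)
        = (\<Sum>xs\<in>XS. \<Sum>es | es \<in> ES \<and> es ` I \<in> F (card I). conf xs es)"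
        by (rule sum.cong[OF refl], rule sum.inter_filter[OF finite_ES, symmetric])
      also have "\<dots> \<le> ?b * Z"
        using I Im N gap two full F C L by (intro sum_conf_forbidden_le) auto
      also have "\<dots> \<le> Z / (4 * 2 ^ m)"
      proof -
        have "?b \<le> 1 / (4 * 2 ^ m)" using small3[OF I(2) Im] by (simp add: field_simps)
        then have "?b * Z \<le> 1 / (4 * 2 ^ m) * Z" using Z by (intro mult_right_mono) auto
        then show ?thesis by simp
      qed
      finally show "(\<Sum>xs\<in>XS. \<Sum>es\<in>ES. if es ` I \<in> F (card I) then conf xs es else 0) \<le> Z / (4 * 2 ^ m)" .
    qed
    also have "\<dots> = real (card \<I>) * (Z / (4 * 2 ^ m))" by simp
    also have "\<dots> \<le> 2 ^ m * (Z / (4 * 2 ^ m))" using cI Z by (intro mult_right_mono) auto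
    finally show ?thesis by simp
  qed
  let ?good = "\<lambda>xs es. 0 < conf xs es \<and> inj_on xs {..<m}
     \<and> (\<forall>p\<in>Q. \<not> clash xs (snd p) (es (fst p)) (es (snd p))) \<and> (\<forall>I\<in>\<I>. es ` I \<notin> F (card I))"
  have "\<exists>xs\<in>XS. \<exists>es\<in>ES. ?good xs es"
  proof (rule ccontr)
    assume no: "\<not> ?thesis"
    let ?f1 = "\<lambda>xs es. \<Sum>p\<in>P. if xs (fst p) = xs (snd p) then conf xs es else 0"
    let ?f2 = "\<lambda>xs es. \<Sum>p\<in>Q. if clash xs (snd p) (es (fst p)) (es (snd p)) then conf xs es else 0"
    let ?f3 = "\<lambda>xs es. \<Sum>I\<in>\<I>. if es ` I \<in> F (card I) then conf xs es else 0"
    have nn: "0 \<le> ?f1 xs es" "0 \<le> ?f2 xs es" "0 \<le> ?f3 xs es" for xs es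
      by (auto intro!: sum_nonneg conf_nonneg)
    have cover: "conf xs es \<le> ?f1 xs es + (?f2 xs es + ?f3 xs es)" if "xs \<in> XS" "es \<in> ES" for xs es
    proof -
      have "\<not> ?good xs es" using no that by blast
      then consider "conf xs es = 0" | "\<not> inj_on xs {..<m}"
        | p where "p \<in> Q" "clash xs (snd p) (es (fst p)) (es (snd p))" | I where "I \<in> \<I>" "es ` I \<in> F (card I)"
        using conf_nonneg[of xs es] by (metis order_le_less)
      then show ?thesis
      proof cases
        case 1
        then show ?thesis using nn[where xs=xs and es=es] by linarith
      next
        case 2
        then obtain a b where "a < m" "b < m" "a \<noteq> b" "xs a = xs b" by (auto simp: inj_on_def)
        then have "(min a b, max a b) \<in> P" "xs (min a b) = xs (max a b)"
          by (auto simp: P_def min_def max_def)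
        then obtain p where p: "p \<in> P" "xs (fst p) = xs (snd p)" by force
        then have "conf xs es \<le> ?f1 xs es"
          using member_le_sum[of p P "\<lambda>p. if xs (fst p) = xs (snd p) then conf xs es else 0"] finPQ
          by (auto simp: conf_nonneg)
        then show ?thesis using nn[where xs=xs and es=es] by linarith
      next
        case (3 p)
        then have "conf xs es \<le> ?f2 xs es"
          using member_le_sum[of p Q "\<lambda>p. if clash xs (snd p) (es (fst p)) (es (snd p)) then conf xs es else 0"] finPQ
          by (auto simp: conf_nonneg)
        then show ?thesis using nn[where xs=xs and es=es] by linarith
      next
        case (4 I)
        then have "conf xs es \<le> ?f3 xs es"
          using member_le_sum[of I \<I> "\<lambda>I. if es ` I \<in> F (card I) then conf xs es else 0"] finPQ
          by (auto simp: conf_nonneg)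
        then show ?thesis using nn[where xs=xs and es=es] by linarith
      qed
    qed
    have "Z \<le> (\<Sum>xs\<in>XS. \<Sum>es\<in>ES. ?f1 xs es + (?f2 xs es + ?f3 xs es))"
      unfolding sum_conf_all[symmetric] by (intro sum_mono cover)
    also have "\<dots> = (\<Sum>xs\<in>XS. \<Sum>es\<in>ES. ?f1 xs es) + ((\<Sum>xs\<in>XS. \<Sum>es\<in>ES. ?f2 xs es) + (\<Sum>xs\<in>XS. \<Sum>es\<in>ES. ?f3 xs es))"
      by (simp only: sum.distrib)
    finally show False using bad1 bad2 bad3 Z by linarith
  qed
  then obtain xs es where good: "xs \<in> XS" "es \<in> ES" "?good xs es" by blast
  show ?thesis
  proof (rule that[of xs es])
    show "\<not> clash xs k (es i) (es k)" if "i < m" "k < m" "i \<noteq> k" for i k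
      using good(3) that by (force simp: Q_def)
    show "es ` I \<notin> F (card I)" if "I \<subseteq> {..<m}" "2 \<le> card I" for I
      using good(3) that by (auto simp: \<I>_def)
  qed (use good in auto)
qed

end

section \<open>Linear cycles from closed walks\<close>

text \<open>The joints of the cycle, at the multiples of \<open>d = r - 1\<close>, go to the
  vertices of the walk, and the \<open>d - 1\<close> numbers between two joints enumerate the
  remaining vertices of a hyperedge. Disjointness over all ordered pairs makes this
  injective.\<close>

lemma cyclic_edges_form_linear_cycle:
  assumes r: "3 \<le> r" and k: "2 \<le> k"
    and xs: "inj_on xs {..<k}"
    and mem: "\<And>i. i < k \<Longrightarrow> xs i \<in> es i" "\<And>i. i < k \<Longrightarrow> xs (Suc i mod k) \<in> es i"
    and es: "\<And>i. i < k \<Longrightarrow> card (es i) = r" "\<And>i. i < k \<Longrightarrow> es i \<subseteq> V" "\<And>i. i < k \<Longrightarrow> es i \<in> E"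
    and disj: "\<And>i j. i < k \<Longrightarrow> j < k \<Longrightarrow> i \<noteq> j \<Longrightarrow>
      (es j - {xs j, xs (Suc j mod k)}) \<inter> (es i \<union> xs ` {..<k}) = {}"
  shows "es ` {..<k} \<in> lc_copies r k V E" and "inj_on es {..<k}"
proof -
  define d where "d = r - 1"
  have d: "2 \<le> d" using r by (simp add: d_def)
  let ?in = "\<lambda>i. es i - {xs i, xs (Suc i mod k)}"
  have fin: "finite (es i)" if "i < k" for i using es(1)[OF that] r card.infinite by fastforce
  have ne: "xs i \<noteq> xs (Suc i mod k)" if "i < k" for i
  proof
    assume "xs i = xs (Suc i mod k)"
    then have "i = Suc i mod k" using xs that k by (auto dest: inj_onD)
    then show False using that k by (metis Suc_lessI mod_less mod_self n_not_Suc_n not_numeral_le_zero numeral_2_eq_2 Suc_n_not_le_n)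
  qed
  have card_in: "card (?in i) = d - 1" if "i < k" for i
    using es(1)[OF that] mem[OF that] ne[OF that] fin[OF that] by (simp add: d_def card_Diff_subset)
  have "\<exists>g. bij_betw g {1..<d} (?in i)" if "i < k" for i
    using card_in[OF that] fin[OF that] by (intro finite_same_card_bij) auto
  then obtain g where g: "\<And>i. i < k \<Longrightarrow> bij_betw (g i) {1..<d} (?in i)" by metis
  \<comment> \<open>Vertices are numbered from 1 to \<open>k * d\<close>. Reducing
    \<open>p div d\<close> modulo \<open>k\<close> sends the last one to \<open>xs 0\<close>, in
    accordance with index 0 standing for \<open>k * d\<close>.\<close>
  define \<phi> where "\<phi> p = (if p mod d = 0 then xs (p div d mod k) else g (p div d) (p mod d))" for p
  have in_mem: "g i s \<in> ?in i" if "i < k" "1 \<le> s" "s < d" for i s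
    using bij_betwE[OF g[OF that(1)]] that by auto
  have joint: "\<phi> (i * d) = xs (i mod k)" for i using d by (simp add: \<phi>_def)
  have inner: "\<phi> (i * d + s) = g i s" if "1 \<le> s" "s < d" for i s using that by (simp add: \<phi>_def)
  have decomp: "(\<exists>i\<in>{1..k}. p = i * d) \<or> (\<exists>i<k. \<exists>s\<in>{1..<d}. p = i * d + s)" if "p \<in> {1..k * d}" for p
  proof (cases "p mod d = 0")
    case True
    then obtain i where i: "p = i * d" by (metis dvd_eq_mod_eq_0 dvd_div_mult_self)
    then have "1 \<le> i" "i \<le> k" using that d by auto
    then show ?thesis using i by auto
  next
    case False
    have p: "p = p div d * d + p mod d" by simp
    have "p mod d < d" using d by simp
    moreover have "p div d < k"
    proof (rule ccontr)
      assume "\<not> p div d < k"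
      then have "k * d \<le> p div d * d" by simp
      moreover have "p \<le> k * d" "0 < p mod d" using that False by auto
      ultimately show False using p by linarith
    qed
    ultimately show ?thesis using p False by (intro disjI2 exI[of _ "p div d"]) (auto intro!: bexI[of _ "p mod d"])
  qed
  \<comment> \<open>The disjointness hypothesis concerns distinct positions only; a second position,
    available by \<open>k \<ge> 2\<close>, separates inner vertices from the walk.\<close>
  have other: "\<exists>j<k. j \<noteq> i" for i using k by (cases "i = 0") (auto intro: exI[of _ 1] exI[of _ 0])
  have not_joint: "g i s \<noteq> xs j" if "i < k" "s \<in> {1..<d}" "j < k" for i s j
  proof -
    obtain j' where "j' < k" "j' \<noteq> i" using other by blast
    then have "?in i \<inter> xs ` {..<k} = {}" using disj[of j' i] that by auto
    then show ?thesis using in_mem[of i s] that by auto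
  qed
  have kpos: "0 < k" using k by simp
  have inj: "inj_on \<phi> {1..k * d}"
  proof (rule inj_onI)
    fix p q assume p: "p \<in> {1..k * d}" and q: "q \<in> {1..k * d}" and eq: "\<phi> p = \<phi> q"
    show "p = q"
      using decomp[OF p]
    proof (elim disjE bexE exE conjE)
      fix i assume i: "i \<in> {1..k}" "p = i * d"
      show ?thesis using decomp[OF q]
      proof (elim disjE bexE exE conjE)
        fix j assume j: "j \<in> {1..k}" "q = j * d"
        have "xs (i mod k) = xs (j mod k)" using eq i j joint by simp
        then have "i mod k = j mod k" using xs kpos by (auto dest: inj_onD)
        moreover have "i = (if i mod k = 0 then k else i mod k)" "j = (if j mod k = 0 then k else j mod k)"
          using i(1) j(1) by (auto simp: le_less)
        ultimately have "i = j" by metis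
        then show ?thesis using i j by simp
      next
        fix j s assume j: "j < k" "s \<in> {1..<d}" "q = j * d + s"
        then have "g j s = xs (i mod k)" using eq i joint inner by simp
        then show ?thesis using not_joint[of j s "i mod k"] j kpos by auto
      qed
    next
      fix i s assume i: "i < k" "s \<in> {1..<d}" "p = i * d + s"
      then have \<phi>p: "\<phi> p = g i s" using inner by simp
      show ?thesis using decomp[OF q]
      proof (elim disjE bexE exE conjE)
        fix j assume j: "j \<in> {1..k}" "q = j * d"
        then have "g i s = xs (j mod k)" using eq \<phi>p joint by simp
        then show ?thesis using not_joint[of i s "j mod k"] i kpos by auto
      next
        fix j s' assume j: "j < k" "s' \<in> {1..<d}" "q = j * d + s'"
        then have eq': "g i s = g j s'" using eq \<phi>p inner by simp
        have "i = j"
        proof (rule ccontr)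
          assume "i \<noteq> j"
          then have "?in j \<inter> es i = {}" using disj[of i j] i j by auto
          moreover have "g i s \<in> ?in i" "g j s' \<in> ?in j" using in_mem i j by auto
          ultimately show False using eq' by auto
        qed
        moreover from this have "s = s'"
          using eq' g[OF i(1)] i(2) j(2) by (auto simp: bij_betw_def dest: inj_onD)
        ultimately show ?thesis using i j by simp
      qed
    qed
  qed
  have edge: "\<phi> ` lc_edge r k (Suc i) = es i" if i: "i < k" for i
  proof -
    have v0: "\<phi> (lc_vertex r k (i * d)) = xs i"
    proof (cases "i = 0")
      case True
      then show ?thesis using joint[of k] by (simp add: lc_vertex_def d_def)
    next
      case False
      then show ?thesis using joint[of i] i d by (simp add: lc_vertex_def)
    qed
    have v1: "\<phi> (lc_vertex r k (Suc i * d)) = xs (Suc i mod k)"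
      using joint[of "Suc i"] d by (simp add: lc_vertex_def)
    have vs: "\<phi> (lc_vertex r k (i * d + s)) = g i s" if "s \<in> {1..<d}" for s
      using inner[of s i] that by (simp add: lc_vertex_def)
    have "{i * d..Suc i * d} = insert (i * d) (insert (Suc i * d) ((\<lambda>s. i * d + s) ` {1..<d}))"
    proof (intro equalityI subsetI)
      fix p assume p: "p \<in> {i * d..Suc i * d}"
      then have "p = i * d \<or> p = Suc i * d \<or> p - i * d \<in> {1..<d}" by auto
      moreover have "p = i * d + (p - i * d)" using p by simp
      ultimately show "p \<in> insert (i * d) (insert (Suc i * d) ((\<lambda>s. i * d + s) ` {1..<d}))" by blast
    qed auto
    moreover have "lc_edge r k (Suc i) = lc_vertex r k ` {i * d..Suc i * d}"
      by (simp add: lc_edge_def d_def)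
    ultimately have "\<phi> ` lc_edge r k (Suc i)
      = insert (xs i) (insert (xs (Suc i mod k)) ((\<lambda>s. \<phi> (lc_vertex r k (i * d + s))) ` {1..<d}))"
      using v0 v1 by (simp only: image_insert image_image)
    also have "(\<lambda>s. \<phi> (lc_vertex r k (i * d + s))) ` {1..<d} = g i ` {1..<d}"
      using vs by (rule image_cong[OF refl])
    also have "g i ` {1..<d} = ?in i" using g[OF i] by (simp add: bij_betw_def)
    also have "insert (xs i) (insert (xs (Suc i mod k)) (?in i)) = es i" using mem[OF i] by auto
    finally show ?thesis .
  qed
  have edges: "(\<lambda>e. \<phi> ` e) ` lc_edges r k = es ` {..<k}"
  proof -
    have "{1..k} = Suc ` {..<k}" by (simp add: image_Suc_lessThan)
    then have "(\<lambda>e. \<phi> ` e) ` lc_edges r k = (\<lambda>i. \<phi> ` lc_edge r k (Suc i)) ` {..<k}"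
      by (simp only: lc_edges_def image_image)
    also have "\<dots> = es ` {..<k}" using edge by (intro image_cong) auto
    finally show ?thesis .
  qed
  have "\<phi> ` {1..k * d} \<subseteq> V"
  proof
    fix v assume "v \<in> \<phi> ` {1..k * d}"
    then obtain p where p: "p \<in> {1..k * d}" "v = \<phi> p" by auto
    show "v \<in> V" using decomp[OF p(1)]
    proof (elim disjE bexE exE conjE)
      fix i assume "i \<in> {1..k}" "p = i * d"
      then have "v = xs (i mod k)" using p joint by simp
      then show ?thesis using mem(1)[of "i mod k"] es(2)[of "i mod k"] kpos by auto
    next
      fix i s assume "i < k" "s \<in> {1..<d}" "p = i * d + s"
      then show ?thesis using in_mem[of i s] inner[of s i] p es(2)[of i] by auto
    qed
  qed
  then show "es ` {..<k} \<in> lc_copies r k V E"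
    unfolding lc_copies_def lc_vertices_def d_def[symmetric]
    using inj edges es(3) by (intro CollectI conjI exI[of _ \<phi>]) auto
  show "inj_on es {..<k}"
  proof (rule inj_onI, rule ccontr)
    fix i j assume ij: "i \<in> {..<k}" "j \<in> {..<k}" "es i = es j" "i \<noteq> j"
    then have "?in j \<inter> es i = {}" using disj[of i j] by auto
    then have "?in j = {}" using ij(3) by auto
    then have "d - 1 = 0" using card_in[of j] ij by (metis card.empty lessThan_iff)
    then show False using d by simp
  qed
qed

section \<open>Avoiding forbidden sets of edges\<close>

context clean_hypergraph
begin

text \<open>The exponent of \<open>n\<close> must not exceed \<open>(j - 1) / (m - 1)\<close>. A gap
  of one step has exponent 1/3, and there \<open>j = m - 1\<close>. A longer gap has exponent
  \<open>a / (3 * (l - 1))\<close> with \<open>a\<close> half of \<open>j\<close> rounded up, and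
  \<open>a \<le> j - 1\<close> together with \<open>2 * l - 1 \<le> 3 * (l - 1)\<close>
  suffices.\<close>

lemma dens_gap_le_powr:
  assumes X: "\<And>x y. x \<in> U \<Longrightarrow> y \<in> U \<Longrightarrow> vol * step x y / deg y \<le> B * n powr (1 / 3)"
    and B: "1 \<le> B" and n: "1 \<le> n" and j: "2 \<le> j" "j < m" and xy: "x \<in> U" "y \<in> U"
  shows "dens (m - j) x y \<le> B * n powr (real (j - 1) / real (m - 1)) * (return x + return y)"
proof -
  let ?X = "B * n powr (1 / 3)" and ?e = "real (j - 1) / real (m - 1)"
  have ret: "1 \<le> return x + return y" using one_le_return[OF xy(1)] one_le_return[OF xy(2)] by linarith
  have "1 \<le> n powr (1 / 3)" using n by (simp add: ge_one_powr_ge_zero)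
  then have X1: "1 \<le> ?X" using B mult_mono[of 1 B 1 "n powr (1 / 3)"] by simp
  show ?thesis
  proof (cases "m - j = 1")
    case True
    have "dens (m - j) x y \<le> ?X" using True by (intro dens_le[OF X xy]) auto
    also have "\<dots> \<le> B * n powr ?e"
    proof -
      have "real (j - 1) = real m - 2" using True j by linarith
      then have "1 / 3 \<le> ?e" using l_ge by (simp add: field_simps of_nat_diff)
      then show ?thesis using B n by (intro mult_left_mono powr_mono) auto
    qed
    also have "\<dots> \<le> B * n powr ?e * (return x + return y)"
      using ret B mult_left_mono[of 1 "return x + return y" "B * n powr ?e"] by simp
    finally show ?thesis .
  next
    case False
    define a where "a = l - (m - j) div 2"
    have a: "a \<le> j - 1" "a \<le> l - 1" using j False l_ge by (auto simp: a_def)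
    let ?p = "real a / real (l - 1)"
    have p: "?p \<le> 1" "0 \<le> ?p" using a l_ge by (auto simp: divide_simps)
    have "dens (m - j) x y \<le> ?X powr ?p * (dens (l + l) x x + dens (l + l) y y)"
      unfolding a_def using j False l_ge by (intro dens_gap_le[OF X X1 xy]) auto
    also have "\<dots> = ?X powr ?p * (return x + return y)" by (simp add: return_def)
    also have "\<dots> \<le> B * n powr ?e * (return x + return y)"
    proof (intro mult_right_mono)
      have "?X powr ?p = B powr ?p * n powr (1 / 3 * ?p)"
        using B n by (simp add: powr_mult powr_powr)
      also have "\<dots> \<le> B powr 1 * n powr ?e"
      proof (intro mult_mono powr_mono)
        have "real a * (2 * real l - 1) \<le> real (j - 1) * (3 * (real l - 1))"
          using a l_ge by (intro mult_mono) auto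
        then show "1 / 3 * ?p \<le> ?e" using l_ge by (simp add: field_simps of_nat_diff)
      qed (use p B n in auto)
      finally show "?X powr ?p \<le> B * n powr ?e" using B by simp
    qed (use ret in auto)
    finally show ?thesis .
  qed
qed

end

lemma card_overloaded_le:
  fixes E :: "'b set" and F :: "'b set set"
  assumes E: "finite E" and F: "finite F" "\<And>J. J \<in> F \<Longrightarrow> J \<subseteq> E \<and> card J = j" and b: "0 < b"
  shows "b * real (card {e \<in> E. b < real (card {J \<in> F. e \<in> J})}) \<le> real j * real (card F)"
proof -
  let ?A = "{e \<in> E. b < real (card {J \<in> F. e \<in> J})}"
  have "b * real (card ?A) = (\<Sum>e\<in>?A. b)" by simp
  also have "\<dots> \<le> (\<Sum>e\<in>?A. real (card {J \<in> F. e \<in> J}))" by (intro sum_mono) auto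
  also have "\<dots> \<le> (\<Sum>e\<in>E. real (card {J \<in> F. e \<in> J}))" using E by (intro sum_mono2) auto
  also have "\<dots> = (\<Sum>e\<in>E. \<Sum>J\<in>{J \<in> F. e \<in> J}. 1)" by simp
  also have "\<dots> = (\<Sum>J\<in>F. \<Sum>e\<in>{e \<in> E. e \<in> J}. 1)" by (rule sum.swap_restrict[OF E F(1)])
  also have "\<dots> = (\<Sum>J\<in>F. real j)"
  proof (intro sum.cong refl)
    fix J assume "J \<in> F"
    then have "{e \<in> E. e \<in> J} = J" "card J = j" using F(2) by auto
    then show "(\<Sum>e\<in>{e \<in> E. e \<in> J}. 1) = real j" by simp
  qed
  finally show ?thesis by (simp add: mult.commute)
qed

text \<open>Each constant serves one bound: \<open>\<alpha>\<close> keeps walks through forbidden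
  sets below a quarter of the total weight, \<open>\<kappa>\<close> keeps overloaded edges below a
  quarter of all edges, the bound on \<open>t\<close> makes clashes rare and the bound on
  \<open>n\<close> makes repeated vertices rare. \<open>q\<close> is chosen so that the cost
  \<open>r / \<delta>\<close> of one more prescribed edge, the loss n^(1/(m-1)) in the gap and one
  factor \<open>q\<close> multiply to a constant.\<close>

lemma exists_linear_cycle_avoiding:
  fixes r l n :: nat and t \<alpha> \<kappa> :: real and V :: "'a set" and F :: "nat \<Rightarrow> 'a set set set"
  defines "m \<equiv> l + l"
  defines "q \<equiv> t * real n powr (real (r - 2) - 1 / real (m - 1))"
  assumes r: "4 \<le> r" and l: "2 \<le> l"
    and \<alpha>: "0 < \<alpha>" "\<alpha> < 1"
      "\<alpha> * (2 ^ m * 16 * real r ^ 2 * (512 * real r ^ 8) * (8 * real r ^ 2) ^ m * real m ^ Suc m) \<le> 1 / 4"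
    and \<kappa>: "4 * real m ^ 2 * \<kappa> \<le> \<alpha>"
    and t: "16 * real m ^ 2 * real r * real (r + m) \<le> t"
    and n: "(2048 * real m ^ 2 * real r ^ 7) ^ 3 \<le> real n"
    and H: "r_graph r V E" "card V = n" "real (card E) = t * real n ^ (r - 1)"
    and F: "\<And>j J. J \<in> F j \<Longrightarrow> J \<subseteq> E \<and> card J = j"
      "\<And>j. j \<in> {1..m} \<Longrightarrow> real (card (F j)) \<le> \<kappa> * (t * real n ^ (r - 1)) * q ^ (j - 1)"
  shows "\<exists>C\<in>lc_copies r m V E. card C = m \<and> (\<forall>j\<in>{1..m}. \<forall>J\<in>F j. \<not> J \<subseteq> C)"
proof -
  have m4: "4 \<le> m" using l by (simp add: m_def)
  have r1: "1 \<le> real r" and m1: "1 \<le> real m" using r m4 by auto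
  have V: "finite V" and EV: "\<And>e. e \<in> E \<Longrightarrow> e \<subseteq> V \<and> card e = r" using H(1) by (auto simp: r_graph_def)
  have finE: "finite E" using V EV by (intro finite_subset[of E "Pow V"]) auto
  have finF: "finite (F j)" for j using F(1) finE by (intro finite_subset[of "F j" "Pow E"]) auto
  have n1: "1 \<le> real n"
  proof -
    have "1 \<le> 2048 * real m ^ 2 * real r ^ 7"
      using r1 m1 by (simp add: mult_ge1_I one_le_power)
    then have "1 \<le> (2048 * real m ^ 2 * real r ^ 7) ^ 3" by (rule one_le_power)
    then show ?thesis using n by linarith
  qed
  have t4: "4 \<le> t"
  proof -
    have "1 \<le> real m ^ 2 * real r * real (r + m)"
      using r1 m1 by (intro mult_ge1_I one_le_power) auto
    then show ?thesis using t by linarith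
  qed
  define T where "T = t * real n ^ (r - 1)"
  have T: "0 < T" using t4 n1 by (simp add: T_def)
  have q: "0 < q" using t4 n1 by (simp add: q_def)

  \<comment> \<open>Edges in too many forbidden sets are deleted. For \<open>j = 1\<close> the
    threshold is \<open>\<alpha> < 1\<close>, so every forbidden single edge disappears
    here.\<close>
  define bad where "bad j = {e \<in> E. \<alpha> * q ^ (j - 1) < real (card {J \<in> F j. e \<in> J})}" for j
  define E1 where "E1 = E - (\<Union>j\<in>{1..m}. bad j)"
  have card_bad: "real (card (bad j)) \<le> real m * \<kappa> * T / \<alpha>" if j: "j \<in> {1..m}" for j
  proof -
    have "\<alpha> * q ^ (j - 1) * real (card (bad j)) \<le> real j * real (card (F j))"
      unfolding bad_def using \<alpha> q by (intro card_overloaded_le finE finF F(1)) auto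
    also have "\<dots> \<le> real m * (\<kappa> * T * q ^ (j - 1))"
      using j F(2)[OF j] by (intro mult_mono) (auto simp: T_def)
    finally have "q ^ (j - 1) * (\<alpha> * real (card (bad j))) \<le> q ^ (j - 1) * (real m * \<kappa> * T)"
      by (simp add: mult_ac)
    then have "\<alpha> * real (card (bad j)) \<le> real m * \<kappa> * T"
      using q by (meson mult_left_le_imp_le zero_less_power)
    then show ?thesis using \<alpha> by (simp add: field_simps)
  qed
  have large: "3 / 4 * (t * real (card V) ^ (r - 1)) \<le> real (card E1)"
  proof -
    have sub: "(\<Union>j\<in>{1..m}. bad j) \<subseteq> E" by (auto simp: bad_def)
    have "card (\<Union>j\<in>{1..m}. bad j) \<le> (\<Sum>j\<in>{1..m}. card (bad j))" by (rule card_UN_le) simp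
    then have "real (card (\<Union>j\<in>{1..m}. bad j)) \<le> real (\<Sum>j\<in>{1..m}. card (bad j))" by (rule of_nat_mono)
    also have "\<dots> = (\<Sum>j\<in>{1..m}. real (card (bad j)))" by simp
    also have "\<dots> \<le> (\<Sum>j\<in>{1..m}. real m * \<kappa> * T / \<alpha>)" by (intro sum_mono card_bad)
    also have "\<dots> = 4 * real m ^ 2 * \<kappa> * (T / (4 * \<alpha>))" using \<alpha> by (simp add: power2_eq_square field_simps)
    also have "\<dots> \<le> \<alpha> * (T / (4 * \<alpha>))" using \<kappa> T \<alpha> by (intro mult_right_mono) auto
    also have "\<dots> = T / 4" using \<alpha> by simp
    finally have "real (card (\<Union>j\<in>{1..m}. bad j)) \<le> T / 4" .
    moreover have "card E1 = card E - card (\<Union>j\<in>{1..m}. bad j)"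
      unfolding E1_def using sub finE by (intro card_Diff_subset finite_subset[OF sub])
    moreover have "card (\<Union>j\<in>{1..m}. bad j) \<le> card E" using sub finE by (rule card_mono[rotated])
    ultimately show ?thesis using H(2,3) by (simp add: T_def of_nat_diff)
  qed
  define s where "s = real n powr (2 / 3)"
  have s: "0 < s" using n1 by (simp add: s_def)
  obtain E0 U where E0: "E0 \<subseteq> E1" and U: "U \<subseteq> V" "U \<noteq> {}"
    and degU: "\<And>x. x \<in> U \<Longrightarrow> (real (codeg E0 {x}) + t * real n ^ (r - 2)) / (8 * real r)
        \<le> (\<Sum>y\<in>U. if light E0 r s x y then real (codeg E0 {x, y}) else 0)"
    and cod: "\<And>Q v. v \<notin> Q \<Longrightarrow> t / 4 * real (codeg E0 (insert v Q)) \<le> real r * real (codeg E0 Q)"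
  proof (rule exists_clean_core[OF V _ _ r t4 large])
    show "1 \<le> card V" using n1 H(2) by simp
    show "e \<subseteq> V \<and> card e = r" if "e \<in> E1" for e using that EV by (auto simp: E1_def)
  qed (use H(2) that in \<open>simp add: s_def\<close>)
  have E0E: "E0 \<subseteq> E" using E0 by (auto simp: E1_def)
  have finE0: "finite E0" using finite_subset[OF E0E finE] .
  have E0V: "e \<subseteq> V \<and> card e = r" if "e \<in> E0" for e using that E0E EV by auto
  have finU: "finite U" using U V finite_subset by blast
  define w where "w x y = (if light E0 r s x y then real (codeg E0 {x, y}) else 0)" for x y
  \<comment> \<open>\<open>\<delta>\<close> is the absolute term of the degree bound. In
    \<open>\<rho>\<close> a factor \<open>8 * r\<close> comes from the proportional term and a
    factor \<open>r\<close> from the definition of light pairs.\<close>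
  define \<delta> where "\<delta> = t * real n ^ (r - 2) / (8 * real r)"
  define \<rho> where "\<rho> = 8 * real r ^ 2 / s"
  have \<delta>: "0 < \<delta>" using t4 n1 r1 by (simp add: \<delta>_def)
  have degw: "real (codeg E0 {x}) / (8 * real r) + \<delta> \<le> (\<Sum>y\<in>U. w x y)" if "x \<in> U" for x
    using degU[OF that] by (simp add: w_def \<delta>_def add_divide_distrib)
  interpret W: weighted_graph U w
  proof
    show "w x y = w y x" for x y unfolding w_def by (simp add: light_sym[of E0 r s x y] insert_commute)
    fix x assume "x \<in> U"
    moreover have "0 \<le> real (codeg E0 {x}) / (8 * real r)" by simp
    ultimately show "0 < (\<Sum>y\<in>U. w x y)" using degw[of x] \<delta> by linarith
  qed (simp_all add: finU w_def)
  have degc: "real (codeg E0 {x}) \<le> 8 * real r * W.deg x" if "x \<in> U" for x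
  proof -
    have "real (codeg E0 {x}) / (8 * real r) \<le> W.deg x" using degw[OF that] \<delta> by (simp add: W.deg_def)
    then show ?thesis using r1 by (simp add: field_simps)
  qed
  have \<delta>_deg: "\<delta> \<le> W.deg x" if "x \<in> U" for x
  proof -
    have "0 \<le> real (codeg E0 {x}) / (8 * real r)" by simp
    then show ?thesis using degw[OF that] unfolding W.deg_def by linarith
  qed
  have step: "W.step x y \<le> \<rho>" if x: "x \<in> U" for x y
  proof -
    have "w x y * s \<le> real (r - 1) * real (codeg E0 {x})" by (simp add: w_def light_def)
    also have "\<dots> \<le> real r * (8 * real r * W.deg x)"
      using degc[OF x] by (intro mult_mono) auto
    finally show ?thesis
      using s W.deg_gt_0[OF x] by (simp add: W.step_def \<rho>_def field_simps power2_eq_square)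
  qed
  interpret CH: clean_hypergraph U w E0 "light E0 r s" r l \<delta> \<rho>
    by unfold_locales (use finE0 E0V r l \<delta> \<delta>_deg step in \<open>auto simp: w_def light_def\<close>)
  have vol: "W.vol / \<delta> \<le> 8 * real r ^ 3 * real n"
  proof -
    have "W.vol \<le> (\<Sum>x\<in>U. \<Sum>y\<in>U. real (codeg E0 {x, y}))"
      unfolding W.vol_def W.deg_def by (intro sum_mono) (simp add: w_def)
    also have "\<dots> \<le> (\<Sum>x\<in>U. \<Sum>y\<in>V. real (codeg E0 {x, y}))"
      using U V by (intro sum_mono sum_mono2) auto
    also have "\<dots> \<le> (\<Sum>x\<in>V. \<Sum>y\<in>V. real (codeg E0 {x, y}))"
      using U V by (intro sum_mono2) (auto intro: sum_nonneg)
    also have "\<dots> = real (\<Sum>x\<in>V. \<Sum>y\<in>V. codeg E0 {x, y})" by simp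
    also have "\<dots> = real (r * r * card E0)"
      using sum_codeg_ordered_pairs(1)[OF V finE0 E0V] by simp
    also have "\<dots> \<le> real r ^ 2 * T"
      using card_mono[OF finE E0E] H(3) by (simp add: T_def power2_eq_square mult_left_mono)
    also have "\<dots> = 8 * real r ^ 3 * real n * \<delta>"
    proof -
      have "r - 1 = Suc (r - 2)" using r by simp
      then have "real n ^ (r - 1) = real n * real n ^ (r - 2)" by (simp only: power_Suc)
      then show ?thesis using r1 by (simp add: T_def \<delta>_def power2_eq_square power3_eq_cube)
    qed
    finally show ?thesis using \<delta> by (simp add: field_simps)
  qed
  have volnn: "0 \<le> W.vol / \<delta>" using W.vol_nonneg \<delta> by simp
  have n_s: "real n / s = real n powr (1 / 3)"
    using n1 powr_diff[of "real n" 1 "2 / 3"] by (simp add: s_def)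
  have \<rho>: "0 \<le> \<rho>" using s by (simp add: \<rho>_def)
  define B where "B = 64 * real r ^ 5"
  have X: "W.vol * W.step x y / W.deg y \<le> B * real n powr (1 / 3)" if "x \<in> U" "y \<in> U" for x y
  proof -
    have "W.vol * W.step x y / W.deg y \<le> W.vol * \<rho> / \<delta>"
      using step[OF that(1)] \<delta>_deg[OF that(2)] W.vol_nonneg \<delta> \<rho>
      by (intro frac_le mult_left_mono mult_nonneg_nonneg) auto
    also have "\<dots> = W.vol / \<delta> * \<rho>" by simp
    also have "\<dots> \<le> 8 * real r ^ 3 * real n * \<rho>" using vol \<rho> by (rule mult_right_mono)
    also have "\<dots> = B * (real n / s)" by (simp add: \<rho>_def B_def flip: power_add)
    finally show ?thesis by (simp only: n_s)
  qed
  have B1: "1 \<le> B" using r1 by (simp add: B_def mult_ge1_I one_le_power)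
  define A where "A = 512 * real r ^ 8"
  have A0: "0 \<le> A" by (simp add: A_def)
  have BA: "B \<le> A"
    unfolding A_def B_def using r1 by (intro mult_mono power_increasing) auto
  \<comment> \<open>The exponent reaches 1 at \<open>j = m\<close>, where
    \<open>vol / \<delta>\<close>, of order \<open>n\<close>, has to be covered. \<open>A\<close> is
    the constant of the two-gap bound and dominates the other ones.\<close>
  define N where "N j = A * real n powr (real (j - 1) / real (m - 1))" for j :: nat
  define L where "L j = \<alpha> * q ^ (j - 1)" for j :: nat
  have n13: "2048 * real m ^ 2 * real r ^ 7 \<le> real n powr (1 / 3)"
  proof -
    have "2048 * real m ^ 2 * real r ^ 7 = ((2048 * real m ^ 2 * real r ^ 7) ^ 3) powr (1 / 3)"
      using r1 m1 by (simp add: powr_powr flip: powr_numeral)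
    also have "\<dots> \<le> real n powr (1 / 3)" using n by (intro powr_mono2) auto
    finally show ?thesis .
  qed
  have powr1: "1 \<le> real n powr (real (j - 1) / real (m - 1))" for j
    using n1 by (intro ge_one_powr_ge_zero) auto
  have gap: "W.dens (l + l - j) x y \<le> N j * (CH.return x + CH.return y)"
    if "2 \<le> j" "j < l + l" "x \<in> U" "y \<in> U" for j x y
  proof -
    have "W.dens (l + l - j) x y \<le> B * real n powr (real (j - 1) / real (m - 1)) * (CH.return x + CH.return y)"
      unfolding m_def using X B1 n1 that by (intro CH.dens_gap_le_powr) auto
    also have "\<dots> \<le> N j * (CH.return x + CH.return y)"
      unfolding N_def using BA CH.return_nonneg by (intro mult_right_mono add_nonneg_nonneg) auto
    finally show ?thesis .
  qed
  have two: "real r * \<rho>\<^sup>2 * (W.vol / \<delta>) \<le> N j" for j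
  proof -
    \<comment> \<open>Two gaps cost \<open>n / s^2\<close>, which is at most 1, so here no growing
      power of \<open>n\<close> is required.\<close>
    have ss: "real n \<le> s * s"
    proof -
      have "s * s = real n powr (4 / 3)" by (simp add: s_def flip: powr_add)
      moreover have "real n powr 1 \<le> real n powr (4 / 3)" using n1 by (intro powr_mono) auto
      ultimately show ?thesis using n1 by simp
    qed
    have "real r * \<rho>\<^sup>2 * (W.vol / \<delta>) \<le> real r * \<rho>\<^sup>2 * (8 * real r ^ 3 * real n)"
      using vol by (intro mult_left_mono) auto
    also have "\<dots> = A * (real n / (s * s))"
      by (simp add: \<rho>_def A_def power2_eq_square power3_eq_cube numeral_eq_Suc)
    also have "\<dots> \<le> A * real n powr (real (j - 1) / real (m - 1))"
      using ss s powr1[of j] A0 by (intro mult_left_mono order_trans[OF _ powr1]) (auto simp: divide_simps)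
    finally show ?thesis by (simp add: N_def)
  qed
  have full: "W.vol / \<delta> \<le> N (l + l)"
  proof -
    have "N (l + l) = A * real n" using l n1 by (simp add: N_def m_def)
    moreover have "8 * real r ^ 3 \<le> A"
      unfolding A_def using r1 by (intro mult_mono power_increasing) auto
    ultimately show ?thesis using vol n1 mult_right_mono[of "8 * real r ^ 3" A "real n"] by linarith
  qed
  have small1: "real (l + l) ^ 2 * (\<rho> * (B * real n powr (1 / 3))) \<le> 1 / 4"
  proof -
    have 1: "\<rho> * real n powr (1 / 3) = 8 * real r ^ 2 / real n powr (1 / 3)"
    proof -
      have "s = real n powr (1 / 3) * real n powr (1 / 3)" by (simp add: s_def flip: powr_add)
      then show ?thesis using n1 by (simp add: \<rho>_def)
    qed
    have "real (l + l) ^ 2 * (\<rho> * (B * real n powr (1 / 3))) = real m ^ 2 * B * (\<rho> * real n powr (1 / 3))"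
      by (simp add: m_def)
    also have "\<dots> = 512 * real m ^ 2 * real r ^ 7 / real n powr (1 / 3)"
      unfolding 1 by (simp add: B_def flip: power_add)
    also have "\<dots> \<le> 1 / 4" using n13 n1 by (simp add: field_simps)
    finally show ?thesis .
  qed
  define \<eta> where "\<eta> = 4 * real r / t"
  have \<eta>0: "0 \<le> \<eta>" using t4 by (simp add: \<eta>_def)
  have \<eta>: "real (codeg E0 (insert v Q)) \<le> \<eta> * real (codeg E0 Q)" if "v \<notin> Q" for v Q
    using cod[OF that] t4 by (simp add: \<eta>_def field_simps)
  have small2: "real (l + l) ^ 2 * (real (r + (l + l)) * \<eta>) \<le> 1 / 4"
    using t t4 by (simp add: \<eta>_def m_def field_simps)
  have small3: "2 ^ (l + l) * (2 * real r * (8 * real r) * (real r / \<delta>) ^ (j - 1) * N j * real j ^ Suc j * L j) \<le> 1 / 4"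
    if j: "2 \<le> j" "j \<le> l + l" for j
  proof -
    \<comment> \<open>In \<open>r / \<delta> * n powr (1 / (m - 1)) * q\<close> all powers of
      \<open>n\<close> and \<open>t\<close> cancel and only \<open>8 * r ^ 2\<close> is left. This
      is why thresholds of the form \<open>\<alpha> * q ^ (j - 1)\<close> work for all
      \<open>j\<close> at once.\<close>
    have np: "real n powr (1 / real (m - 1)) * real n powr (real (r - 2) - 1 / real (m - 1)) = real n ^ (r - 2)"
      using n1 by (simp add: powr_realpow flip: powr_add)
    have "real r / \<delta> * real n powr (1 / real (m - 1)) * q
      = real r / \<delta> * t * (real n powr (1 / real (m - 1)) * real n powr (real (r - 2) - 1 / real (m - 1)))"
      by (simp add: q_def)
    also have "\<dots> = 8 * real r ^ 2"
      unfolding np using t4 n1 r1 by (simp add: \<delta>_def power2_eq_square)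
    finally have eq: "real r / \<delta> * real n powr (1 / real (m - 1)) * q = 8 * real r ^ 2" .
    have "real n powr (real (j - 1) / real (m - 1)) = (real n powr (1 / real (m - 1))) ^ (j - 1)"
      using n1 by (simp add: powr_powr flip: powr_realpow)
    then have "(real r / \<delta>) ^ (j - 1) * N j * L j
      = A * \<alpha> * (real r / \<delta> * real n powr (1 / real (m - 1)) * q) ^ (j - 1)"
      unfolding N_def L_def power_mult_distrib by (simp only: mult_ac)
    then have "(real r / \<delta>) ^ (j - 1) * N j * L j = A * \<alpha> * (8 * real r ^ 2) ^ (j - 1)"
      unfolding eq .
    then have "2 ^ (l + l) * (2 * real r * (8 * real r) * (real r / \<delta>) ^ (j - 1) * N j * real j ^ Suc j * L j)
       = 2 ^ m * 16 * real r ^ 2 * (A * \<alpha> * (8 * real r ^ 2) ^ (j - 1)) * real j ^ Suc j"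
      unfolding m_def power2_eq_square by (simp add: mult_ac del: power_Suc)
    also have "\<dots> \<le> 2 ^ m * 16 * real r ^ 2 * (A * \<alpha> * (8 * real r ^ 2) ^ m) * real m ^ Suc m"
    proof -
      have 8: "1 \<le> 8 * real r ^ 2" using r1 by (simp add: mult_ge1_I one_le_power)
      have "(8 * real r ^ 2) ^ (j - 1) \<le> (8 * real r ^ 2) ^ m" using 8 j by (intro power_increasing) (auto simp: m_def)
      moreover have "real j ^ Suc j \<le> real m ^ Suc m"
      proof -
        have "real j ^ Suc j \<le> real m ^ Suc j" using j by (intro power_mono) (auto simp: m_def)
        also have "\<dots> \<le> real m ^ Suc m" using m1 j by (intro power_increasing) (auto simp: m_def)
        finally show ?thesis .
      qed
      ultimately show ?thesis using A0 \<alpha> by (intro mult_mono mult_nonneg_nonneg) auto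
    qed
    also have "\<dots> = \<alpha> * (2 ^ m * 16 * real r ^ 2 * (512 * real r ^ 8) * (8 * real r ^ 2) ^ m * real m ^ Suc m)"
      by (simp add: A_def mult_ac)
    also have "\<dots> \<le> 1 / 4" by (rule \<alpha>(3))
    finally show ?thesis .
  qed
  have Fdeg: "real (card {J \<in> F j. e \<in> J}) \<le> L j" if "1 \<le> j" "j \<le> m" "e \<in> E0" for j e
  proof -
    have "e \<in> E" "e \<notin> bad j" using that E0 by (auto simp: E1_def)
    then show ?thesis by (auto simp: bad_def L_def)
  qed
  obtain xs es where xs: "xs \<in> PiE {..<l + l} (\<lambda>_. U)" and es: "es \<in> PiE {..<l + l} (\<lambda>_. E0)"
    and pos: "0 < CH.conf xs es" and inj: "inj_on xs {..<l + l}"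
    and clash: "\<And>i k. i < l + l \<Longrightarrow> k < l + l \<Longrightarrow> i \<noteq> k \<Longrightarrow> \<not> CH.clash xs k (es i) (es k)"
    and avoid: "\<And>I. I \<subseteq> {..<l + l} \<Longrightarrow> 2 \<le> card I \<Longrightarrow> es ` I \<notin> F (card I)"
  proof (rule CH.exists_good_config[OF U(2) X \<eta>0 \<eta> _ degc _ gap two full finF _ Fdeg _ small1 small2 small3])
    show "0 \<le> N j" for j using A0 by (simp add: N_def)
    show "0 \<le> L j" for j using \<alpha> q by (simp add: L_def)
  qed (use F(1) that in \<open>auto simp: m_def\<close>)
  have mem: "xs i \<in> es i \<and> xs (Suc i mod m) \<in> es i" if "i < m" for i
  proof (rule ccontr)
    assume "\<not> ?thesis"
    then have "CH.conf xs es = 0"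
      unfolding CH.conf_def using that by (intro prod_zero) (auto simp: CH.wt_def m_def intro!: bexI[of _ i])
    then show False using pos by simp
  qed
  have esE0: "es i \<in> E0" if "i < m" for i using es that by (auto simp: m_def)
  have copy: "es ` {..<m} \<in> lc_copies r m V E" and injes: "inj_on es {..<m}"
  proof -
    have *: "(es j - {xs j, xs (Suc j mod m)}) \<inter> (es i \<union> xs ` {..<m}) = {}" if "i < m" "j < m" "i \<noteq> j" for i j
      using clash[of i j] that by (auto simp: CH.clash_def m_def)
    show "es ` {..<m} \<in> lc_copies r m V E"
      by (rule cyclic_edges_form_linear_cycle(1)[where xs=xs])
        (use r m4 inj mem esE0 E0E E0V * in \<open>auto simp: m_def\<close>)
    show "inj_on es {..<m}"
      by (rule cyclic_edges_form_linear_cycle(2)[where xs=xs and r=r and V=V and E=E])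
        (use r m4 inj mem esE0 E0E E0V * in \<open>auto simp: m_def\<close>)
  qed
  have "\<not> J \<subseteq> es ` {..<m}" if j: "j \<in> {1..m}" and J: "J \<in> F j" for j J
  proof
    assume "J \<subseteq> es ` {..<m}"
    then obtain I where I: "I \<subseteq> {..<m}" "inj_on es I" "J = es ` I" by (auto simp: subset_image_inj)
    then have cI: "card I = j" using F(1)[OF J] by (simp add: card_image)
    show False
    proof (cases "j = 1")
      case True
      then obtain i where "I = {i}" using cI card_1_singletonE by blast
      then have "es i \<in> E0" "es i \<in> J" using I esE0 by auto
      then have "{J} \<subseteq> {J \<in> F 1. es i \<in> J}" using J True by auto
      then have "card {J} \<le> card {J \<in> F 1. es i \<in> J}" using finF by (intro card_mono) auto
      then have "1 \<le> card {J \<in> F 1. es i \<in> J}" by simp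
      moreover have "real (card {J \<in> F 1. es i \<in> J}) \<le> L 1" using \<open>es i \<in> E0\<close> m4 by (intro Fdeg) auto
      ultimately show False using \<alpha> by (simp add: L_def)
    next
      case False
      then show False using avoid[of I] I J cI j by (auto simp: m_def)
    qed
  qed
  moreover have "card (es ` {..<m}) = m" using injes by (simp add: card_image)
  ultimately show ?thesis using copy by blast
qed

section \<open>Balanced collections\<close>

text \<open>Copies are added one at a time. A \<open>j\<close>-set lying in more than
  \<open>B j\<close> of them is saturated and forbidden to the next copy, which \<open>avoid\<close>
  supplies as long as there are few saturated sets. Since \<open>B j \<ge> 1\<close>, an unsaturated
  set lies in at most \<open>2 * B j\<close> copies after the addition.\<close>

lemma exists_balanced_collection:
  fixes E :: "'b set" and \<C> :: "'b set set" and m :: nat and \<kappa> T q :: real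
  assumes E: "finite E" and \<C>: "\<And>C. C \<in> \<C> \<Longrightarrow> C \<subseteq> E"
    and m: "2 \<le> m" and \<kappa>: "0 < \<kappa>" and T: "0 < T" and q: "1 \<le> q"
    and avoid: "\<And>F. (\<And>j J. J \<in> F j \<Longrightarrow> J \<subseteq> E \<and> card J = j) \<Longrightarrow>
      (\<And>j. j \<in> {1..m} \<Longrightarrow> real (card (F j)) \<le> \<kappa> * T * q ^ (j - 1)) \<Longrightarrow>
      \<exists>C\<in>\<C>. card C = m \<and> (\<forall>j\<in>{1..m}. \<forall>J\<in>F j. \<not> J \<subseteq> C)"
  obtains S where "S \<subseteq> \<C>" "S \<noteq> {}" "\<And>C. C \<in> S \<Longrightarrow> card C = m"
    "\<And>J. card J \<in> {1..m} \<Longrightarrow>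
      real (card {C \<in> S. J \<subseteq> C}) \<le> 2 * 2 ^ m / \<kappa> * real (card S) / (T * q ^ (card J - 1))"
proof -
  \<comment> \<open>The target size has the order of the bound that \<open>avoid\<close> puts on
    \<open>F m\<close>, so that \<open>S\<close> itself can be forbidden for \<open>j = m\<close>,
    and it is large enough to give \<open>B j \<ge> 1\<close>.\<close>
  define N where "N = nat \<lceil>\<kappa> / 2 * T * q ^ (m - 1)\<rceil>"
  \<comment> \<open>Fewer than \<open>N\<close> copies have at most \<open>N * 2 ^ m\<close> subsets
    in total, with multiplicity, and each saturated \<open>j\<close>-set accounts for at least
    \<open>B j\<close> of them. This leaves at most \<open>\<kappa> * T * q ^ (j - 1)\<close>
    saturated sets.\<close>
  define B where "B j = 2 ^ m / \<kappa> * real N / (T * q ^ (j - 1))" for j :: nat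
  have pos: "0 < \<kappa> / 2 * T * q ^ (m - 1)" using \<kappa> T q by simp
  have N: "\<kappa> / 2 * T * q ^ (m - 1) \<le> real N" "real N < \<kappa> / 2 * T * q ^ (m - 1) + 1"
    unfolding N_def using pos by linarith+
  have N1: "1 \<le> N" using pos N(1) by (cases N) auto
  have B1: "1 \<le> B j" if "j \<in> {1..m}" for j
  proof -
    have "T * q ^ (j - 1) \<le> T * q ^ (m - 1)" using that T q by (intro mult_left_mono power_increasing) auto
    also have "\<dots> \<le> 2 ^ m / \<kappa> * (\<kappa> / 2 * T * q ^ (m - 1))"
    proof -
      have "2 \<le> (2::real) ^ m" using m power_increasing[of 1 m "2::real"] by simp
      then show ?thesis using \<kappa> T q mult_right_mono[of 2 "2 ^ m" "T * q ^ (m - 1)"] by simp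
    qed
    also have "\<dots> \<le> 2 ^ m / \<kappa> * real N" using N(1) \<kappa> by (intro mult_left_mono) auto
    finally have "T * q ^ (j - 1) \<le> 2 ^ m / \<kappa> * real N" .
    moreover have "0 < T * q ^ (j - 1)" using T q by simp
    ultimately show ?thesis unfolding B_def by (simp only: le_divide_eq_1_pos)
  qed
  have "\<exists>S. S \<subseteq> \<C> \<and> card S = s \<and> (\<forall>C\<in>S. card C = m)
      \<and> (\<forall>J. card J \<in> {1..m} \<longrightarrow> real (card {C \<in> S. J \<subseteq> C}) \<le> 2 * B (card J))" if "s \<le> N" for s
    using that
  proof (induction s)
    case 0
    have "0 \<le> 2 * B j" for j using \<kappa> T q by (simp add: B_def)
    then show ?case by (intro exI[of _ "{}"]) auto
  next
    case (Suc s)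
    then obtain S where S: "S \<subseteq> \<C>" "card S = s" "\<And>C. C \<in> S \<Longrightarrow> card C = m"
      and inv: "\<And>J. card J \<in> {1..m} \<Longrightarrow> real (card {C \<in> S. J \<subseteq> C}) \<le> 2 * B (card J)" by auto
    have SE: "S \<subseteq> Pow E" using S(1) \<C> by auto
    have finS: "finite S" using finite_subset[OF SE] E by simp
    \<comment> \<open>the saturated sets; taking \<open>S\<close> itself for \<open>j = m\<close> forces the next copy to be new\<close>
    define F where "F j = (if j = m then S else {J. J \<subseteq> E \<and> card J = j \<and> B j < real (card {C \<in> S. J \<subseteq> C})})" for j
    have F1: "J \<subseteq> E \<and> card J = j" if "J \<in> F j" for j J
      using that SE S(3) by (auto simp: F_def split: if_splits)
    have F2: "real (card (F j)) \<le> \<kappa> * T * q ^ (j - 1)" if j: "j \<in> {1..m}" for j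
    proof (cases "j = m")
      case True
      have "real s < \<kappa> / 2 * T * q ^ (m - 1)" using N(2) Suc.prems by linarith
      also have "\<dots> \<le> \<kappa> * T * q ^ (m - 1)" using \<kappa> T q by simp
      finally show ?thesis using True S(2) by (simp add: F_def)
    next
      case False
      have finF: "finite (F j)" using False E by (auto simp: F_def intro: finite_subset[of _ "Pow E"])
      have "B j * real (card (F j)) = (\<Sum>J\<in>F j. B j)" by simp
      also have "\<dots> \<le> (\<Sum>J\<in>F j. real (card {C \<in> S. J \<subseteq> C}))"
        using False by (intro sum_mono) (auto simp: F_def)
      also have "\<dots> = (\<Sum>J\<in>F j. \<Sum>C\<in>{C \<in> S. J \<subseteq> C}. 1)" by simp
      also have "\<dots> = (\<Sum>C\<in>S. \<Sum>J\<in>{J \<in> F j. J \<subseteq> C}. 1)" by (rule sum.swap_restrict[OF finF finS])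
      also have "\<dots> \<le> (\<Sum>C\<in>S. 2 ^ m)"
      proof (rule sum_mono)
        fix C assume C: "C \<in> S"
        then have "finite C" using SE E finite_subset by blast
        then have "card {J \<in> F j. J \<subseteq> C} \<le> card (Pow C)" by (intro card_mono) auto
        also have "\<dots> = 2 ^ m" using card_Pow[OF \<open>finite C\<close>] S(3)[OF C] by simp
        finally have "real (card {J \<in> F j. J \<subseteq> C}) \<le> real (2 ^ m)" by (rule of_nat_mono)
        then show "(\<Sum>J\<in>{J \<in> F j. J \<subseteq> C}. 1 :: real) \<le> 2 ^ m" by simp
      qed
      also have "\<dots> \<le> real N * 2 ^ m" using S(2) Suc.prems by simp
      finally have "2 ^ m * real N * real (card (F j)) \<le> 2 ^ m * real N * (\<kappa> * T * q ^ (j - 1))"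
        using \<kappa> T q by (simp add: B_def field_simps)
      then show ?thesis using N1 by (simp add: mult_le_cancel_left)
    qed
    obtain C where C: "C \<in> \<C>" "card C = m" "\<And>j J. j \<in> {1..m} \<Longrightarrow> J \<in> F j \<Longrightarrow> \<not> J \<subseteq> C"
      using avoid[of F, OF F1 F2] by blast
    have "C \<notin> S" using C(3)[of m C] m by (auto simp: F_def)
    then have cS: "card (insert C S) = Suc s" using finS S(2) by simp
    have "real (card {C' \<in> insert C S. J \<subseteq> C'}) \<le> 2 * B (card J)" if J: "card J \<in> {1..m}" for J
    proof (cases "J \<subseteq> C")
      case False
      then have "{C' \<in> insert C S. J \<subseteq> C'} = {C' \<in> S. J \<subseteq> C'}" by auto
      then show ?thesis using inv[OF J] by simp
    next
      case True
      then have JE: "J \<subseteq> E" using \<C> C(1) by blast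
      show ?thesis
      proof (cases "card J = m")
        case jm: True
        have "{C' \<in> insert C S. J \<subseteq> C'} \<subseteq> {J}"
        proof
          fix C' assume C': "C' \<in> {C' \<in> insert C S. J \<subseteq> C'}"
          then have "card C' = m" using C(2) S(3) by auto
          moreover have "C' \<subseteq> E" using C' S(1) C(1) \<C> by auto
          then have "finite C'" using E by (rule finite_subset)
          ultimately show "C' \<in> {J}" using C' jm card_subset_eq[of C' J] by auto
        qed
        then have "card {C' \<in> insert C S. J \<subseteq> C'} \<le> card {J}" by (intro card_mono) auto
        then show ?thesis using B1[OF J] by simp
      next
        case False
        have "J \<notin> F (card J)" using C(3)[OF J] True by blast
        then have "real (card {C' \<in> S. J \<subseteq> C'}) \<le> B (card J)" using False JE by (auto simp: F_def)
        moreover have "card {C' \<in> insert C S. J \<subseteq> C'} \<le> card (insert C {C' \<in> S. J \<subseteq> C'})"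
          using finS by (intro card_mono) auto
        moreover have "\<dots> \<le> Suc (card {C' \<in> S. J \<subseteq> C'})" using finS by (simp add: card_insert_if)
        ultimately show ?thesis using B1[OF J] by linarith
      qed
    qed
    then show ?case using S C cS by (intro exI[of _ "insert C S"]) auto
  qed
  then obtain S where S: "S \<subseteq> \<C>" "card S = N" "\<forall>C\<in>S. card C = m"
    "\<forall>J. card J \<in> {1..m} \<longrightarrow> real (card {C \<in> S. J \<subseteq> C}) \<le> 2 * B (card J)" by blast
  show ?thesis
  proof (rule that[of S])
    show "S \<noteq> {}" using S(2) N1 by auto
    show "real (card {C \<in> S. J \<subseteq> C}) \<le> 2 * 2 ^ m / \<kappa> * real (card S) / (T * q ^ (card J - 1))"
      if "card J \<in> {1..m}" for J
      using S(2,4) that by (simp add: B_def mult.assoc)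
  qed (use S in auto)
qed

theorem theorem2p5:
  fixes r l :: nat
  assumes "r \<ge> 4" and "l \<ge> 2"
  shows "\<exists>K>0. \<exists>c>0. \<forall>\<^sub>F n :: nat in sequentially. \<forall>t\<ge>K. \<forall>(V :: 'a set) (E :: 'a set set).
    r_graph r V E \<and> card V = n \<and> real (card E) = t * real n ^ (r - 1) \<longrightarrow>
    (\<exists>S. S \<subseteq> lc_copies r (2 * l) V E \<and> S \<noteq> {} \<and>
      (\<forall>j\<in>{1..2 * l}.
        real (max_codegree E j S) \<le>
          c * real (card S) * ln (real n) ^ (r - 2) / (t * real n ^ (r - 1)) *
          (inverse (t / ln (real n) ^ (r - 2)) *
            real n powr (- real r + 2 + 1 / (2 * real l - 1))) ^ (j - 1)))"
proof -
  define m where "m = l + l"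
  have m4: "4 \<le> m" using assms by (simp add: m_def)
  \<comment> \<open>\<open>D\<close> collects the factors in the condition on
    \<open>\<alpha>\<close>, so that \<open>\<alpha> * D = 1 / 4\<close>; \<open>\<kappa>\<close>
    and \<open>K\<close> are the extremal values that the construction of an avoiding cycle
    admits.\<close>
  define D where "D = 2 ^ m * 16 * real r ^ 2 * (512 * real r ^ 8) * (8 * real r ^ 2) ^ m * real m ^ Suc m"
  define \<alpha> where "\<alpha> = 1 / (4 * D)"
  define \<kappa> where "\<kappa> = \<alpha> / (4 * real m ^ 2)"
  define K where "K = 16 * real m ^ 2 * real r * real (r + m)"
  define c where "c = 2 * 2 ^ m / \<kappa>"
  have D1: "1 \<le> D"
    unfolding D_def using assms m4 by (intro mult_ge1_I one_le_power) auto
  have \<alpha>: "0 < \<alpha>" "\<alpha> < 1" "\<alpha> * D \<le> 1 / 4" using D1 by (auto simp: \<alpha>_def)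
  have \<kappa>: "0 < \<kappa>" "4 * real m ^ 2 * \<kappa> \<le> \<alpha>" using \<alpha> m4 by (auto simp: \<kappa>_def)
  have K: "1 \<le> K" unfolding K_def using assms m4 by (intro mult_ge1_I one_le_power) auto
  have c: "0 < c" using \<kappa> by (simp add: c_def)
  obtain n0 :: nat where n0: "(2048 * real m ^ 2 * real r ^ 7) ^ 3 \<le> real n0" using real_arch_simple by blast
  have main: "\<exists>S. S \<subseteq> lc_copies r (2 * l) V E \<and> S \<noteq> {} \<and>
      (\<forall>j\<in>{1..2 * l}.
        real (max_codegree E j S) \<le>
          c * real (card S) * ln (real n) ^ (r - 2) / (t * real n ^ (r - 1)) *
          (inverse (t / ln (real n) ^ (r - 2)) *
            real n powr (- real r + 2 + 1 / (2 * real l - 1))) ^ (j - 1))"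
    if n: "max 3 n0 \<le> n" and t: "K \<le> t"
      and H: "r_graph r V E" "card V = n" "real (card E) = t * real n ^ (r - 1)"
    for n t and V :: "'a set" and E :: "'a set set"
  proof -
    have n3: "3 \<le> n" and nn0: "(2048 * real m ^ 2 * real r ^ 7) ^ 3 \<le> real n" using n n0 by auto
    have t1: "1 \<le> t" using t K by linarith
    define T where "T = t * real n ^ (r - 1)"
    define q where "q = t * real n powr (real (r - 2) - 1 / real (m - 1))"
    have T: "0 < T" using t1 n3 by (simp add: T_def)
    have q1: "1 \<le> q"
    proof -
      have "1 / real (m - 1) \<le> 1" "1 \<le> real (r - 2)" using m4 assms by auto
      then have "1 / real (m - 1) \<le> real (r - 2)" by (rule order_trans)
      then have "1 \<le> real n powr (real (r - 2) - 1 / real (m - 1))"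
        using n3 by (intro ge_one_powr_ge_zero) simp_all
      then show ?thesis unfolding q_def using t1 by (intro mult_ge1_I)
    qed
    have finE: "finite E"
      using H(1) by (intro finite_subset[of E "Pow V"]) (auto simp: r_graph_def)
    obtain S where S: "S \<subseteq> lc_copies r m V E" "S \<noteq> {}" "\<And>C. C \<in> S \<Longrightarrow> card C = m"
      and bound: "\<And>J. card J \<in> {1..m} \<Longrightarrow>
        real (card {C \<in> S. J \<subseteq> C}) \<le> c * real (card S) / (T * q ^ (card J - 1))"
    proof (rule exists_balanced_collection[OF finE _ _ \<kappa>(1) T q1])
      show "C \<subseteq> E" if "C \<in> lc_copies r m V E" for C using that by (simp add: lc_copies_def)
      show "2 \<le> m" using m4 by simp
      show "\<exists>C\<in>lc_copies r m V E. card C = m \<and> (\<forall>j\<in>{1..m}. \<forall>J\<in>F j. \<not> J \<subseteq> C)"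
        if "\<And>j J. J \<in> F j \<Longrightarrow> J \<subseteq> E \<and> card J = j"
          "\<And>j. j \<in> {1..m} \<Longrightarrow> real (card (F j)) \<le> \<kappa> * T * q ^ (j - 1)" for F
        unfolding m_def
        by (rule exists_linear_cycle_avoiding[of r l \<alpha> \<kappa> t n V E F])
          (use assms \<alpha> \<kappa>(2) t nn0 H that in \<open>auto simp: m_def D_def K_def T_def q_def\<close>)
    qed (use that in \<open>auto simp: c_def\<close>)
    \<comment> \<open>The collection satisfies the bound without logarithms. From
      \<open>n \<ge> 3\<close> the power \<open>?L\<close> is at least 1, and inserting it into both
      factors only enlarges the right-hand side.\<close>
    let ?L = "ln (real n) ^ (r - 2)"
    have L: "1 \<le> ?L"
    proof -
      have "exp 1 \<le> real n" using exp_le n3 by linarith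
      then have "1 \<le> ln (real n)" using n3 by (subst ln_ge_iff) auto
      then show ?thesis by (rule one_le_power)
    qed
    have q_eq: "inverse (t / ?L) * real n powr (- real r + 2 + 1 / (2 * real l - 1)) = ?L / q"
    proof -
      have e: "- real r + 2 + 1 / (2 * real l - 1) = - (real (r - 2) - 1 / real (m - 1))"
        using assms by (simp add: m_def of_nat_diff)
      show ?thesis unfolding e powr_minus q_def by (simp add: divide_inverse)
    qed
    have "real (max_codegree E j S)
      \<le> c * real (card S) * ?L / (t * real n ^ (r - 1))
        * (inverse (t / ?L) * real n powr (- real r + 2 + 1 / (2 * real l - 1))) ^ (j - 1)"
      if j: "j \<in> {1..m}" for j
    proof -
      let ?A = "(\<lambda>J. card {C \<in> S. J \<subseteq> C}) ` {J. J \<subseteq> E \<and> card J = j}"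
      have finA: "finite ?A" using finE by (intro finite_imageI) auto
      \<comment> \<open>The maximum in \<open>max_codegree\<close> is attained since there are
        \<open>j\<close>-sets of edges: a member of \<open>S\<close> consists of
        \<open>m \<ge> j\<close> edges of \<open>E\<close>.\<close>
      obtain C where C: "C \<in> S" using S(2) by auto
      then have "C \<subseteq> E" "j \<le> card C" using S(1,3) j by (auto simp: lc_copies_def)
      then obtain J where "J \<subseteq> C" "card J = j" by (meson obtain_subset_with_card_n)
      then have "?A \<noteq> {}" using \<open>C \<subseteq> E\<close> by auto
      then have "max_codegree E j S \<in> ?A" unfolding max_codegree_def using finA by (rule Max_in[rotated])
      then obtain J where J: "card J = j" "max_codegree E j S = card {C \<in> S. J \<subseteq> C}" by auto
      have "real (max_codegree E j S) \<le> c * real (card S) / (T * q ^ (j - 1))"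
        using bound[of J] J j by simp
      also have "\<dots> = c * real (card S) / T * (1 / q) ^ (j - 1)" by (simp add: power_divide)
      also have "\<dots> \<le> c * real (card S) * ?L / T * (?L / q) ^ (j - 1)"
      proof (rule mult_mono)
        have "c * real (card S) \<le> c * real (card S) * ?L"
          using L c mult_left_mono[of 1 ?L "c * real (card S)"] by simp
        then show "c * real (card S) / T \<le> c * real (card S) * ?L / T"
          using T by (intro divide_right_mono) auto
        show "(1 / q) ^ (j - 1) \<le> (?L / q) ^ (j - 1)"
          using L q1 by (intro power_mono divide_right_mono) auto
      qed (use L T q1 c in auto)
      finally show ?thesis unfolding q_eq T_def .
    qed
    then show ?thesis using S(1,2) unfolding m_def mult_2 by blast
  qed
  have "\<forall>\<^sub>F n in sequentially. max 3 n0 \<le> n" by (rule eventually_ge_at_top)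
  moreover have "0 < K" using K by simp
  ultimately show ?thesis
    by (intro exI[of _ K] exI[of _ c] conjI c) (assumption, erule eventually_mono, blast intro: main)
qed

end
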